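(* Let $S$ be a subordinator, $d\in(-0.5,0)$ and $a>0$, and suppose that $S^{a,d}_t=\int_{\mathbb{R}}f_{a,d}(t,u)\,\mathrm{d}S_u$ exists for all $t\in\mathbb{R}$. (i) If $S$ has strictly increasing sample paths, then also $(S^{a,d}_t)_{t\ge0}$ has strictly increasing sample paths. (ii) The two-sided process $(S^{a,d}_t)_{t\in\mathbb{R}}$ has stationary increments. (iii) If $\mathbb{E}(S_1)<\infty$, then the following strong law of large numbers holds for the two-sided process $(S^{a,d}_t)_{t\in\mathbb{R}}$: $$\lim_{t\to\pm\infty}\frac1{|t|}\Big(S^{a,d}_t-\mathbb{E}(S_1)\int_{\mathbb{R}}f_{a,d}(t,u)\,\mathrm{d}u\Big)=0\quad\text{a.s.}$$
   Context: For $d\in(-0.5,0)$, $a>0$ the modified Mandelbrot-van-Ness kernel is $f_{a,d}(t,s)=(a+(-s)_+)^d-(a+(t-s)_+)^d$ for $t,s\in\mathbb{R}$, where $x_+=\max\{x,0\}$. A subordinator is a L\'evy process with almost surely increasing sample paths. It is extended to a two-sided process $(S_t)_{t\in\mathbb{R}}$ by $S_t=-S^{(1)}_{(-t)-}\mathbf{1}_{\{t<0\}}+S^{(2)}_t\mathbf{1}_{\{t\ge0\}}$, with $S^{(1)},S^{(2)}$ independent identically distributed copies of $S$. The integral defining $S^{a,d}_t$ is the limit in probability of integrals of approximating step functions (it exists for instance if $\mathbb{E}(S_1^2)<\infty$). Sample path statements refer to the modification of $(S^{a,d}_t)_{t\in\mathbb{R}}$ with continuous sample paths. *)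

theory Defs
  imports "HOL-Probability.Probability"
begin

definition mvn_kernel :: "real \<Rightarrow> real \<Rightarrow> real \<Rightarrow> real \<Rightarrow> real" where
  "mvn_kernel a d t s = (a + max (- s) 0) powr d - (a + max (t - s) 0) powr d"


subsection \<open>Processes\<close>

definition same_fdd ::
  "'a measure \<Rightarrow> real set \<Rightarrow> (real \<Rightarrow> 'a \<Rightarrow> real) \<Rightarrow> (real \<Rightarrow> 'a \<Rightarrow> real) \<Rightarrow> bool" where
  "same_fdd M T X Y \<longleftrightarrow> (\<forall>J. finite J \<and> J \<subseteq> T \<longrightarrow>
     distr M (\<Pi>\<^sub>M t\<in>J. borel) (\<lambda>\<omega>. \<lambda>t\<in>J. X t \<omega>) = distr M (\<Pi>\<^sub>M t\<in>J. borel) (\<lambda>\<omega>. \<lambda>t\<in>J. Y t \<omega>))"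

text \<open>For processes whose increments need not be independent: all finite-dimensional
  distributions of the increment process, not only the laws of single increments,
  are invariant under time shifts.\<close>

definition stationary_increments :: "'a measure \<Rightarrow> (real \<Rightarrow> 'a \<Rightarrow> real) \<Rightarrow> bool" where
  "stationary_increments M X \<longleftrightarrow> (\<forall>t. X t \<in> borel_measurable M) \<and>
     (\<forall>h. same_fdd M UNIV (\<lambda>t \<omega>. X (t + h) \<omega> - X h \<omega>) (\<lambda>t \<omega>. X t \<omega> - X 0 \<omega>))"

definition continuous_modification ::
  "'a measure \<Rightarrow> (real \<Rightarrow> 'a \<Rightarrow> real) \<Rightarrow> (real \<Rightarrow> 'a \<Rightarrow> real) \<Rightarrow> bool" where
  "continuous_modification M X Y \<longleftrightarrow>
     (\<forall>t. Y t \<in> borel_measurable M \<and> (AE \<omega> in M. Y t \<omega> = X t \<omega>)) \<and>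
     (AE \<omega> in M. continuous_on UNIV (\<lambda>t. Y t \<omega>))"

definition cadlag_on_nonneg :: "(real \<Rightarrow> real) \<Rightarrow> bool" where
  "cadlag_on_nonneg x \<longleftrightarrow>
     (\<forall>t\<ge>0. continuous (at_right t) x) \<and> (\<forall>t>0. \<exists>l. (x \<longlongrightarrow> l) (at_left t))"

text \<open>The time set is \<open>[0, \<infinity>)\<close>; values at negative times are irrelevant. Stochastic continuity
  is not listed because it follows from right continuity and stationarity of the increments.\<close>

definition levy_process :: "'a measure \<Rightarrow> (real \<Rightarrow> 'a \<Rightarrow> real) \<Rightarrow> bool" where
  "levy_process M L \<longleftrightarrow>
     (\<forall>t\<ge>0. L t \<in> borel_measurable M) \<and>
     (AE \<omega> in M. L 0 \<omega> = 0) \<and>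
     (\<forall>(n::nat) (t::nat \<Rightarrow> real). 0 \<le> t 0 \<and> (\<forall>i<n. t i \<le> t (Suc i)) \<longrightarrow>
        prob_space.indep_vars M (\<lambda>_. borel) (\<lambda>i \<omega>. L (t (Suc i)) \<omega> - L (t i) \<omega>) {..<n}) \<and>
     (\<forall>s\<ge>0. \<forall>h\<ge>0. distr M borel (\<lambda>\<omega>. L (s + h) \<omega> - L s \<omega>) = distr M borel (L h)) \<and>
     (\<forall>\<omega>\<in>space M. cadlag_on_nonneg (\<lambda>t. L t \<omega>))"

definition subordinator :: "'a measure \<Rightarrow> (real \<Rightarrow> 'a \<Rightarrow> real) \<Rightarrow> bool" where
  "subordinator M L \<longleftrightarrow> levy_process M L \<and> (AE \<omega> in M. mono_on {0..} (\<lambda>t. L t \<omega>))"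

definition two_sided ::
  "(real \<Rightarrow> 'a \<Rightarrow> real) \<Rightarrow> (real \<Rightarrow> 'a \<Rightarrow> real) \<Rightarrow> real \<Rightarrow> 'a \<Rightarrow> real" where
  "two_sided S1 S2 t \<omega> = (if t < 0 then - Lim (at_left (- t)) (\<lambda>u. S1 u \<omega>) else S2 t \<omega>)"

definition two_sided_subordinator :: "'a measure \<Rightarrow> (real \<Rightarrow> 'a \<Rightarrow> real) \<Rightarrow> bool" where
  "two_sided_subordinator M S \<longleftrightarrow> (\<exists>S1 S2.
     subordinator M S1 \<and> subordinator M S2 \<and> same_fdd M {0..} S1 S2 \<and>
     prob_space.indep_var M
       (\<Pi>\<^sub>M t\<in>{0..}. borel) (\<lambda>\<omega>. \<lambda>t\<in>{0..}. S1 t \<omega>)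
       (\<Pi>\<^sub>M t\<in>{0..}. borel) (\<lambda>\<omega>. \<lambda>t\<in>{0..}. S2 t \<omega>) \<and>
     S = two_sided S1 S2)"


subsection \<open>Integration with respect to a two-sided subordinator\<close>

definition converges_in_probability ::
  "'a measure \<Rightarrow> (nat \<Rightarrow> 'a \<Rightarrow> real) \<Rightarrow> ('a \<Rightarrow> real) \<Rightarrow> bool" where
  "converges_in_probability M X Z \<longleftrightarrow>
     (\<forall>n. X n \<in> borel_measurable M) \<and> Z \<in> borel_measurable M \<and>
     (\<forall>\<epsilon>>0. (\<lambda>n. measure M {\<omega> \<in> space M. \<bar>X n \<omega> - Z \<omega>\<bar> > \<epsilon>}) \<longlonglongrightarrow> 0)"

text \<open>The random measure determined by \<open>(s, t] \<mapsto> S t - S s\<close>, realised path by path. Paths are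
  only almost surely increasing; the remaining ones are sent to the null measure.\<close>

definition path_measure :: "(real \<Rightarrow> 'a \<Rightarrow> real) \<Rightarrow> 'a \<Rightarrow> real measure" where
  "path_measure S \<omega> =
     (if mono (\<lambda>t. S t \<omega>) then interval_measure (\<lambda>t. S t \<omega>) else null_measure borel)"

text \<open>Step functions over bounded Borel sets.\<close>

definition step_function :: "(real \<Rightarrow> real) \<Rightarrow> bool" where
  "step_function g \<longleftrightarrow> simple_function borel g \<and> bounded {u. g u \<noteq> 0}"

definition step_integral ::
  "(real \<Rightarrow> 'a \<Rightarrow> real) \<Rightarrow> (real \<Rightarrow> real) \<Rightarrow> real set \<Rightarrow> 'a \<Rightarrow> real" where
  "step_integral S g A \<omega> = (\<Sum>y\<in>range g. y * measure (path_measure S \<omega>) (A \<inter> g -` {y}))"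

text \<open>The integral in the sense of Rajput and Rosinski (Spectral representations of infinitely
  divisible processes, 1989). Convergence is required over every Borel set \<open>A\<close> because convergence
  over the whole line alone would not determine the limit: with \<open>S t = t\<close>, the step functions
  \<open>indicator {n<..n+1}\<close> tend to 0 pointwise but have integral 1. The integral is determined up
  to null sets, hence the predicate form.\<close>

definition has_subordinator_integral ::
  "'a measure \<Rightarrow> (real \<Rightarrow> 'a \<Rightarrow> real) \<Rightarrow> (real \<Rightarrow> real) \<Rightarrow> ('a \<Rightarrow> real) \<Rightarrow> bool" where
  "has_subordinator_integral M S f I \<longleftrightarrow> (\<exists>g :: nat \<Rightarrow> real \<Rightarrow> real.
     (\<forall>n. step_function (g n)) \<and>
     (AE u in lborel. (\<lambda>n. g n u) \<longlonglongrightarrow> f u) \<and>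
     (\<forall>A\<in>sets borel. \<exists>Z. converges_in_probability M (\<lambda>n. step_integral S (g n) A) Z) \<and>
     converges_in_probability M (\<lambda>n. step_integral S (g n) UNIV) I)"

end

theory Submission
  imports Defs
begin

text \<open>The whole statement rests on one fact: the integral \<open>X t\<close>, which is only a limit in probability of
integrals of step functions, is almost surely the Lebesgue-Stieltjes integral of the kernel against the
increasing path of \<open>S\<close>. Once this is known, each of the three claims is a statement about single paths
or about the law of the increments of \<open>S\<close>.

Two ingredients give that fact (\<open>subordinator_integral_eq_path_integral\<close>). First, a Lebesgue null set
has measure zero under almost every path measure (\<open>AE_path_measure_null\<close>): by Fubini almost every
translate of it is null for a given path, and stationarity of the increments transfers this from some
translate to the set itself. Hence step functions that converge Lebesgue almost everywhere converge
almost everywhere for the path measure. Secondly, mass cannot escape in the limit: convergence of the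
integrals over \<^emph>\<open>every\<close> Borel set forces the integrals over the tails of a countable partition to be
uniformly small, by a gliding hump argument in the space of random variables with convergence in
probability (\<open>gliding_hump\<close>). The kernel has constant sign for each time, so monotone convergence then
yields both integrability and the value of the integral.

Claim (i): for \<open>0 \<le> s < t\<close> the difference of the kernels at \<open>t\<close> and \<open>s\<close> is nonnegative, and it is positive
to the left of \<open>t\<close>, where a strictly increasing path puts mass. This gives strict monotonicity along the
rationals, and continuity extends it.

Claim (ii): \<open>X (t + h) - X h\<close> is the integral of the kernel at \<open>t\<close> against the path measure, translated so
that \<open>h\<close> becomes the origin. For all \<open>h\<close> it is therefore the same measurable functional of the increments of
\<open>S\<close> relative to its value at \<open>h\<close>, and the law of these increments on the rationals does not depend on \<open>h\<close> (\<open>increments_path_law\<close>).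

Claim (iii): the strong law of large numbers gives \<open>S u = m u + o(u)\<close> almost surely at both ends of the
line. The level sets of the kernel are intervals, whose path measure is thus \<open>m\<close> times their length up to a
constant and a small multiple of the absolute values of their end points. Integrating over the levels bounds
the difference between the pathwise integral and \<open>m\<close> times the Lebesgue integral of the kernel
(\<open>mvn_integral_deviation\<close>).\<close>

section \<open>The strong law of large numbers\<close>

text \<open>The largest amount, over \<open>k \<le> n\<close>, by which the \<open>k\<close>-th partial sum exceeds \<open>b k\<close>. The recursion shifts the
sequence, which is the form that the maximal inequality needs.\<close>

primrec max_excess :: "real \<Rightarrow> nat \<Rightarrow> (nat \<Rightarrow> real) \<Rightarrow> real" where
  "max_excess b 0 x = 0"
| "max_excess b (Suc n) x = max 0 (x 0 - b + max_excess b n (\<lambda>i. x (Suc i)))"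

lemma max_excess_nonneg: "0 \<le> max_excess b n x"
  by (cases n) auto

lemma max_excess_Suc_mono: "max_excess b n x \<le> max_excess b (Suc n) x"
proof (induction n arbitrary: x)
  case (Suc n)
  have "max_excess b n (\<lambda>i. x (Suc i)) \<le> max_excess b (Suc n) (\<lambda>i. x (Suc i))"
    by (rule Suc)
  then have "max 0 (x 0 - b + max_excess b n (\<lambda>i. x (Suc i)))
      \<le> max 0 (x 0 - b + max_excess b (Suc n) (\<lambda>i. x (Suc i)))"
    by linarith
  then show ?case by (simp only: max_excess.simps)
qed simp

lemma partial_sum_le_max_excess:
  "k \<le> n \<Longrightarrow> (\<Sum>i<k. x i) - b * real k \<le> max_excess b n x"
proof (induction n arbitrary: k x)
  case (Suc n)
  show ?case
  proof (cases k)
    case 0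
    then show ?thesis using max_excess_nonneg by simp
  next
    case (Suc k')
    then have "(\<Sum>i<k'. x (Suc i)) - b * real k' \<le> max_excess b n (\<lambda>i. x (Suc i))"
      using Suc.IH[of k'] Suc.prems by simp
    moreover have "(\<Sum>i<k. x i) = x 0 + (\<Sum>i<k'. x (Suc i))"
      unfolding Suc by (rule sum.lessThan_Suc_shift)
    moreover have "b * real k = b * real k' + b" unfolding Suc by (simp add: algebra_simps)
    ultimately show ?thesis by (simp add: algebra_simps)
  qed
qed simp

lemma max_excess_le_sum: "max_excess b n x \<le> (\<Sum>i<n. \<bar>x i - b\<bar>)"
proof (induction n arbitrary: x)
  case (Suc n)
  have "max_excess b n (\<lambda>i. x (Suc i)) \<le> (\<Sum>i<n. \<bar>x (Suc i) - b\<bar>)" by (rule Suc)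
  moreover have "0 \<le> (\<Sum>i<n. \<bar>x (Suc i) - b\<bar>)" by (simp add: sum_nonneg)
  moreover have "(\<Sum>i<Suc n. \<bar>x i - b\<bar>) = \<bar>x 0 - b\<bar> + (\<Sum>i<n. \<bar>x (Suc i) - b\<bar>)"
    by (rule sum.lessThan_Suc_shift)
  ultimately show ?case by simp
qed simp

lemma measurable_max_excess [measurable]:
  "max_excess b n \<in> borel_measurable (\<Pi>\<^sub>M i\<in>(UNIV::nat set). (borel :: real measure))"
proof (induction n)
  case (Suc n)
  have shift: "(\<lambda>x i. x (Suc i)) \<in> (\<Pi>\<^sub>M i\<in>(UNIV::nat set). (borel :: real measure)) \<rightarrow>\<^sub>M (\<Pi>\<^sub>M i\<in>UNIV. borel)"
    by (rule measurable_PiM_single') auto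
  have [measurable]: "(\<lambda>x. max_excess b n (\<lambda>i. x (Suc i))) \<in> borel_measurable (\<Pi>\<^sub>M i\<in>(UNIV::nat set). (borel :: real measure))"
    using measurable_compose[OF shift Suc] .
  show ?case by simp
qed simp

text \<open>Garsia's inequality: if the maximum is positive then it is attained by a nonempty sum, so removing the
first term costs at most that term.\<close>

lemma max_excess_step:
  assumes "0 < max_excess b n x"
  shows "max_excess b n x - max_excess b n (\<lambda>i. x (Suc i)) \<le> x 0 - b"
proof (cases n)
  case (Suc m)
  then show ?thesis
    using assms max_excess_Suc_mono[of b m "\<lambda>i. x (Suc i)"] by (simp split: if_splits)
qed (use assms in simp)

lemma (in prob_space) iid_shift_law:
  fixes \<xi> :: "nat \<Rightarrow> 'a \<Rightarrow> real"
  assumes indep: "indep_vars (\<lambda>_. borel) \<xi> UNIV"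
    and law: "\<And>i. distr M borel (\<xi> i) = distr M borel (\<xi> 0)"
  shows "distr M (\<Pi>\<^sub>M i\<in>UNIV. borel) (\<lambda>\<omega> i. \<xi> (Suc i) \<omega>) = distr M (\<Pi>\<^sub>M i\<in>UNIV. borel) (\<lambda>\<omega> i. \<xi> i \<omega>)"
proof -
  have m[measurable]: "random_variable borel (\<xi> i)" for i
    using indep by (auto simp: indep_vars_def)
  have same: "prob (\<xi> i -` A \<inter> space M) = prob (\<xi> 0 -` A \<inter> space M)" if "A \<in> sets borel" for i A
    using arg_cong[OF law[of i], of "\<lambda>N. measure N A"] that by (simp add: measure_distr)
  have box: "prob ((\<lambda>\<omega> i. \<xi> (f i) \<omega>) -` prod_emb UNIV (\<lambda>_. borel) J (Pi\<^sub>E J A) \<inter> space M)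
      = (\<Prod>i\<in>J. prob (\<xi> 0 -` A i \<inter> space M))"
    if J: "finite J" and A: "\<And>i. i \<in> J \<Longrightarrow> A i \<in> sets borel" and f: "inj f" for f J A
  proof (cases "J = {}")
    case False
    have "(\<lambda>\<omega> i. \<xi> (f i) \<omega>) -` prod_emb UNIV (\<lambda>_. borel) J (Pi\<^sub>E J A) \<inter> space M
        = (\<Inter>k\<in>f ` J. \<xi> k -` A (inv f k) \<inter> space M)"
      using False f by (auto simp: prod_emb_def PiE_iff)
    also have "prob \<dots> = (\<Prod>k\<in>f ` J. prob (\<xi> k -` A (inv f k) \<inter> space M))"
      using False J A f by (intro indep_varsD[OF indep]) auto
    also have "\<dots> = (\<Prod>i\<in>J. prob (\<xi> (f i) -` A i \<inter> space M))"
      using f by (subst prod.reindex) (auto simp: inj_on_def)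
    also have "\<dots> = (\<Prod>i\<in>J. prob (\<xi> 0 -` A i \<inter> space M))"
      using A by (intro prod.cong refl same) auto
    finally show ?thesis .
  next
    case True
    then have "(\<lambda>\<omega> i. \<xi> (f i) \<omega>) -` prod_emb UNIV (\<lambda>_. borel) J (Pi\<^sub>E J A) \<inter> space M = space M"
      by (auto simp: prod_emb_def restrict_def)
    then show ?thesis using True by (simp add: prob_space)
  qed
  have fm[measurable]: "(\<lambda>\<omega> i. \<xi> (f i) \<omega>) \<in> M \<rightarrow>\<^sub>M (\<Pi>\<^sub>M i\<in>UNIV. borel)" for f :: "nat \<Rightarrow> nat"
    by (rule measurable_PiM_single') auto
  show ?thesis
  proof (rule measure_eqI_PiM_infinite[where M = "\<lambda>_. borel" and I = UNIV])
    show "finite_measure (distr M (\<Pi>\<^sub>M i\<in>UNIV. borel) (\<lambda>\<omega> i. \<xi> (Suc i) \<omega>))"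
      by (intro finite_measure_distr fm)
    fix A :: "nat \<Rightarrow> real set" and J :: "nat set" assume J: "finite J" "\<And>i. i \<in> J \<Longrightarrow> A i \<in> sets borel"
    have s: "prod_emb UNIV (\<lambda>_. borel) J (Pi\<^sub>E J A) \<in> sets (\<Pi>\<^sub>M i\<in>UNIV. borel)"
      using J by (intro sets_PiM_I) auto
    show "distr M (\<Pi>\<^sub>M i\<in>UNIV. borel) (\<lambda>\<omega> i. \<xi> (Suc i) \<omega>) (prod_emb UNIV (\<lambda>_. borel) J (Pi\<^sub>E J A))
      = distr M (\<Pi>\<^sub>M i\<in>UNIV. borel) (\<lambda>\<omega> i. \<xi> i \<omega>) (prod_emb UNIV (\<lambda>_. borel) J (Pi\<^sub>E J A))"
      using box[OF J, of Suc] box[OF J, of "\<lambda>i. i"] s fm[of Suc] fm[of "\<lambda>i. i"]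
      by (simp add: emeasure_distr emeasure_eq_measure)
  qed auto
qed

text \<open>The maximal ergodic inequality, for averages that exceed a level \<open>b\<close> almost surely at some time. The
expected drop of the maximum under the shift is zero because the shifted sequence has the same law.\<close>

lemma (in prob_space) maximal_inequality_iid:
  fixes \<xi> :: "nat \<Rightarrow> 'a \<Rightarrow> real"
  assumes indep: "indep_vars (\<lambda>_. borel) \<xi> UNIV"
    and law: "\<And>i. distr M borel (\<xi> i) = distr M borel (\<xi> 0)"
    and int: "integrable M (\<xi> 0)"
    and exceeds: "AE \<omega> in M. \<exists>n. b * real n < (\<Sum>i<n. \<xi> i \<omega>)"
  shows "b \<le> expectation (\<xi> 0)"
proof -
  let ?P = "\<Pi>\<^sub>M i\<in>(UNIV::nat set). (borel :: real measure)"
  have m[measurable]: "random_variable borel (\<xi> i)" for i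
    using indep by (auto simp: indep_vars_def)
  have fm[measurable]: "(\<lambda>\<omega> i. \<xi> (f i) \<omega>) \<in> M \<rightarrow>\<^sub>M ?P" for f :: "nat \<Rightarrow> nat"
    by (rule measurable_PiM_single') auto
  have int_i: "integrable M (\<xi> i)" for i
  proof -
    have "integrable (distr M borel (\<xi> 0)) (\<lambda>x. x)" using int by (simp add: integrable_distr_eq)
    then show ?thesis unfolding law[of i, symmetric] by (simp add: integrable_distr_eq)
  qed
  define V where "V n \<omega> = max_excess b n (\<lambda>i. \<xi> i \<omega>)" for n \<omega>
  define W where "W n \<omega> = max_excess b n (\<lambda>i. \<xi> (Suc i) \<omega>)" for n \<omega>
  have [measurable]: "V n \<in> borel_measurable M" "W n \<in> borel_measurable M" for n
    unfolding V_def W_def using fm[of "\<lambda>i. i"] fm[of Suc] by measurable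
  have intV: "integrable M (V n)" for n
  proof (rule Bochner_Integration.integrable_bound)
    show "integrable M (\<lambda>\<omega>. \<Sum>i<n. \<bar>\<xi> i \<omega> - b\<bar>)" using int_i by auto
    show "AE \<omega> in M. norm (V n \<omega>) \<le> norm (\<Sum>i<n. \<bar>\<xi> i \<omega> - b\<bar>)"
      using max_excess_nonneg max_excess_le_sum unfolding V_def by (auto intro!: AE_I2 order_trans[OF max_excess_le_sum])
  qed simp
  have intW: "integrable M (W n)" for n
  proof (rule Bochner_Integration.integrable_bound)
    show "integrable M (\<lambda>\<omega>. \<Sum>i<n. \<bar>\<xi> (Suc i) \<omega> - b\<bar>)" using int_i by auto
    show "AE \<omega> in M. norm (W n \<omega>) \<le> norm (\<Sum>i<n. \<bar>\<xi> (Suc i) \<omega> - b\<bar>)"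
      using max_excess_nonneg max_excess_le_sum unfolding W_def by (auto intro!: AE_I2 order_trans[OF max_excess_le_sum])
  qed simp
  have EV: "expectation (V n) = expectation (W n)" for n
  proof -
    have "expectation (V n) = (\<integral>x. max_excess b n x \<partial>distr M ?P (\<lambda>\<omega> i. \<xi> i \<omega>))"
      unfolding V_def using fm[of "\<lambda>i. i"] by (subst integral_distr) auto
    also have "\<dots> = (\<integral>x. max_excess b n x \<partial>distr M ?P (\<lambda>\<omega> i. \<xi> (Suc i) \<omega>))"
      by (simp only: iid_shift_law[OF indep law])
    also have "\<dots> = expectation (W n)"
      unfolding W_def using fm[of Suc] by (subst integral_distr) auto
    finally show ?thesis .
  qed
  \<comment> \<open>On the event that the running maximum is positive, its first summand dominates the drop of the
    maximum under the shift; that drop has mean zero.\<close>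
  have garsia: "0 \<le> expectation (\<lambda>\<omega>. (\<xi> 0 \<omega> - b) * indicator {\<omega>. 0 < V n \<omega>} \<omega>)" for n
  proof -
    have "0 = expectation (\<lambda>\<omega>. V n \<omega> - W n \<omega>)"
      using EV[of n] intV intW by simp
    also have "\<dots> \<le> expectation (\<lambda>\<omega>. (\<xi> 0 \<omega> - b) * indicator {\<omega>. 0 < V n \<omega>} \<omega>)"
    proof (rule integral_mono)
      show "integrable M (\<lambda>\<omega>. (\<xi> 0 \<omega> - b) * indicator {\<omega>. 0 < V n \<omega>} \<omega>)"
        by (rule Bochner_Integration.integrable_bound[where f = "\<lambda>\<omega>. \<xi> 0 \<omega> - b"])
          (use int in \<open>auto intro!: AE_I2 simp: indicator_def\<close>)
      show "V n \<omega> - W n \<omega> \<le> (\<xi> 0 \<omega> - b) * indicator {\<omega>. 0 < V n \<omega>} \<omega>" for \<omega>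
        using max_excess_step[of b n "\<lambda>i. \<xi> i \<omega>"] max_excess_nonneg[of b n "\<lambda>i. \<xi> (Suc i) \<omega>"]
          max_excess_nonneg[of b n "\<lambda>i. \<xi> i \<omega>"]
        unfolding V_def W_def by (auto simp: indicator_def)
    qed (use intV intW in auto)
    finally show ?thesis .
  qed
  have "(\<lambda>n. expectation (\<lambda>\<omega>. (\<xi> 0 \<omega> - b) * indicator {\<omega>. 0 < V n \<omega>} \<omega>))
      \<longlonglongrightarrow> expectation (\<lambda>\<omega>. \<xi> 0 \<omega> - b)"
  proof (rule integral_dominated_convergence[where w = "\<lambda>\<omega>. \<bar>\<xi> 0 \<omega> - b\<bar>"])
    show "AE \<omega> in M. (\<lambda>n. (\<xi> 0 \<omega> - b) * indicator {\<omega>. 0 < V n \<omega>} \<omega>) \<longlonglongrightarrow> \<xi> 0 \<omega> - b"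
      using exceeds
    proof eventually_elim
      case (elim \<omega>)
      then obtain k where k: "b * real k < (\<Sum>i<k. \<xi> i \<omega>)" by auto
      have "0 < V n \<omega>" if "k \<le> n" for n
        using partial_sum_le_max_excess[OF that, of "\<lambda>i. \<xi> i \<omega>" b] k unfolding V_def by simp
      then show ?case
        by (intro tendsto_eventually) (auto simp: eventually_sequentially indicator_def)
    qed
  qed (use int in \<open>auto simp: indicator_def\<close>)
  then have "0 \<le> expectation (\<lambda>\<omega>. \<xi> 0 \<omega> - b)"
    by (rule LIMSEQ_le_const) (use garsia in auto)
  then show ?thesis using int by (simp add: prob_space)
qed

text \<open>The upper limit of the averages does not depend on any initial segment, so by Kolmogorov's law the event
that it exceeds \<open>b\<close> has probability zero or one; probability one contradicts the maximal inequality.\<close>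

lemma (in prob_space) limsup_average_le:
  fixes \<xi> :: "nat \<Rightarrow> 'a \<Rightarrow> real"
  assumes indep: "indep_vars (\<lambda>_. borel) \<xi> UNIV"
    and law: "\<And>i. distr M borel (\<xi> i) = distr M borel (\<xi> 0)"
    and int: "integrable M (\<xi> 0)"
    and b: "expectation (\<xi> 0) < b"
  shows "AE \<omega> in M. limsup (\<lambda>n. ereal ((\<Sum>i<n. \<xi> i \<omega>) / real n)) \<le> ereal b"
proof -
  have m[measurable]: "random_variable borel (\<xi> i)" for i
    using indep by (auto simp: indep_vars_def)
  define L where "L N \<omega> = limsup (\<lambda>n. ereal ((\<Sum>i\<in>{N..<n}. \<xi> i \<omega>) / real n))" for N \<omega>
  define A where "A i = {\<xi> i -` B \<inter> space M | B. B \<in> sets borel}" for i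
  define Q where "Q = {\<omega> \<in> space M. ereal b < L 0 \<omega>}"
  have L_eq: "L 0 \<omega> = L N \<omega>" for N \<omega>
  proof -
    have lim: "(\<lambda>n. ereal ((\<Sum>i<N. \<xi> i \<omega>) / real n)) \<longlonglongrightarrow> 0"
      using tendsto_divide_0[OF tendsto_const[of "\<Sum>i<N. \<xi> i \<omega>"] filterlim_at_top_imp_at_infinity[OF filterlim_real_sequentially]]
      by (simp add: zero_ereal_def)
    have "L 0 \<omega> = limsup (\<lambda>n. ereal ((\<Sum>i<N. \<xi> i \<omega>) / real n) + ereal ((\<Sum>i\<in>{N..<n}. \<xi> i \<omega>) / real n))"
      unfolding L_def
    proof (rule Limsup_eq)
      show "\<forall>\<^sub>F n in sequentially. ereal ((\<Sum>i\<in>{0..<n}. \<xi> i \<omega>) / real n)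
          = ereal ((\<Sum>i<N. \<xi> i \<omega>) / real n) + ereal ((\<Sum>i\<in>{N..<n}. \<xi> i \<omega>) / real n)"
        using eventually_ge_at_top[of N]
      proof eventually_elim
        case (elim n)
        have "(\<Sum>i\<in>{0..<n}. \<xi> i \<omega>) = (\<Sum>i<N. \<xi> i \<omega>) + (\<Sum>i\<in>{N..<n}. \<xi> i \<omega>)"
          using sum.atLeastLessThan_concat[of 0 N n "\<lambda>i. \<xi> i \<omega>"] elim by (simp add: lessThan_atLeast0)
        then show ?case by (simp add: add_divide_distrib)
      qed
    qed
    also have "\<dots> = 0 + L N \<omega>"
      unfolding L_def using lim by (rule ereal_limsup_lim_add) simp
    finally show ?thesis by simp
  qed
  have "Q \<in> tail_events A"
    unfolding tail_events_def
  proof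
    fix N :: nat
    let ?G = "sigma (space M) (\<Union> (A ` {N..}))"
    have sub: "\<Union> (A ` {N..}) \<subseteq> Pow (space M)" unfolding A_def by auto
    have G[measurable]: "\<xi> i \<in> borel_measurable ?G" if "N \<le> i" for i
    proof (rule measurableI)
      fix B :: "real set" assume "B \<in> sets borel"
      then have "\<xi> i -` B \<inter> space M \<in> \<Union> (A ` {N..})" using that unfolding A_def by auto
      then show "\<xi> i -` B \<inter> space ?G \<in> sets ?G"
        using sub by (simp add: space_measure_of sets_measure_of sigma_sets.Basic)
    qed simp
    have "L N \<in> borel_measurable ?G" unfolding L_def by measurable
    then have "{\<omega> \<in> space ?G. ereal b < L N \<omega>} \<in> sets ?G" by measurable
    moreover have "Q = {\<omega> \<in> space ?G. ereal b < L N \<omega>}"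
      unfolding Q_def L_eq[of _ N] using sub by (simp add: space_measure_of)
    ultimately have "Q \<in> sets ?G" by simp
    then show "Q \<in> sigma_sets (space M) (\<Union> (A ` {N..}))"
      using sub by (simp add: sets_measure_of)
  qed
  moreover have "indep_sets A UNIV"
    using indep unfolding indep_vars_def2 A_def by simp
  moreover have "sigma_algebra (space M) (A i)" for i
    unfolding A_def using sets.sigma_algebra_axioms[of "vimage_algebra (space M) (\<xi> i) borel"]
    by (simp add: sets_vimage_algebra2)
  ultimately consider "prob Q = 0" | "prob Q = 1"
    using kolmogorov_0_1_law by blast
  then show ?thesis
  proof cases
    case 1
    have [measurable]: "Q \<in> sets M" unfolding Q_def L_def by measurable
    have "AE \<omega> in M. \<omega> \<notin> Q" using 1 by (intro AE_not_in null_setsI) (auto simp: emeasure_eq_measure)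
    then show ?thesis using AE_space by eventually_elim (auto simp: Q_def L_def lessThan_atLeast0)
  next
    case 2
    have [measurable]: "Q \<in> sets M" unfolding Q_def L_def by measurable
    have "AE \<omega> in M. \<omega> \<in> Q" using 2 by (simp add: AE_in_set_eq_1)
    then have "AE \<omega> in M. \<exists>n. b * real n < (\<Sum>i<n. \<xi> i \<omega>)"
    proof eventually_elim
      case (elim \<omega>)
      then have "\<exists>\<^sub>F n in sequentially. ereal b < ereal ((\<Sum>i\<in>{0..<n}. \<xi> i \<omega>) / real n)"
        unfolding Q_def L_def using Limsup_bounded[of "\<lambda>n. ereal ((\<Sum>i\<in>{0..<n}. \<xi> i \<omega>) / real n)" "ereal b" sequentially]
        by (auto simp: frequently_def not_less)
      then have "\<exists>\<^sub>F n in sequentially. n > 0 \<and> ereal b < ereal ((\<Sum>i\<in>{0..<n}. \<xi> i \<omega>) / real n)"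
        using eventually_gt_at_top[of "0::nat"] by (simp add: frequently_eventually_conj)
      then show ?case
        by (auto dest!: frequently_ex simp: lessThan_atLeast0 field_simps)
    qed
    then have "b \<le> expectation (\<xi> 0)"
      by (rule maximal_inequality_iid[OF indep law int])
    then show ?thesis using b by simp
  qed
qed

theorem (in prob_space) strong_law_of_large_numbers:
  fixes \<xi> :: "nat \<Rightarrow> 'a \<Rightarrow> real"
  assumes indep: "indep_vars (\<lambda>_. borel) \<xi> UNIV"
    and law: "\<And>i. distr M borel (\<xi> i) = distr M borel (\<xi> 0)"
    and int: "integrable M (\<xi> 0)"
  shows "AE \<omega> in M. (\<lambda>n. (\<Sum>i<n. \<xi> i \<omega>) / real n) \<longlonglongrightarrow> expectation (\<xi> 0)"
proof -
  let ?m = "expectation (\<xi> 0)"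
  have m[measurable]: "random_variable borel (\<xi> i)" for i
    using indep by (auto simp: indep_vars_def)
  have "AE \<omega> in M. \<forall>k. limsup (\<lambda>n. ereal ((\<Sum>i<n. \<xi> i \<omega>) / real n)) \<le> ereal (?m + 1 / real (Suc k))"
    unfolding AE_all_countable by (intro allI limsup_average_le indep law int) simp
  moreover have "AE \<omega> in M. \<forall>k. limsup (\<lambda>n. ereal ((\<Sum>i<n. - \<xi> i \<omega>) / real n)) \<le> ereal (- ?m + 1 / real (Suc k))"
    unfolding AE_all_countable
  proof (intro allI limsup_average_le)
    show "indep_vars (\<lambda>_. borel) (\<lambda>i \<omega>. - \<xi> i \<omega>) UNIV"
      by (rule indep_vars_compose2[OF indep]) simp
    show "distr M borel (\<lambda>\<omega>. - \<xi> i \<omega>) = distr M borel (\<lambda>\<omega>. - \<xi> 0 \<omega>)" for i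
    proof -
      have "distr M borel (\<lambda>\<omega>. - \<xi> j \<omega>) = distr (distr M borel (\<xi> j)) borel uminus" for j
        by (subst distr_distr) (auto simp: comp_def)
      then show ?thesis by (simp only: law[of i])
    qed
  qed (use int in auto)
  ultimately show ?thesis
  proof eventually_elim
    case (elim \<omega>)
    let ?a = "\<lambda>n. ereal ((\<Sum>i<n. \<xi> i \<omega>) / real n)"
    have arch: "x \<le> ereal c" if "\<And>k. x \<le> ereal (c + 1 / real (Suc k))" for x c
    proof (rule LIMSEQ_le_const)
      show "(\<lambda>k. ereal (c + 1 / real (Suc k))) \<longlonglongrightarrow> ereal c"
        using tendsto_add[OF tendsto_const[of c] lim_inverse_n'[THEN LIMSEQ_Suc]] by simp
    qed (use that in auto)
    have "limsup ?a \<le> ereal ?m" using elim(1) arch by blast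
    moreover have "limsup (\<lambda>n. - ?a n) \<le> ereal (- ?m)"
      using arch[of "limsup (\<lambda>n. - ?a n)" "- ?m"] elim(2) by (simp add: sum_negf)
    then have "- liminf ?a \<le> - ereal ?m"
      unfolding ereal_Limsup_uminus by simp
    then have "ereal ?m \<le> liminf ?a"
      by (simp only: ereal_minus_le_minus)
    moreover have "liminf ?a \<le> limsup ?a" by (rule Liminf_le_Limsup) simp
    ultimately have "liminf ?a = ereal ?m \<and> limsup ?a = ereal ?m"
      by (meson order_antisym order_trans)
    then have "?a \<longlonglongrightarrow> ereal ?m"
      by (subst tendsto_iff_Liminf_eq_Limsup) simp_all
    then show ?case by simp
  qed
qed

text \<open>Along the integers a process with stationary independent increments is a random walk.\<close>

lemma (in prob_space) levy_process_strong_law: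
  assumes L: "levy_process M L" and int: "integrable M (L 1)"
  shows "AE \<omega> in M. (\<lambda>n. L (real n) \<omega> / real n) \<longlonglongrightarrow> expectation (L 1)"
proof -
  have m: "L t \<in> borel_measurable M" if "0 \<le> t" for t using L that by (simp add: levy_process_def)
  define \<xi> where "\<xi> i \<omega> = L (real (Suc i)) \<omega> - L (real i) \<omega>" for i \<omega>
  have rv: "\<xi> i \<in> borel_measurable M" for i
    unfolding \<xi>_def by (intro borel_measurable_diff m) simp_all
  have "indep_vars (\<lambda>_. borel) \<xi> {..<n}" for n
    using L unfolding levy_process_def \<xi>_def
    by (elim conjE allE[where x = n] allE[where x = real]) simp
  then have fin: "indep_sets (\<lambda>i. {\<xi> i -` A \<inter> space M |A. A \<in> sets borel}) {..<n}" for n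
    by (simp add: indep_vars_def2)
  have "indep_sets (\<lambda>i. {\<xi> i -` A \<inter> space M |A. A \<in> sets borel}) UNIV"
  proof (subst indep_sets_finite_index_sets, intro allI impI)
    fix J :: "nat set" assume "J \<noteq> {}" "finite J"
    then have "J \<subseteq> {..<Suc (Max J)}" by (auto simp: less_Suc_eq_le)
    then show "indep_sets (\<lambda>i. {\<xi> i -` A \<inter> space M |A. A \<in> sets borel}) J"
      using fin by (rule indep_sets_mono_index)
  qed
  then have indep: "indep_vars (\<lambda>_. borel) \<xi> UNIV"
    using rv by (simp add: indep_vars_def2)
  have law1: "distr M borel (\<xi> i) = distr M borel (L 1)" for i
  proof -
    have "distr M borel (\<lambda>\<omega>. L (real i + 1) \<omega> - L (real i) \<omega>) = distr M borel (L 1)"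
      using L unfolding levy_process_def by (metis of_nat_0_le_iff zero_le_one)
    then show ?thesis by (simp add: \<xi>_def[abs_def] add.commute)
  qed
  have "integrable (distr M borel (\<xi> 0)) (\<lambda>x. x)"
    unfolding law1 using int m[of 1] by (simp add: integrable_distr_eq)
  then have int0: "integrable M (\<xi> 0)" using rv by (simp add: integrable_distr_eq)
  have "expectation (\<xi> 0) = (\<integral>x. x \<partial>distr M borel (\<xi> 0))" using rv by (simp add: integral_distr)
  also have "\<dots> = expectation (L 1)" unfolding law1 using m[of 1] by (simp add: integral_distr)
  finally have mean: "expectation (\<xi> 0) = expectation (L 1)" .
  have "AE \<omega> in M. (\<lambda>n. (\<Sum>i<n. \<xi> i \<omega>) / real n) \<longlonglongrightarrow> expectation (\<xi> 0)"
    by (rule strong_law_of_large_numbers[OF indep _ int0]) (simp add: law1)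
  moreover have "AE \<omega> in M. L 0 \<omega> = 0" using L by (simp add: levy_process_def)
  ultimately show ?thesis
  proof eventually_elim
    case (elim \<omega>)
    have "(\<Sum>i<n. \<xi> i \<omega>) = L (real n) \<omega> - L (real 0) \<omega>" for n
      unfolding \<xi>_def by (rule sum_lessThan_telescope)
    then show ?case using elim by (simp add: mean)
  qed
qed

section \<open>Measures read off from paths on the rationals\<close>

text \<open>The right-continuous function that interpolates an increasing function on the rationals. Paths are
recorded on the rationals only, because then path space is a countable product, on which this function and
the measure it generates depend measurably on the path. Sequences that are not increasing
are sent to the zero function, so that a distribution function results in every case.\<close>

definition path_cdf :: "(rat \<Rightarrow> real) \<Rightarrow> real \<Rightarrow> real" where
  "path_cdf x t = (if mono x then INF q\<in>{q. t < of_rat q}. x q else 0)"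

lemma path_cdf_bdd_below:
  fixes x :: "rat \<Rightarrow> real" and t :: real
  assumes m: "mono x"
  shows "bdd_below (x ` {q. t < of_rat q})"
proof -
  obtain r where r: "of_rat r < t" using of_rat_dense[of "t - 1" t] by auto
  have "x r \<le> x q" if "t < of_rat q" for q
    using m r that by (metis monoD of_rat_less_eq less_eq_real_def order_less_trans)
  then show ?thesis by (intro bdd_belowI2) auto
qed

lemma rat_above_nonempty: "{q. (t::real) < of_rat q} \<noteq> {}"
  using of_rat_dense[of t "t + 1"] by auto

lemma path_cdf_mono: "s \<le> t \<Longrightarrow> path_cdf x s \<le> path_cdf x t"
  unfolding path_cdf_def
  by (auto intro!: cINF_superset_mono path_cdf_bdd_below rat_above_nonempty)

lemma path_cdf_right_continuous: "continuous (at_right t) (path_cdf x)"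
proof (cases "mono x")
  case True
  show ?thesis
    unfolding continuous_within
  proof (rule decreasing_tendsto)
    show "\<forall>\<^sub>F s in at_right t. path_cdf x t \<le> path_cdf x s"
      by (auto simp: eventually_at_right_field intro!: path_cdf_mono exI[of _ "t + 1"])
    fix y assume "path_cdf x t < y"
    then obtain q where q: "t < of_rat q" "x q < y"
      using True cINF_less_iff[OF rat_above_nonempty[of t] path_cdf_bdd_below[OF True], of y] by (auto simp: path_cdf_def)
    have "path_cdf x s < y" if "s < of_rat q" for s
      using True q(2) that cINF_less_iff[OF rat_above_nonempty[of s] path_cdf_bdd_below[OF True], of y] by (auto simp: path_cdf_def)
    then show "\<forall>\<^sub>F s in at_right t. path_cdf x s < y"
      using q(1) by (auto simp: eventually_at_right_field)
  qed
next
  case False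
  then have "path_cdf x = (\<lambda>_. 0)" by (auto simp: path_cdf_def)
  then show ?thesis by simp
qed

abbreviation "path_space \<equiv> (\<Pi>\<^sub>M q\<in>(UNIV :: rat set). (borel :: real measure))"

lemma measurable_path_cdf [measurable]: "(\<lambda>x. path_cdf x t) \<in> borel_measurable path_space"
proof -
  have mono_iff: "mono x \<longleftrightarrow> (\<forall>p q. p \<le> q \<longrightarrow> x p \<le> x q)" for x :: "rat \<Rightarrow> real"
    by (auto simp: mono_def)
  have [measurable]: "Measurable.pred path_space (\<lambda>x. x p \<le> x q)" for p q :: rat
    unfolding pred_def by (intro borel_measurable_le measurable_component_singleton) simp_all
  have pm: "Measurable.pred path_space mono"
    unfolding mono_iff by measurable
  have "path_cdf x t = (INF q\<in>{q. t < of_rat q}. if mono x then x q else 0)" for x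
    using rat_above_nonempty[of t] by (auto simp: path_cdf_def)
  moreover have "(\<lambda>x. INF q\<in>{q. t < of_rat q}. if mono x then x q else 0) \<in> borel_measurable path_space"
  proof (rule borel_measurable_cINF)
    show "bdd_below ((\<lambda>q. if mono x then x q else (0::real)) ` {q. t < of_rat q})" for x :: "rat \<Rightarrow> real"
      using path_cdf_bdd_below[of x t] by (cases "mono x") (auto intro: bdd_belowI2)
    show "(\<lambda>x. if mono x then x q else 0) \<in> borel_measurable path_space" for q
      using pm by measurable
  qed auto
  ultimately show ?thesis by simp
qed

definition path_stieltjes :: "(rat \<Rightarrow> real) \<Rightarrow> real measure" where
  "path_stieltjes x = interval_measure (path_cdf x)"

lemma sets_path_stieltjes [simp, measurable_cong]: "sets (path_stieltjes x) = sets borel"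
  and space_path_stieltjes [simp]: "space (path_stieltjes x) = UNIV"
  by (simp_all add: path_stieltjes_def)

lemma emeasure_path_stieltjes_Ioc:
  "s \<le> t \<Longrightarrow> emeasure (path_stieltjes x) {s<..t} = ennreal (path_cdf x t - path_cdf x s)"
  unfolding path_stieltjes_def by (intro emeasure_interval_measure_Ioc path_cdf_mono path_cdf_right_continuous)

text \<open>The measure of a path, cut off to a bounded interval and divided by one plus its mass there. These are
subprobability kernels, and the full measure is recovered from them by monotone convergence.\<close>

definition path_kernel :: "nat \<Rightarrow> (rat \<Rightarrow> real) \<Rightarrow> real measure" where
  "path_kernel k x = density (path_stieltjes x) (\<lambda>u.
     ennreal (1 / (1 + (path_cdf x (real k) - path_cdf x (- real k)))) * indicator {- real k<..real k} u)"

lemma path_kernel_const_pos: "0 < 1 + (path_cdf x (real k) - path_cdf x (- real k))"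
  using path_cdf_mono[of "- real k" "real k" x] by simp

lemma nn_integral_path_kernel:
  assumes [measurable]: "f \<in> borel_measurable borel"
  shows "(\<integral>\<^sup>+u. f u \<partial>path_kernel k x)
    = ennreal (1 / (1 + (path_cdf x (real k) - path_cdf x (- real k)))) * (\<integral>\<^sup>+u. f u * indicator {- real k<..real k} u \<partial>path_stieltjes x)"
proof -
  have "(\<integral>\<^sup>+u. f u \<partial>path_kernel k x)
    = (\<integral>\<^sup>+u. (ennreal (1 / (1 + (path_cdf x (real k) - path_cdf x (- real k)))) * indicator {- real k<..real k} u) * f u \<partial>path_stieltjes x)"
    unfolding path_kernel_def by (rule nn_integral_density) auto
  also have "\<dots> = (\<integral>\<^sup>+u. ennreal (1 / (1 + (path_cdf x (real k) - path_cdf x (- real k)))) * (f u * indicator {- real k<..real k} u) \<partial>path_stieltjes x)"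
    by (simp add: ac_simps)
  also have "\<dots> = ennreal (1 / (1 + (path_cdf x (real k) - path_cdf x (- real k)))) * (\<integral>\<^sup>+u. f u * indicator {- real k<..real k} u \<partial>path_stieltjes x)"
    by (rule nn_integral_cmult) auto
  finally show ?thesis .
qed

lemma emeasure_path_kernel:
  assumes [measurable]: "B \<in> sets borel"
  shows "emeasure (path_kernel k x) B
    = ennreal (1 / (1 + (path_cdf x (real k) - path_cdf x (- real k)))) * emeasure (path_stieltjes x) (B \<inter> {- real k<..real k})"
proof -
  have "sets (path_kernel k x) = sets borel" by (simp add: path_kernel_def)
  then have "emeasure (path_kernel k x) B = (\<integral>\<^sup>+u. indicator B u \<partial>path_kernel k x)"
    by (simp add: nn_integral_indicator)
  also have "\<dots> = ennreal (1 / (1 + (path_cdf x (real k) - path_cdf x (- real k)))) * (\<integral>\<^sup>+u. indicator (B \<inter> {- real k<..real k}) u \<partial>path_stieltjes x)"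
    by (subst nn_integral_path_kernel)
      (auto simp: indicator_inter_arith[abs_def, symmetric] simp del: nn_integral_indicator)
  finally show ?thesis by simp
qed

lemma measurable_path_kernel: "path_kernel k \<in> path_space \<rightarrow>\<^sub>M subprob_algebra borel"
proof (rule measurable_subprob_algebra_generated[where G = "range atMost" and \<Omega> = UNIV])
  show "sets (borel :: real measure) = sigma_sets UNIV (range atMost)"
    by (subst borel_eq_atMost) simp
  show "Int_stable (range (atMost :: real \<Rightarrow> real set))"
    by (auto simp: Int_stable_def)
  let ?c = "\<lambda>x. 1 / (1 + (path_cdf x (real k) - path_cdf x (- real k)))"
  have E: "emeasure (path_kernel k x) {..t}
      = ennreal (?c x) * ennreal (path_cdf x (max (- real k) (min t (real k))) - path_cdf x (- real k))" for x t
  proof -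
    have "{..t} \<inter> {- real k<..real k} = {- real k<..max (- real k) (min t (real k))}" by auto
    then show ?thesis by (subst emeasure_path_kernel) (auto simp: emeasure_path_stieltjes_Ioc)
  qed
  show "(\<lambda>x. emeasure (path_kernel k x) A) \<in> borel_measurable path_space" if "A \<in> range atMost" for A
    using that by (auto simp: E)
  have U: "emeasure (path_kernel k x) UNIV = ennreal (?c x) * ennreal (path_cdf x (real k) - path_cdf x (- real k))" for x
    by (subst emeasure_path_kernel) (auto simp: emeasure_path_stieltjes_Ioc)
  show "(\<lambda>x. emeasure (path_kernel k x) UNIV) \<in> borel_measurable path_space"
    by (simp add: U)
  show "sets (path_kernel k x) = sets borel" for x by (simp add: path_kernel_def)
  show "subprob_space (path_kernel k x)" for x
  proof (rule subprob_spaceI)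
    have "ennreal (?c x) * ennreal (path_cdf x (real k) - path_cdf x (- real k)) \<le> 1"
      using path_kernel_const_pos[of x k] path_cdf_mono[of "- real k" "real k" x]
      by (subst ennreal_mult[symmetric]) (auto simp: field_simps)
    then show "emeasure (path_kernel k x) (space (path_kernel k x)) \<le> 1"
      by (simp add: U path_kernel_def[of k x, THEN arg_cong[where f = space]])
    show "space (path_kernel k x) \<noteq> {}" by (simp add: path_kernel_def)
  qed
qed simp_all

lemma nn_integral_path_stieltjes_SUP:
  assumes [measurable]: "f \<in> borel_measurable borel"
  shows "(\<integral>\<^sup>+u. f u \<partial>path_stieltjes x)
    = (SUP k. ennreal (1 + (path_cdf x (real k) - path_cdf x (- real k))) * (\<integral>\<^sup>+u. f u \<partial>path_kernel k x))"
proof -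
  have inc: "incseq (\<lambda>k u. f u * indicator {- real k<..real k} u)"
    by (auto simp: incseq_def le_fun_def indicator_def)
  have "f u = (SUP k. f u * indicator {- real k<..real k} u)" for u
  proof (rule antisym)
    obtain k :: nat where "\<bar>u\<bar> < real k" using reals_Archimedean2 by blast
    then have "f u \<le> f u * indicator {- real k<..real k} u" by (auto simp: indicator_def)
    also have "\<dots> \<le> (SUP k. f u * indicator {- real k<..real k} u)" by (rule SUP_upper) simp
    finally show "f u \<le> (SUP k. f u * indicator {- real k<..real k} u)" .
  qed (auto intro!: SUP_least simp: indicator_def)
  then have "(\<integral>\<^sup>+u. f u \<partial>path_stieltjes x) = (\<integral>\<^sup>+u. (SUP k. f u * indicator {- real k<..real k} u) \<partial>path_stieltjes x)"
    by simp
  also have "\<dots> = (SUP k. \<integral>\<^sup>+u. f u * indicator {- real k<..real k} u \<partial>path_stieltjes x)"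
    by (rule nn_integral_monotone_convergence_SUP[OF inc]) auto
  also have "\<dots> = (SUP k. ennreal (1 + (path_cdf x (real k) - path_cdf x (- real k))) * (\<integral>\<^sup>+u. f u \<partial>path_kernel k x))"
  proof (rule SUP_cong)
    fix k
    let ?c = "1 + (path_cdf x (real k) - path_cdf x (- real k))"
    have "ennreal ?c * ennreal (1 / ?c) = 1"
      using path_kernel_const_pos[of x k] by (subst ennreal_mult[symmetric]) auto
    then show "(\<integral>\<^sup>+u. f u * indicator {- real k<..real k} u \<partial>path_stieltjes x) = ennreal ?c * (\<integral>\<^sup>+u. f u \<partial>path_kernel k x)"
      by (simp add: nn_integral_path_kernel mult.assoc[symmetric])
  qed simp
  finally show ?thesis .
qed

text \<open>All random integrals below are measurable for this reason: path and integrand may both depend on the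
random parameter.\<close>

lemma measurable_nn_integral_path_stieltjes:
  assumes f: "(\<lambda>(y, u). f y u) \<in> borel_measurable (N \<Otimes>\<^sub>M borel)" and p: "p \<in> N \<rightarrow>\<^sub>M path_space"
  shows "(\<lambda>y. \<integral>\<^sup>+u. f y u \<partial>path_stieltjes (p y)) \<in> borel_measurable N"
proof -
  have [measurable]: "f y \<in> borel_measurable borel" if "y \<in> space N" for y
    using measurable_compose[OF measurable_Pair1'[OF that] f] by simp
  have [measurable]: "(\<lambda>y. path_cdf (p y) t) \<in> borel_measurable N" for t
    using measurable_compose[OF p measurable_path_cdf] .
  have [measurable]: "(\<lambda>y. \<integral>\<^sup>+u. f y u \<partial>path_kernel k (p y)) \<in> borel_measurable N" for k
    by (rule nn_integral_measurable_subprob_algebra2[OF f measurable_compose[OF p measurable_path_kernel]])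
  have "(\<lambda>y. SUP k. ennreal (1 + (path_cdf (p y) (real k) - path_cdf (p y) (- real k))) * (\<integral>\<^sup>+u. f y u \<partial>path_kernel k (p y)))
      \<in> borel_measurable N"
    by measurable
  then show ?thesis
    by (rule measurable_cong[THEN iffD1, rotated]) (simp add: nn_integral_path_stieltjes_SUP)
qed

section \<open>Paths and increments of a two-sided subordinator\<close>

lemma cadlag_left_limit:
  assumes "cadlag_on_nonneg x" "0 < t"
  shows "(x \<longlongrightarrow> Lim (at_left t) x) (at_left t)"
proof -
  obtain l where l: "(x \<longlongrightarrow> l) (at_left t)"
    using assms unfolding cadlag_on_nonneg_def by blast
  moreover have "Lim (at_left t) x = l" using l by (intro tendsto_Lim) simp_all
  ultimately show ?thesis by simp
qed

lemma left_limit_between: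
  assumes x: "cadlag_on_nonneg x" "mono_on {0..} x" and st: "0 \<le> s" "s < t"
  shows "x s \<le> Lim (at_left t) x" and "Lim (at_left t) x \<le> x t"
proof -
  have t: "0 < t" using st by simp
  note lim = cadlag_left_limit[OF x(1) t]
  have ev: "\<forall>\<^sub>F u in at_left t. s < u \<and> u < t"
    using st by (auto simp: eventually_at_left_field)
  have "\<forall>\<^sub>F u in at_left t. x s \<le> x u"
    using ev by eventually_elim (use st in \<open>auto intro!: mono_onD[OF x(2)]\<close>)
  then show "x s \<le> Lim (at_left t) x"
    by (rule tendsto_lowerbound[OF lim]) simp
  have "\<forall>\<^sub>F u in at_left t. x u \<le> x t"
    using ev by eventually_elim (use st in \<open>auto intro!: mono_onD[OF x(2)]\<close>)
  then show "Lim (at_left t) x \<le> x t"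
    by (rule tendsto_upperbound[OF lim]) simp
qed

text \<open>To the left of the origin the two-sided path is the left-limit version of a right-continuous path run
backwards. Left limits of an increasing function form a left-continuous function, and reversing time
turns this into right continuity.\<close>

lemma two_sided_path:
  fixes S1 S2 :: "real \<Rightarrow> 'a \<Rightarrow> real"
  assumes x1: "cadlag_on_nonneg (\<lambda>t. S1 t \<omega>)" "mono_on {0..} (\<lambda>t. S1 t \<omega>)" "S1 0 \<omega> = 0"
    and x2: "cadlag_on_nonneg (\<lambda>t. S2 t \<omega>)" "mono_on {0..} (\<lambda>t. S2 t \<omega>)" "S2 0 \<omega> = 0"
  shows "mono (\<lambda>t. two_sided S1 S2 t \<omega>)"
    and "continuous (at_right t) (\<lambda>t. two_sided S1 S2 t \<omega>)"
proof -
  let ?F = "\<lambda>t. two_sided S1 S2 t \<omega>"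
  let ?l = "\<lambda>t. Lim (at_left t) (\<lambda>u. S1 u \<omega>)"
  note lb = left_limit_between(1)[OF x1(1,2)] and ub = left_limit_between(2)[OF x1(1,2)]
  have pos: "0 \<le> S2 t \<omega>" if "0 \<le> t" for t
    using mono_onD[OF x2(2), of 0 t] that x2(3) by simp
  have lpos: "0 \<le> ?l t" if "0 < t" for t
    using lb[of 0 t] that x1(3) by simp
  show mono: "mono ?F"
  proof (rule monoI)
    fix s t :: real assume "s \<le> t"
    consider "s = t" | "s < t" "t < 0" | "s < 0" "0 \<le> t" | "0 \<le> s" using \<open>s \<le> t\<close> by linarith
    then show "?F s \<le> ?F t"
    proof cases
      case 2
      have "?l (- t) \<le> S1 (- t) \<omega>" using ub[of 0 "- t"] 2 by simp
      also have "\<dots> \<le> ?l (- s)" using lb[of "- t" "- s"] 2 by simp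
      finally show ?thesis using 2 by (simp add: two_sided_def)
    next
      case 3
      then show ?thesis using pos[of t] lpos[of "- s"] by (simp add: two_sided_def)
    next
      case 4
      then show ?thesis using \<open>s \<le> t\<close> mono_onD[OF x2(2), of s t] by (simp add: two_sided_def)
    qed simp
  qed
  show "continuous (at_right t) ?F"
  proof (cases "t < 0")
    case True
    note lim = cadlag_left_limit[OF x1(1), of "- t"]
    show ?thesis unfolding continuous_within
    proof (rule decreasing_tendsto)
      show "\<forall>\<^sub>F s in at_right t. ?F t \<le> ?F s"
        by (auto simp: eventually_at_right_field intro!: monoD[OF mono] exI[of _ "t + 1"])
      fix y assume "?F t < y"
      then have "- y < ?l (- t)" using True by (simp add: two_sided_def)
      then have "\<forall>\<^sub>F u in at_left (- t). - y < S1 u \<omega>"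
        using order_tendstoD(1)[OF lim] True by simp
      then obtain r where r: "r < - t" "\<And>u. r < u \<Longrightarrow> u < - t \<Longrightarrow> - y < S1 u \<omega>"
        by (auto simp: eventually_at_left_field)
      have "?F s < y" if s: "t < s" "s < min 0 (- r)" for s
      proof -
        define u where "u = (max r 0 + (- s)) / 2"
        have u: "r < u" "0 \<le> u" "u < - s" "u < - t" using s by (auto simp: u_def)
        have "- y < S1 u \<omega>" using r(2) u by simp
        also have "\<dots> \<le> ?l (- s)" using lb[of u "- s"] u by simp
        finally show ?thesis using s by (simp add: two_sided_def)
      qed
      then show "\<forall>\<^sub>F s in at_right t. ?F s < y"
        using True r(1) by (auto simp: eventually_at_right_field intro!: exI[of _ "min 0 (- r)"])
    qed
  next
    case False
    then have "((\<lambda>t. S2 t \<omega>) \<longlongrightarrow> S2 t \<omega>) (at_right t)"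
      using x2(1) by (auto simp: cadlag_on_nonneg_def continuous_within)
    moreover have "\<forall>\<^sub>F s in at_right t. S2 s \<omega> = ?F s"
      using False by (auto simp: eventually_at_right_field two_sided_def intro!: exI[of _ "t + 1"])
    ultimately have "(?F \<longlongrightarrow> S2 t \<omega>) (at_right t)"
      by (rule Lim_transform_eventually)
    then show ?thesis using False by (simp add: continuous_within two_sided_def)
  qed
qed

lemma (in prob_space) levy_increment_boxes:
  assumes L: "levy_process M L"
    and t: "0 \<le> t 0" "\<And>i. i < n \<Longrightarrow> t i \<le> t (Suc i)" and A: "\<And>i. i < n \<Longrightarrow> A i \<in> sets borel"
  shows "prob {\<omega> \<in> space M. \<forall>i<n. L (t (Suc i)) \<omega> - L (t i) \<omega> \<in> A i}
    = (\<Prod>i<n. prob {\<omega> \<in> space M. L (t (Suc i) - t i) \<omega> \<in> A i})"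
proof (cases "n = 0")
  case False
  have tpos: "0 \<le> t i" if "i \<le> n" for i
    using that
  proof (induction i)
    case (Suc i)
    then show ?case using t(2)[of i] by simp
  qed (use t in simp)
  have m: "L s \<in> borel_measurable M" if "0 \<le> s" for s using L that by (simp add: levy_process_def)
  have "indep_vars (\<lambda>_. borel) (\<lambda>i \<omega>. L (t (Suc i)) \<omega> - L (t i) \<omega>) {..<n}"
    using L t unfolding levy_process_def by blast
  then have "prob (\<Inter>i\<in>{..<n}. (\<lambda>\<omega>. L (t (Suc i)) \<omega> - L (t i) \<omega>) -` A i \<inter> space M)
      = (\<Prod>i<n. prob ((\<lambda>\<omega>. L (t (Suc i)) \<omega> - L (t i) \<omega>) -` A i \<inter> space M))"
    by (rule indep_varsD_finite) (use False A in auto)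
  also have "(\<Inter>i\<in>{..<n}. (\<lambda>\<omega>. L (t (Suc i)) \<omega> - L (t i) \<omega>) -` A i \<inter> space M)
      = {\<omega> \<in> space M. \<forall>i<n. L (t (Suc i)) \<omega> - L (t i) \<omega> \<in> A i}"
    using False by auto
  also have "(\<Prod>i<n. prob ((\<lambda>\<omega>. L (t (Suc i)) \<omega> - L (t i) \<omega>) -` A i \<inter> space M))
      = (\<Prod>i<n. prob {\<omega> \<in> space M. L (t (Suc i) - t i) \<omega> \<in> A i})"
  proof (rule prod.cong)
    fix i assume i: "i \<in> {..<n}"
    have t_le: "t i \<le> t (Suc i)" and p: "0 \<le> t i" "0 \<le> t (Suc i)" using t i tpos by auto
    have "distr M borel (\<lambda>\<omega>. L (t i + (t (Suc i) - t i)) \<omega> - L (t i) \<omega>) = distr M borel (L (t (Suc i) - t i))"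
      using L t_le p unfolding levy_process_def by (metis diff_ge_0_iff_ge)
    then have "distr M borel (\<lambda>\<omega>. L (t (Suc i)) \<omega> - L (t i) \<omega>) = distr M borel (L (t (Suc i) - t i))"
      by simp
    from arg_cong[OF this, of "\<lambda>N. measure N (A i)"]
    show "prob ((\<lambda>\<omega>. L (t (Suc i)) \<omega> - L (t i) \<omega>) -` A i \<inter> space M) = prob {\<omega> \<in> space M. L (t (Suc i) - t i) \<omega> \<in> A i}"
      using m[OF p(1)] m[OF p(2)] m[of "t (Suc i) - t i"] t_le A i
      by (simp add: measure_distr vimage_def Int_def conj_commute)
  qed simp
  finally show ?thesis .
qed (simp add: prob_space)

text \<open>At a fixed time there is almost surely no jump: \<open>L t - L (t - h)\<close> has the law of \<open>L h\<close>, which tends to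
\<open>L 0 = 0\<close> as \<open>h\<close> decreases to zero. Thus the left limits in the two-sided process can be replaced by values
when finitely many times are considered.\<close>

lemma (in prob_space) levy_left_continuous_at:
  assumes L: "levy_process M L" and t: "0 < t"
  shows "AE \<omega> in M. Lim (at_left t) (\<lambda>u. L u \<omega>) = L t \<omega>"
    and "(\<lambda>\<omega>. Lim (at_left t) (\<lambda>u. L u \<omega>)) \<in> borel_measurable M"
proof -
  have m: "L s \<in> borel_measurable M" if "0 \<le> s" for s using L that by (simp add: levy_process_def)
  have cad: "cadlag_on_nonneg (\<lambda>t. L t \<omega>)" if "\<omega> \<in> space M" for \<omega>
    using L that by (simp add: levy_process_def)
  \<comment> \<open>The sequence decreases to zero and never exceeds \<open>t\<close>, so that \<open>t - h n\<close> stays in the time domain.\<close>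
  define h where "h n = t / real (Suc n)" for n
  have h: "0 < h n" "h n \<le> t" for n using t by (auto simp: h_def field_simps)
  have h0: "h \<longlonglongrightarrow> 0"
    unfolding h_def using tendsto_mult[OF tendsto_const[of t] lim_inverse_n'[THEN LIMSEQ_Suc]] by (simp add: field_simps)
  define J where "J \<omega> = L t \<omega> - Lim (at_left t) (\<lambda>u. L u \<omega>)" for \<omega>
  define D where "D n \<omega> = L t \<omega> - L (t - h n) \<omega>" for n \<omega>
  have t_left: "filterlim (\<lambda>n. t - h n) (at_left t) sequentially"
    unfolding filterlim_at using tendsto_diff[OF tendsto_const[of t] h0] h by (auto simp: less_imp_neq eventually_sequentially)
  have D_lim: "(\<lambda>n. D n \<omega>) \<longlonglongrightarrow> J \<omega>" if "\<omega> \<in> space M" for \<omega>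
    unfolding D_def J_def
    by (intro tendsto_diff tendsto_const filterlim_compose[OF cadlag_left_limit[OF cad[OF that] t] t_left])
  have mt: "L t \<in> borel_measurable M" using t m[of t] by simp
  have mD[measurable]: "D n \<in> borel_measurable M" for n
    unfolding D_def using mt m[of "t - h n"] h[of n] by (intro borel_measurable_diff) simp_all
  have mJ[measurable]: "J \<in> borel_measurable M"
    by (rule borel_measurable_LIMSEQ_metric[OF mD D_lim])
  have "(\<lambda>\<omega>. L t \<omega> - J \<omega>) \<in> borel_measurable M" using mt mJ by simp
  then show "(\<lambda>\<omega>. Lim (at_left t) (\<lambda>u. L u \<omega>)) \<in> borel_measurable M"
    by (simp add: J_def)
  have "(\<lambda>n. expectation (\<lambda>\<omega>. min 1 \<bar>D n \<omega>\<bar>)) \<longlonglongrightarrow> expectation (\<lambda>\<omega>. min 1 \<bar>J \<omega>\<bar>)"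
  proof (rule integral_dominated_convergence[where w = "\<lambda>_. 1"])
    show "AE \<omega> in M. (\<lambda>n. min 1 \<bar>D n \<omega>\<bar>) \<longlonglongrightarrow> min 1 \<bar>J \<omega>\<bar>"
      using D_lim by (intro AE_I2 tendsto_intros) auto
  qed auto
  moreover have "expectation (\<lambda>\<omega>. min 1 \<bar>D n \<omega>\<bar>) = expectation (\<lambda>\<omega>. min 1 \<bar>L (h n) \<omega>\<bar>)" for n
  proof -
    have "distr M borel (\<lambda>\<omega>. L ((t - h n) + h n) \<omega> - L (t - h n) \<omega>) = distr M borel (L (h n))"
      using L h[of n] unfolding levy_process_def by (metis diff_ge_0_iff_ge less_imp_le)
    then have "distr M borel (D n) = distr M borel (L (h n))"
      unfolding D_def by simp
    from arg_cong[OF this, of "\<lambda>N. integral\<^sup>L N (\<lambda>x. min 1 \<bar>x\<bar>)"]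
    show ?thesis using m[of "h n"] h[of n] by (simp add: integral_distr)
  qed
  moreover have "(\<lambda>n. expectation (\<lambda>\<omega>. min 1 \<bar>L (h n) \<omega>\<bar>)) \<longlonglongrightarrow> expectation (\<lambda>\<omega>. 0)"
  proof (rule integral_dominated_convergence[where w = "\<lambda>_. 1"])
    have "AE \<omega> in M. L 0 \<omega> = 0" using L by (simp add: levy_process_def)
    then show "AE \<omega> in M. (\<lambda>n. min 1 \<bar>L (h n) \<omega>\<bar>) \<longlonglongrightarrow> 0"
      using AE_space
    proof eventually_elim
      case (elim \<omega>)
      have right: "filterlim h (at_right 0) sequentially"
        unfolding filterlim_at using h0 h by (auto simp: less_imp_neq[symmetric] eventually_sequentially)
      have "((\<lambda>u. L u \<omega>) \<longlongrightarrow> L 0 \<omega>) (at_right 0)"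
        using cad[OF elim(2)] by (simp add: cadlag_on_nonneg_def continuous_within)
      from filterlim_compose[OF this right] have "(\<lambda>n. min 1 \<bar>L (h n) \<omega>\<bar>) \<longlonglongrightarrow> min 1 \<bar>0\<bar>"
        using elim(1) by (intro tendsto_intros) simp
      then show ?case by simp
    qed
    show "(\<lambda>\<omega>. min 1 \<bar>L (h n) \<omega>\<bar>) \<in> borel_measurable M" for n
      using m[of "h n"] h[of n] by simp
  qed auto
  ultimately have "expectation (\<lambda>\<omega>. min 1 \<bar>J \<omega>\<bar>) = 0"
    using LIMSEQ_unique by fastforce
  then have "AE \<omega> in M. min 1 \<bar>J \<omega>\<bar> = 0"
    by (subst (asm) integral_nonneg_eq_0_iff_AE) (auto intro!: integrable_const_bound[where B = 1])
  then show "AE \<omega> in M. Lim (at_left t) (\<lambda>u. L u \<omega>) = L t \<omega>"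
    by eventually_elim (auto simp: J_def min_def split: if_splits)
qed

locale two_sided_process = prob_space M for M :: "'a measure" +
  fixes S1 S2 S :: "real \<Rightarrow> 'a \<Rightarrow> real"
  assumes sub1: "subordinator M S1" and sub2: "subordinator M S2"
    and same: "same_fdd M {0..} S1 S2"
    and indep: "indep_var (\<Pi>\<^sub>M t\<in>{0..}. borel) (\<lambda>\<omega>. \<lambda>t\<in>{0..}. S1 t \<omega>)
       (\<Pi>\<^sub>M t\<in>{0..}. borel) (\<lambda>\<omega>. \<lambda>t\<in>{0..}. S2 t \<omega>)"
    and S_def: "S = two_sided S1 S2"
begin

lemma levy1: "levy_process M S1" and levy2: "levy_process M S2"
  using sub1 sub2 by (auto simp: subordinator_def)

lemma measurable_S1: "0 \<le> t \<Longrightarrow> S1 t \<in> borel_measurable M"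
  and measurable_S2: "0 \<le> t \<Longrightarrow> S2 t \<in> borel_measurable M"
  using levy1 levy2 by (auto simp: levy_process_def)

lemma measurable_S [measurable]: "S t \<in> borel_measurable M"
proof (cases "t < 0")
  case True
  have "(\<lambda>\<omega>. - Lim (at_left (- t)) (\<lambda>u. S1 u \<omega>)) \<in> borel_measurable M"
    using levy_left_continuous_at(2)[OF levy1, of "- t"] True by simp
  then show ?thesis using True by (simp add: S_def two_sided_def[abs_def])
next
  case False
  then show ?thesis using measurable_S2[of t] by (simp add: S_def two_sided_def[abs_def])
qed

lemma AE_S1_S2: "AE \<omega> in M. cadlag_on_nonneg (\<lambda>t. S1 t \<omega>) \<and> mono_on {0..} (\<lambda>t. S1 t \<omega>) \<and> S1 0 \<omega> = 0
    \<and> cadlag_on_nonneg (\<lambda>t. S2 t \<omega>) \<and> mono_on {0..} (\<lambda>t. S2 t \<omega>) \<and> S2 0 \<omega> = 0"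
proof -
  have "AE \<omega> in M. mono_on {0..} (\<lambda>t. S1 t \<omega>)" "AE \<omega> in M. mono_on {0..} (\<lambda>t. S2 t \<omega>)"
    "AE \<omega> in M. S1 0 \<omega> = 0" "AE \<omega> in M. S2 0 \<omega> = 0"
    using sub1 sub2 by (auto simp: subordinator_def levy_process_def)
  then show ?thesis using AE_space
  proof eventually_elim
    case (elim \<omega>)
    then show ?case using levy1 levy2 by (auto simp: levy_process_def)
  qed
qed

lemma AE_regular: "AE \<omega> in M. mono (\<lambda>t. S t \<omega>) \<and> (\<forall>t. continuous (at_right t) (\<lambda>t. S t \<omega>)) \<and> S 0 \<omega> = 0"
  using AE_S1_S2
proof eventually_elim
  case (elim \<omega>)
  then show ?case
    using two_sided_path[of S1 \<omega> S2] by (auto simp: S_def two_sided_def)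
qed

lemma AE_S_nonpos: "t \<le> 0 \<Longrightarrow> AE \<omega> in M. S t \<omega> = - S1 (- t) \<omega>"
proof (cases "t = 0")
  case True
  show ?thesis using AE_S1_S2 by eventually_elim (simp add: True S_def two_sided_def)
next
  case False
  assume "t \<le> 0"
  then have t: "t < 0" using False by simp
  have "AE \<omega> in M. Lim (at_left (- t)) (\<lambda>u. S1 u \<omega>) = S1 (- t) \<omega>"
    using t by (intro levy_left_continuous_at(1)[OF levy1]) simp
  then show ?thesis by eventually_elim (use t in \<open>simp add: S_def two_sided_def\<close>)
qed

lemma distr_S1_eq_S2: "0 \<le> t \<Longrightarrow> distr M borel (S1 t) = distr M borel (S2 t)"
proof -
  assume t: "0 \<le> t"
  have eq: "distr M borel (X t) = distr (distr M (\<Pi>\<^sub>M s\<in>{t}. borel) (\<lambda>\<omega>. \<lambda>s\<in>{t}. X s \<omega>)) borel (\<lambda>x. x t)"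
    if "X t \<in> borel_measurable M" for X :: "real \<Rightarrow> 'a \<Rightarrow> real"
    using that by (subst distr_distr) (auto simp: comp_def intro!: measurable_restrict)
  have "distr M (\<Pi>\<^sub>M s\<in>{t}. borel) (\<lambda>\<omega>. \<lambda>s\<in>{t}. S1 s \<omega>) = distr M (\<Pi>\<^sub>M s\<in>{t}. borel) (\<lambda>\<omega>. \<lambda>s\<in>{t}. S2 s \<omega>)"
    using same t unfolding same_fdd_def by auto
  then show ?thesis
    using eq[of S1] eq[of S2] measurable_S1[OF t] measurable_S2[OF t] by simp
qed

text \<open>The increments over a grid that contains the origin are independent, with laws given by the lengths of the
cells: cells to the left of the origin come from \<open>S1\<close> in reversed order, cells to the right from \<open>S2\<close>.
The probabilities of boxes determine the joint law.\<close>

lemma increment_boxes: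
  assumes p: "\<And>i. i < n \<Longrightarrow> p i \<le> p (Suc i)" and k: "k \<le> n" "p k = 0"
    and A: "\<And>i. i < n \<Longrightarrow> A i \<in> sets borel"
  shows "prob {\<omega> \<in> space M. \<forall>i<n. S (p (Suc i)) \<omega> - S (p i) \<omega> \<in> A i}
    = (\<Prod>i<n. prob {\<omega> \<in> space M. S2 (p (Suc i) - p i) \<omega> \<in> A i})"
proof -
  have p_mono: "p i \<le> p j" if "i \<le> j" "j \<le> n" for i j
    using that
  proof (induction j)
    case (Suc j)
    then show ?case using p[of j] by (cases "i = Suc j") auto
  qed simp
  have neg: "p i \<le> 0" if "i \<le> k" for i using p_mono[OF that k(1)] k by simp
  have pos: "0 \<le> p i" if "k \<le> i" "i \<le> n" for i using p_mono[OF that] k by simp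
  let ?P = "\<Pi>\<^sub>M t\<in>{0..}. (borel :: real measure)"
  define B1 where "B1 = {x \<in> space ?P. \<forall>i\<in>{..<k}. x (- p i) - x (- p (Suc i)) \<in> A i}"
  define B2 where "B2 = {x \<in> space ?P. \<forall>i\<in>{k..<n}. x (p (Suc i)) - x (p i) \<in> A i}"
  define E1 where "E1 = {\<omega> \<in> space M. \<forall>i<k. S1 (- p i) \<omega> - S1 (- p (Suc i)) \<omega> \<in> A i}"
  define E2 where "E2 = {\<omega> \<in> space M. \<forall>i<n - k. S2 (p (k + Suc i)) \<omega> - S2 (p (k + i)) \<omega> \<in> A (k + i)}"
  have comp: "(\<lambda>x. x t) \<in> borel_measurable ?P" if "0 \<le> t" for t :: real
    using that by (intro measurable_component_singleton) simp
  have B1: "B1 \<in> sets ?P"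
    unfolding B1_def
  proof (rule sets.sets_Collect_finite_All)
    fix i assume i: "i \<in> {..<k}"
    have "(\<lambda>x. x (- p i) - x (- p (Suc i))) \<in> borel_measurable ?P"
      using i neg[of i] neg[of "Suc i"] by (intro borel_measurable_diff comp) auto
    from measurable_sets[OF this, of "A i"] show "{x \<in> space ?P. x (- p i) - x (- p (Suc i)) \<in> A i} \<in> sets ?P"
      using A[of i] i k by (simp add: vimage_def Int_def conj_commute)
  qed simp
  have B2: "B2 \<in> sets ?P"
    unfolding B2_def
  proof (rule sets.sets_Collect_finite_All)
    fix i assume i: "i \<in> {k..<n}"
    have "(\<lambda>x. x (p (Suc i)) - x (p i)) \<in> borel_measurable ?P"
      using i pos[of i] pos[of "Suc i"] by (intro borel_measurable_diff comp) auto
    from measurable_sets[OF this, of "A i"] show "{x \<in> space ?P. x (p (Suc i)) - x (p i) \<in> A i} \<in> sets ?P"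
      using A[of i] i k by (simp add: vimage_def Int_def conj_commute)
  qed simp
  let ?X1 = "\<lambda>\<omega>. \<lambda>t\<in>{0..}. S1 t \<omega>" and ?X2 = "\<lambda>\<omega>. \<lambda>t\<in>{0..}. S2 t \<omega>"
  have X1: "?X1 \<in> M \<rightarrow>\<^sub>M ?P" and X2: "?X2 \<in> M \<rightarrow>\<^sub>M ?P"
    by (auto intro!: measurable_restrict measurable_S1 measurable_S2)
  have E1_eq: "E1 = ?X1 -` B1 \<inter> space M"
    using neg measurable_space[OF X1] by (auto simp: E1_def B1_def)
  have shift: "(\<forall>i\<in>{k..<n}. Q i) \<longleftrightarrow> (\<forall>i<n - k. Q (k + i))" for Q
  proof safe
    fix i assume "\<forall>i<n - k. Q (k + i)" "i \<in> {k..<n}"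
    then have "Q (k + (i - k))" by (intro spec[of "\<lambda>i. i < n - k \<longrightarrow> Q (k + i)", THEN mp]) auto
    then show "Q i" using \<open>i \<in> {k..<n}\<close> by simp
  qed auto
  have E2_eq: "E2 = ?X2 -` B2 \<inter> space M"
    using pos measurable_space[OF X2] by (auto simp: E2_def B2_def shift)
  have [measurable]: "E1 \<in> sets M" "E2 \<in> sets M"
    unfolding E1_eq E2_eq using measurable_sets[OF X1 B1] measurable_sets[OF X2 B2] by auto
  have "prob {\<omega> \<in> space M. \<forall>i<n. S (p (Suc i)) \<omega> - S (p i) \<omega> \<in> A i} = prob (E1 \<inter> E2)"
  proof (rule finite_measure_eq_AE)
    have "AE \<omega> in M. \<forall>i\<in>{..k}. S (p i) \<omega> = - S1 (- p i) \<omega>"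
      by (intro AE_finite_allI AE_S_nonpos neg) auto
    then show "AE \<omega> in M. (\<omega> \<in> {\<omega> \<in> space M. \<forall>i<n. S (p (Suc i)) \<omega> - S (p i) \<omega> \<in> A i}) = (\<omega> \<in> E1 \<inter> E2)"
      using AE_space
    proof eventually_elim
      case (elim \<omega>)
      have ge: "S (p i) \<omega> = S2 (p i) \<omega>" if "i \<in> {k..n}" for i
        using pos[of i] that by (simp add: S_def two_sided_def)
      have "(\<forall>i<n. S (p (Suc i)) \<omega> - S (p i) \<omega> \<in> A i)
          \<longleftrightarrow> (\<forall>i\<in>{..<k}. S (p (Suc i)) \<omega> - S (p i) \<omega> \<in> A i) \<and> (\<forall>i\<in>{k..<n}. S (p (Suc i)) \<omega> - S (p i) \<omega> \<in> A i)"
        using k(1) by (auto simp: not_less)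
      also have "(\<forall>i\<in>{..<k}. S (p (Suc i)) \<omega> - S (p i) \<omega> \<in> A i) \<longleftrightarrow> \<omega> \<in> E1"
        using elim by (auto simp: E1_def)
      also have "(\<forall>i\<in>{k..<n}. S (p (Suc i)) \<omega> - S (p i) \<omega> \<in> A i)
          \<longleftrightarrow> (\<forall>i\<in>{k..<n}. S2 (p (Suc i)) \<omega> - S2 (p i) \<omega> \<in> A i)"
        using ge by (intro ball_cong) auto
      also have "\<dots> \<longleftrightarrow> \<omega> \<in> E2"
        using elim by (simp add: E2_def shift)
      finally show ?case using elim by simp
    qed
    show "{\<omega> \<in> space M. \<forall>i<n. S (p (Suc i)) \<omega> - S (p i) \<omega> \<in> A i} \<in> sets M"
    proof -
      have "{\<omega> \<in> space M. \<forall>i\<in>{..<n}. S (p (Suc i)) \<omega> - S (p i) \<omega> \<in> A i} \<in> sets M"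
      proof (rule sets.sets_Collect_finite_All)
        fix i assume "i \<in> {..<n}"
        then have "A i \<in> sets borel" using A by simp
        moreover have "(\<lambda>\<omega>. S (p (Suc i)) \<omega> - S (p i) \<omega>) \<in> borel_measurable M" by measurable
        ultimately show "{\<omega> \<in> space M. S (p (Suc i)) \<omega> - S (p i) \<omega> \<in> A i} \<in> sets M"
          using measurable_sets[of "\<lambda>\<omega>. S (p (Suc i)) \<omega> - S (p i) \<omega>" M borel "A i"]
          by (simp add: vimage_def Int_def conj_commute)
      qed simp
      then show ?thesis by (simp only: Ball_def lessThan_iff)
    qed
  qed simp
  also have "prob (E1 \<inter> E2) = prob E1 * prob E2"
  proof -
    have "(\<lambda>x. (?X1 x, ?X2 x)) -` (B1 \<times> B2) \<inter> space M = E1 \<inter> E2"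
      unfolding E1_eq E2_eq by auto
    then show ?thesis
      using indep_varD[OF indep B1 B2] unfolding E1_eq E2_eq by simp
  qed
  also have "prob E1 = (\<Prod>i<k. prob {\<omega> \<in> space M. S2 (p (Suc i) - p i) \<omega> \<in> A i})"
  proof -
    \<comment> \<open>Time runs backwards for \<open>S1\<close>: the grid points left of the origin, reflected, in increasing order.\<close>
    define t where "t j = - p (k - j)" for j
    have "E1 = {\<omega> \<in> space M. \<forall>j<k. S1 (t (Suc j)) \<omega> - S1 (t j) \<omega> \<in> A (k - Suc j)}" (is "_ = ?R")
    proof -
      have "(\<forall>i<k. S1 (- p i) \<omega> - S1 (- p (Suc i)) \<omega> \<in> A i)
          \<longleftrightarrow> (\<forall>j<k. S1 (t (Suc j)) \<omega> - S1 (t j) \<omega> \<in> A (k - Suc j))" (is "?a \<longleftrightarrow> ?b") for \<omega>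
      proof
        assume a: ?a
        show ?b
        proof safe
          fix j assume "j < k"
          then show "S1 (t (Suc j)) \<omega> - S1 (t j) \<omega> \<in> A (k - Suc j)"
            using a[rule_format, of "k - Suc j"] by (simp add: t_def Suc_diff_Suc)
        qed
      next
        assume b: ?b
        show ?a
        proof safe
          fix i assume "i < k"
          then show "S1 (- p i) \<omega> - S1 (- p (Suc i)) \<omega> \<in> A i"
            using b[rule_format, of "k - Suc i"] by (simp add: t_def Suc_diff_Suc)
        qed
      qed
      then show ?thesis by (simp add: E1_def)
    qed
    also have "prob ?R = (\<Prod>j<k. prob {\<omega> \<in> space M. S1 (t (Suc j) - t j) \<omega> \<in> A (k - Suc j)})"
    proof (rule levy_increment_boxes[OF levy1])
      show "t j \<le> t (Suc j)" if "j < k" for j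
        using p[of "k - Suc j"] that k(1) by (simp add: t_def Suc_diff_Suc)
      show "A (k - Suc j) \<in> sets borel" if "j < k" for j using A[of "k - Suc j"] that k by simp
    qed (simp add: t_def k)
    also have "\<dots> = (\<Prod>j<k. prob {\<omega> \<in> space M. S1 (p (Suc (k - Suc j)) - p (k - Suc j)) \<omega> \<in> A (k - Suc j)})"
      by (intro prod.cong) (auto simp: t_def Suc_diff_Suc)
    also have "\<dots> = (\<Prod>i<k. prob {\<omega> \<in> space M. S1 (p (Suc i) - p i) \<omega> \<in> A i})"
      by (rule prod.nat_diff_reindex)
    also have "\<dots> = (\<Prod>i<k. prob {\<omega> \<in> space M. S2 (p (Suc i) - p i) \<omega> \<in> A i})"
    proof (rule prod.cong)
      fix i assume "i \<in> {..<k}"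
      then have i: "i < n" "0 \<le> p (Suc i) - p i" using k p[of i] by auto
      from arg_cong[OF distr_S1_eq_S2[OF i(2)], of "\<lambda>N. measure N (A i)"]
      show "prob {\<omega> \<in> space M. S1 (p (Suc i) - p i) \<omega> \<in> A i} = prob {\<omega> \<in> space M. S2 (p (Suc i) - p i) \<omega> \<in> A i}"
        using measurable_S1[OF i(2)] measurable_S2[OF i(2)] A[OF i(1)]
        by (simp add: measure_distr vimage_def Int_def conj_commute)
    qed simp
    finally show ?thesis .
  qed
  also have "prob E2 = (\<Prod>i<n - k. prob {\<omega> \<in> space M. S2 (p (k + Suc i) - p (k + i)) \<omega> \<in> A (k + i)})"
    unfolding E2_def
    by (rule levy_increment_boxes[OF levy2, where t = "\<lambda>i. p (k + i)" and A = "\<lambda>i. A (k + i)"])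
      (use k p A in auto)
  also have "(\<Prod>i<k. prob {\<omega> \<in> space M. S2 (p (Suc i) - p i) \<omega> \<in> A i})
      * (\<Prod>i<n - k. prob {\<omega> \<in> space M. S2 (p (k + Suc i) - p (k + i)) \<omega> \<in> A (k + i)})
      = (\<Prod>i<n. prob {\<omega> \<in> space M. S2 (p (Suc i) - p i) \<omega> \<in> A i})"
    using prod.atLeastLessThan_concat[of 0 k n "\<lambda>i. prob {\<omega> \<in> space M. S2 (p (Suc i) - p i) \<omega> \<in> A i}"] k(1)
    by (simp add: prod.atLeastLessThan_shift_0[of _ k n] comp_def lessThan_atLeast0)
  finally show ?thesis .
qed

end

definition increments_path :: "(real \<Rightarrow> 'a \<Rightarrow> real) \<Rightarrow> real \<Rightarrow> 'a \<Rightarrow> rat \<Rightarrow> real" where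
  "increments_path S h \<omega> q = S (of_rat q + h) \<omega> - S h \<omega>"

lemma path_cdf_increments_path:
  assumes mono: "mono (\<lambda>t. S t \<omega>)" and rc: "\<And>t. continuous (at_right t) (\<lambda>t. S t \<omega>)"
  shows "path_cdf (increments_path S h \<omega>) t = S (t + h) \<omega> - S h \<omega>"
proof -
  let ?x = "increments_path S h \<omega>"
  have mx: "mono ?x"
    by (auto simp: mono_def increments_path_def of_rat_less_eq intro!: monoD[OF mono])
  have "(INF q\<in>{q. t < of_rat q}. ?x q) = S (t + h) \<omega> - S h \<omega>"
  proof (rule antisym)
    show "S (t + h) \<omega> - S h \<omega> \<le> (INF q\<in>{q. t < of_rat q}. ?x q)"
      by (rule cINF_greatest[OF rat_above_nonempty]) (auto simp: increments_path_def intro!: monoD[OF mono])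
    show "(INF q\<in>{q. t < of_rat q}. ?x q) \<le> S (t + h) \<omega> - S h \<omega>"
    proof (rule field_le_epsilon)
      fix e :: real assume e: "0 < e"
      have "((\<lambda>t. S t \<omega>) \<longlongrightarrow> S (t + h) \<omega>) (at_right (t + h))"
        using rc[of "t + h"] by (simp add: continuous_within)
      then have "\<forall>\<^sub>F s in at_right (t + h). S s \<omega> < S (t + h) \<omega> + e"
        by (rule order_tendstoD(2)) (use e in simp)
      then obtain b where b: "t + h < b" "\<And>s. t + h < s \<Longrightarrow> s < b \<Longrightarrow> S s \<omega> < S (t + h) \<omega> + e"
        by (auto simp: eventually_at_right_field)
      obtain q where q: "t < of_rat q" "of_rat q < b - h"
        using of_rat_dense[of t "b - h"] b(1) by auto
      have "(INF q\<in>{q. t < of_rat q}. ?x q) \<le> ?x q"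
        by (rule cINF_lower[OF path_cdf_bdd_below[OF mx]]) (use q in simp)
      also have "\<dots> \<le> S (t + h) \<omega> - S h \<omega> + e"
        using b(2)[of "of_rat q + h"] q by (simp add: increments_path_def)
      finally show "(INF q\<in>{q. t < of_rat q}. ?x q) \<le> S (t + h) \<omega> - S h \<omega> + e" .
    qed
  qed
  then show ?thesis using mx by (simp add: path_cdf_def)
qed

lemma interval_measure_eqI:
  fixes N :: "real measure"
  assumes sets: "sets N = sets borel" and F: "mono F" "\<And>t. continuous (at_right t) F"
    and eq: "\<And>a b. a \<le> b \<Longrightarrow> emeasure N {a<..b} = ennreal (F b - F a)"
  shows "N = interval_measure F"
proof (rule measure_eqI_generator_eq[where E = "range (\<lambda>(a, b). {a<..b})" and \<Omega> = UNIV
      and A = "\<lambda>n::nat. {- real n<..real n}"])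
  show "Int_stable (range (\<lambda>(a::real, b). {a<..b}))"
    by (auto simp: Int_stable_def intro!: image_eqI[of _ _ "(max _ _, min _ _)"])
  show "emeasure N X = emeasure (interval_measure F) X" if "X \<in> range (\<lambda>(a::real, b). {a<..b})" for X
  proof -
    obtain a b where X: "X = {a<..b}" using \<open>X \<in> _\<close> by auto
    show ?thesis
    proof (cases "a \<le> b")
      case True
      then show ?thesis unfolding X
        using eq[OF True] emeasure_interval_measure_Ioc[OF True, of F] F by (auto simp: mono_def)
    qed (simp add: X)
  qed
  have "sets borel = sigma_sets UNIV (range (\<lambda>(a::real, b). {a<..b}))"
    by (subst borel_sigma_sets_Ioc) simp
  then show "sets N = sigma_sets UNIV (range (\<lambda>(a, b). {a<..b}))"
    and "sets (interval_measure F) = sigma_sets UNIV (range (\<lambda>(a, b). {a<..b}))"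
    using sets by simp_all
  show "(\<Union>n::nat. {- real n<..real n}) = UNIV"
  proof -
    have "\<exists>n::nat. - real n < u \<and> u \<le> real n" for u
      using reals_Archimedean2[of "\<bar>u\<bar>"] by (metis abs_less_iff less_imp_le minus_less_iff)
    then show ?thesis by auto
  qed
  show "emeasure N {- real n<..real n} \<noteq> \<infinity>" for n by (simp add: eq)
qed auto

text \<open>Measuring times and values relative to those at \<open>h\<close> translates the measure of the path so that \<open>h\<close> becomes the origin.\<close>

lemma path_stieltjes_increments_path:
  assumes mono: "mono (\<lambda>t. S t \<omega>)" and rc: "\<And>t. continuous (at_right t) (\<lambda>t. S t \<omega>)"
  shows "path_stieltjes (increments_path S h \<omega>) = distr (path_measure S \<omega>) borel (\<lambda>u. u - h)"
proof -
  let ?x = "increments_path S h \<omega>"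
  have sets_pm: "sets (path_measure S \<omega>) = sets borel" "space (path_measure S \<omega>) = UNIV"
    using mono by (simp_all add: path_measure_def)
  have "distr (path_measure S \<omega>) borel (\<lambda>u. u - h) = interval_measure (path_cdf ?x)"
  proof (rule interval_measure_eqI)
    show "mono (path_cdf ?x)" by (auto simp: mono_def intro!: path_cdf_mono)
    show "continuous (at_right t) (path_cdf ?x)" for t by (rule path_cdf_right_continuous)
    fix a b :: real assume "a \<le> b"
    have "(\<lambda>u. u - h) \<in> path_measure S \<omega> \<rightarrow>\<^sub>M borel"
      by (subst measurable_cong_sets[OF sets_pm(1) refl]) simp
    then have "emeasure (distr (path_measure S \<omega>) borel (\<lambda>u. u - h)) {a<..b} = emeasure (path_measure S \<omega>) {a + h<..b + h}"
      by (subst emeasure_distr) (auto simp: sets_pm intro!: arg_cong[where f = "emeasure _"])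
    also have "\<dots> = ennreal (S (b + h) \<omega> - S (a + h) \<omega>)"
      using mono \<open>a \<le> b\<close> emeasure_interval_measure_Ioc[of "a + h" "b + h" "\<lambda>t. S t \<omega>"] rc
      by (simp add: path_measure_def mono_def)
    finally show "emeasure (distr (path_measure S \<omega>) borel (\<lambda>u. u - h)) {a<..b} = ennreal (path_cdf ?x b - path_cdf ?x a)"
      using path_cdf_increments_path[of S \<omega> h a, OF mono rc] path_cdf_increments_path[of S \<omega> h b, OF mono rc] by simp
  qed simp
  then show ?thesis by (simp add: path_stieltjes_def)
qed

lemma nn_integral_path_stieltjes_increments_path:
  assumes "mono (\<lambda>t. S t \<omega>)" "\<And>t. continuous (at_right t) (\<lambda>t. S t \<omega>)"
    and f: "f \<in> borel_measurable borel"
  shows "(\<integral>\<^sup>+u. f u \<partial>path_stieltjes (increments_path S h \<omega>)) = (\<integral>\<^sup>+u. f (u - h) \<partial>path_measure S \<omega>)"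
proof -
  have s: "sets (path_measure S \<omega>) = sets borel" using assms(1) by (simp add: path_measure_def)
  have "(\<lambda>u. u - h) \<in> path_measure S \<omega> \<rightarrow>\<^sub>M borel"
    by (subst measurable_cong_sets[OF s refl]) simp
  then show ?thesis
    using f path_stieltjes_increments_path[of S \<omega> h, OF assms(1,2)] by (simp add: nn_integral_distr)
qed

context two_sided_process
begin

lemma increments_shift_law:
  assumes p: "\<And>i. i < n \<Longrightarrow> p i \<le> p (Suc i)"
    and k: "k \<le> n" "p k = 0" and j: "j \<le> n" "p j + h = 0"
  shows "distr M (\<Pi>\<^sub>M i\<in>{..<n}. borel) (\<lambda>\<omega>. \<lambda>i\<in>{..<n}. S (p (Suc i) + h) \<omega> - S (p i + h) \<omega>)
    = distr M (\<Pi>\<^sub>M i\<in>{..<n}. borel) (\<lambda>\<omega>. \<lambda>i\<in>{..<n}. S (p (Suc i)) \<omega> - S (p i) \<omega>)"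
    (is "?D h = ?D'")
proof -
  let ?P = "\<Pi>\<^sub>M i\<in>{..<n}. (borel :: real measure)"
  let ?X = "\<lambda>p \<omega>. \<lambda>i\<in>{..<n}. S (p (Suc i)) \<omega> - S (p i) \<omega>"
  have X: "?X p \<in> M \<rightarrow>\<^sub>M ?P" for p :: "nat \<Rightarrow> real"
    by (intro measurable_restrict borel_measurable_diff measurable_S)
  have box: "distr M ?P (?X p) (Pi\<^sub>E {..<n} A) = ennreal (\<Prod>i<n. prob {\<omega> \<in> space M. S2 (p (Suc i) - p i) \<omega> \<in> A i})"
    if "\<And>i. i < n \<Longrightarrow> p i \<le> p (Suc i)" "k \<le> n" "p k = 0" "\<And>i. i \<in> {..<n} \<Longrightarrow> A i \<in> sets borel" for p k A
  proof -
    have "distr M ?P (?X p) (Pi\<^sub>E {..<n} A) = emeasure M (?X p -` Pi\<^sub>E {..<n} A \<inter> space M)"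
      by (rule emeasure_distr[OF X]) (use that in \<open>auto intro!: sets_PiM_I_finite\<close>)
    also have "?X p -` Pi\<^sub>E {..<n} A \<inter> space M = {\<omega> \<in> space M. \<forall>i<n. S (p (Suc i)) \<omega> - S (p i) \<omega> \<in> A i}"
      unfolding vimage_def Int_def mem_Collect_eq restrict_PiE_iff Ball_def lessThan_iff by blast
    also have "emeasure M {\<omega> \<in> space M. \<forall>i<n. S (p (Suc i)) \<omega> - S (p i) \<omega> \<in> A i}
        = ennreal (\<Prod>i<n. prob {\<omega> \<in> space M. S2 (p (Suc i) - p i) \<omega> \<in> A i})"
      unfolding emeasure_eq_measure
      by (rule arg_cong[OF increment_boxes[of n p k A]]) (use that in simp_all)
    finally show ?thesis .
  qed
  have "distr M ?P (?X (\<lambda>i. p i + h)) = distr M ?P (?X p)"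
  proof (rule measure_eqI_PiM_finite[where I = "{..<n}" and M = "\<lambda>_. borel" and A = "\<lambda>_. Pi\<^sub>E {..<n} (\<lambda>_. UNIV)"])
    fix A :: "nat \<Rightarrow> real set" assume A: "\<And>i. i \<in> {..<n} \<Longrightarrow> A i \<in> sets borel"
    show "distr M ?P (?X (\<lambda>i. p i + h)) (Pi\<^sub>E {..<n} A) = distr M ?P (?X p) (Pi\<^sub>E {..<n} A)"
    proof -
      have "distr M ?P (?X (\<lambda>i. p i + h)) (Pi\<^sub>E {..<n} A)
          = ennreal (\<Prod>i<n. prob {\<omega> \<in> space M. S2 ((p (Suc i) + h) - (p i + h)) \<omega> \<in> A i})"
        by (rule box[of "\<lambda>i. p i + h" j A]) (use p j A in auto)
      also have "\<dots> = ennreal (\<Prod>i<n. prob {\<omega> \<in> space M. S2 (p (Suc i) - p i) \<omega> \<in> A i})"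
        by (simp only: add_diff_cancel_right)
      also have "\<dots> = distr M ?P (?X p) (Pi\<^sub>E {..<n} A)"
        by (rule box[of p k A, symmetric]) (use p k A in auto)
      finally show ?thesis .
    qed
  next
    show "range (\<lambda>_::nat. Pi\<^sub>E {..<n} (\<lambda>_. UNIV)) \<subseteq> prod_algebra {..<n} (\<lambda>_. borel :: real measure)"
      by (auto intro!: prod_algebraI_finite)
    interpret D: prob_space "distr M ?P (?X (\<lambda>i. p i + h))" by (rule prob_space_distr[OF X])
    show "distr M ?P (?X (\<lambda>i. p i + h)) (Pi\<^sub>E {..<n} (\<lambda>_. UNIV)) \<noteq> \<infinity>"
      using D.emeasure_finite unfolding infinity_ennreal_def .
  qed (auto simp: space_PiM)
  then show ?thesis .
qed

text \<open>By telescoping, the increments from \<open>h\<close> to the shifted times are sums of increments over the cells of a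
grid, so it suffices that the joint law of the latter is invariant under shifts.\<close>

lemma stationary_law_family:
  fixes \<tau> :: "'i \<Rightarrow> real"
  assumes J: "finite J"
  shows "distr M (\<Pi>\<^sub>M i\<in>J. borel) (\<lambda>\<omega>. \<lambda>i\<in>J. S (\<tau> i + h) \<omega> - S h \<omega>)
    = distr M (\<Pi>\<^sub>M i\<in>J. borel) (\<lambda>\<omega>. \<lambda>i\<in>J. S (\<tau> i) \<omega> - S 0 \<omega>)"
proof -
  \<comment> \<open>The grid contains every time of the family, the origin, and the point that the shift moves to the origin.\<close>
  define T where "T = insert 0 (insert (- h) (\<tau> ` J))"
  define ps where "ps = sorted_list_of_set T"
  have T: "finite T" "T \<noteq> {}" using J by (auto simp: T_def)
  have ps: "set ps = T" "sorted ps" "ps \<noteq> []" using T by (auto simp: ps_def)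
  define n where "n = length ps - 1"
  have len: "length ps = Suc n" using ps(3) by (simp add: n_def)
  define p where "p i = ps ! i" for i
  have p: "p i \<le> p (Suc i)" if "i < n" for i
    using ps(2) that len unfolding p_def by (intro sorted_nth_mono) auto
  have "\<exists>i\<le>n. p i = r" if "r \<in> T" for r
    using that ps(1) len unfolding p_def by (metis in_set_conv_nth less_Suc_eq_le)
  then obtain idx where idx: "\<And>r. r \<in> T \<Longrightarrow> idx r \<le> n" "\<And>r. r \<in> T \<Longrightarrow> p (idx r) = r"
    by metis
  have in_T: "0 \<in> T" "- h \<in> T" "\<And>i. i \<in> J \<Longrightarrow> \<tau> i \<in> T" by (auto simp: T_def)
  let ?P = "\<Pi>\<^sub>M i\<in>{..<n}. (borel :: real measure)" and ?Q = "\<Pi>\<^sub>M i\<in>J. (borel :: real measure)"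
  define \<Phi> where "\<Phi> y = (\<lambda>i\<in>J. (\<Sum>l<idx (\<tau> i). y l) - (\<Sum>l<idx 0. y l))" for y :: "nat \<Rightarrow> real"
  have \<Phi>: "\<Phi> \<in> ?P \<rightarrow>\<^sub>M ?Q"
    unfolding \<Phi>_def
  proof (intro measurable_restrict borel_measurable_diff borel_measurable_sum)
    fix i l assume "i \<in> J" "l \<in> {..<idx (\<tau> i)}"
    then show "(\<lambda>y. y l) \<in> borel_measurable ?P"
      using idx(1)[OF in_T(3)] by (intro measurable_component_singleton) (auto dest: order_less_le_trans)
  next
    fix l assume "l \<in> {..<idx 0}"
    then show "(\<lambda>y. y l) \<in> borel_measurable ?P"
      using idx(1)[OF in_T(1)] by (intro measurable_component_singleton) auto
  qed
  let ?X = "\<lambda>h \<omega>. \<lambda>i\<in>{..<n}. S (p (Suc i) + h) \<omega> - S (p i + h) \<omega>"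
  have X: "?X h \<in> M \<rightarrow>\<^sub>M ?P" for h :: real
    by (intro measurable_restrict borel_measurable_diff measurable_S)
  have tele: "(\<lambda>\<omega>. \<lambda>i\<in>J. S (\<tau> i + h) \<omega> - S h \<omega>) = (\<lambda>\<omega>. \<Phi> (?X h \<omega>))" for h
  proof
    fix \<omega>
    have sum: "(\<Sum>l<idx r. ?X h \<omega> l) = S (r + h) \<omega> - S (p 0 + h) \<omega>" if "r \<in> T" for r
    proof -
      have "(\<Sum>l<idx r. ?X h \<omega> l) = (\<Sum>l<idx r. S (p (Suc l) + h) \<omega> - S (p l + h) \<omega>)"
        using idx(1)[OF that] by (intro sum.cong) auto
      also have "\<dots> = S (p (idx r) + h) \<omega> - S (p 0 + h) \<omega>"
        by (rule sum_lessThan_telescope)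
      finally show ?thesis by (simp add: idx(2)[OF that])
    qed
    show "(\<lambda>i\<in>J. S (\<tau> i + h) \<omega> - S h \<omega>) = \<Phi> (?X h \<omega>)"
      using sum[OF in_T(1)] sum[OF in_T(3)] unfolding \<Phi>_def by (intro restrict_ext) simp
  qed
  have law: "distr M ?Q (\<lambda>\<omega>. \<lambda>i\<in>J. S (\<tau> i + h) \<omega> - S h \<omega>) = distr (distr M ?P (?X h)) ?Q \<Phi>" for h
    unfolding tele by (subst distr_distr[OF \<Phi> X]) (simp add: comp_def)
  have "distr M ?P (?X h) = distr M ?P (?X 0)"
    using increments_shift_law[of n p "idx 0" "idx (- h)" h, OF p] idx in_T by simp
  then show ?thesis
    using law[of h] law[of 0] by simp
qed

lemma measurable_increments_path: "increments_path S h \<in> M \<rightarrow>\<^sub>M path_space"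
  unfolding increments_path_def[abs_def] by (intro measurable_PiM_single') auto

text \<open>Strict stationarity in the form used below: every measurable functional of the increments observed at
rational distances from \<open>h\<close> has a law that does not depend on \<open>h\<close>.\<close>

theorem increments_path_law:
  "distr M path_space (increments_path S h) = distr M path_space (increments_path S 0)"
proof (rule measure_eqI_PiM_infinite[where I = UNIV and M = "\<lambda>_. borel"])
  show "finite_measure (distr M path_space (increments_path S h))"
    by (intro finite_measure_distr measurable_increments_path)
  fix A :: "rat \<Rightarrow> real set" and J :: "rat set" assume J: "finite J" and A: "\<And>i. i \<in> J \<Longrightarrow> A i \<in> sets borel"
  have E: "Pi\<^sub>E J A \<in> sets (\<Pi>\<^sub>M i\<in>J. borel)" using J A by (intro sets_PiM_I_finite) auto
  have "distr M path_space (increments_path S h) (prod_emb UNIV (\<lambda>_. borel) J (Pi\<^sub>E J A))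
      = distr M (\<Pi>\<^sub>M i\<in>J. borel) (\<lambda>\<omega>. \<lambda>i\<in>J. S (of_rat i + h) \<omega> - S h \<omega>) (Pi\<^sub>E J A)" for h
  proof -
    have m: "(\<lambda>\<omega>. \<lambda>i\<in>J. S (of_rat i + h) \<omega> - S h \<omega>) \<in> M \<rightarrow>\<^sub>M (\<Pi>\<^sub>M i\<in>J. borel)"
      by (intro measurable_restrict borel_measurable_diff measurable_S)
    have "distr M path_space (increments_path S h) (prod_emb UNIV (\<lambda>_. borel) J (Pi\<^sub>E J A))
        = emeasure M (increments_path S h -` prod_emb UNIV (\<lambda>_. borel) J (Pi\<^sub>E J A) \<inter> space M)"
      using J A by (intro emeasure_distr measurable_increments_path sets_PiM_I) auto
    also have "increments_path S h -` prod_emb UNIV (\<lambda>_. borel) J (Pi\<^sub>E J A) \<inter> space M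
        = (\<lambda>\<omega>. \<lambda>i\<in>J. S (of_rat i + h) \<omega> - S h \<omega>) -` Pi\<^sub>E J A \<inter> space M"
      by (auto simp: prod_emb_def increments_path_def PiE_iff)
    also have "emeasure M \<dots> = distr M (\<Pi>\<^sub>M i\<in>J. borel) (\<lambda>\<omega>. \<lambda>i\<in>J. S (of_rat i + h) \<omega> - S h \<omega>) (Pi\<^sub>E J A)"
      by (rule emeasure_distr[OF m E, symmetric])
    finally show ?thesis .
  qed
  from this[of h] this[of 0] show "distr M path_space (increments_path S h) (prod_emb UNIV (\<lambda>_. borel) J (Pi\<^sub>E J A))
      = distr M path_space (increments_path S 0) (prod_emb UNIV (\<lambda>_. borel) J (Pi\<^sub>E J A))"
    using stationary_law_family[OF J, of of_rat h] by simp
qed auto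

end

section \<open>Lebesgue null sets are null for the path measures\<close>

context two_sided_process
begin

text \<open>For each path the set of \<open>h\<close> for which the translate of \<open>N\<close> by \<open>h\<close> has positive measure is Lebesgue null, by
Fubini and the translation and reflection invariance of Lebesgue measure. Exchanging the order once
more gives a single \<open>h\<close> whose translate is almost surely null, and stationarity moves it back to \<open>N\<close>.\<close>

theorem AE_path_measure_null:
  assumes N: "N \<in> null_sets lborel"
  shows "AE \<omega> in M. emeasure (path_measure S \<omega>) N = 0"
proof -
  have Nb[measurable]: "N \<in> sets borel" and N0: "emeasure lborel N = 0" using N by auto
  define \<Phi> where "\<Phi> x = (\<integral>\<^sup>+u. indicator N u \<partial>path_stieltjes x)" for x
  have \<Phi>[measurable]: "\<Phi> \<in> borel_measurable path_space"
    unfolding \<Phi>_def by (rule measurable_nn_integral_path_stieltjes) measurable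
  note inc[measurable] = measurable_increments_path
  define G where "G = (\<lambda>(\<omega>, h). \<integral>\<^sup>+u. indicator N (u - h) \<partial>path_stieltjes (increments_path S 0 \<omega>))"
  have G: "G \<in> borel_measurable (M \<Otimes>\<^sub>M lborel)"
  proof -
    have "(\<lambda>y. \<integral>\<^sup>+u. indicator N (u - snd y) \<partial>path_stieltjes (increments_path S 0 (fst y))) \<in> borel_measurable (M \<Otimes>\<^sub>M lborel)"
      by (rule measurable_nn_integral_path_stieltjes) measurable
    then show ?thesis by (simp add: G_def case_prod_unfold)
  qed
  have shift: "AE \<omega> in M. \<forall>h. \<Phi> (increments_path S h \<omega>) = G (\<omega>, h)"
    using AE_regular
  proof eventually_elim
    case (elim \<omega>)
    then have r: "mono (\<lambda>t. S t \<omega>)" "\<And>t. continuous (at_right t) (\<lambda>t. S t \<omega>)" by auto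
    show ?case
    proof
      fix h :: real
      have [measurable]: "(\<lambda>u. indicator N (u - h) :: ennreal) \<in> borel_measurable borel" by measurable
      show "\<Phi> (increments_path S h \<omega>) = G (\<omega>, h)"
        unfolding \<Phi>_def G_def
        using nn_integral_path_stieltjes_increments_path[of S \<omega> "indicator N" h, OF r]
          nn_integral_path_stieltjes_increments_path[of S \<omega> "\<lambda>u. indicator N (u - h)" 0, OF r]
        by simp
    qed
  qed
  have zero: "(\<integral>\<^sup>+h. G (\<omega>, h) \<partial>lborel) = 0" for \<omega>
  proof -
    let ?K = "path_stieltjes (increments_path S 0 \<omega>)"
    interpret K: sigma_finite_measure ?K
      unfolding path_stieltjes_def by (intro sigma_finite_interval_measure path_cdf_mono path_cdf_right_continuous)
    interpret P: pair_sigma_finite ?K lborel ..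
    have [measurable]: "(\<lambda>(u, h). indicator N (u - h) :: ennreal) \<in> borel_measurable (?K \<Otimes>\<^sub>M lborel)"
      by measurable
    have "(\<integral>\<^sup>+h. G (\<omega>, h) \<partial>lborel) = (\<integral>\<^sup>+u. (\<integral>\<^sup>+h. indicator N (u - h) \<partial>lborel) \<partial>?K)"
      unfolding G_def case_prod_conv by (rule P.Fubini') measurable
    also have "(\<lambda>u. \<integral>\<^sup>+h. indicator N (u - h) \<partial>lborel) = (\<lambda>u. 0 :: ennreal)"
    proof
      fix u :: real
      have "(\<integral>\<^sup>+h. indicator N (u - h) \<partial>lborel) = (\<integral>\<^sup>+h. indicator N h \<partial>lborel)"
        using nn_integral_real_affine[of "indicator N" "-1" u] by simp
      then show "(\<integral>\<^sup>+h. indicator N (u - h) \<partial>lborel) = (0 :: ennreal)" using N0 by simp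
    qed
    finally show ?thesis by simp
  qed
  interpret MH: pair_sigma_finite M lborel ..
  have "(\<integral>\<^sup>+h. (\<integral>\<^sup>+\<omega>. G (\<omega>, h) \<partial>M) \<partial>lborel) = (\<integral>\<^sup>+\<omega>. (\<integral>\<^sup>+h. G (\<omega>, h) \<partial>lborel) \<partial>M)"
    using G by (intro MH.Fubini' ) simp
  then have "(\<integral>\<^sup>+h. (\<integral>\<^sup>+\<omega>. G (\<omega>, h) \<partial>M) \<partial>lborel) = 0"
    by (simp add: zero)
  moreover have "(\<lambda>h. \<integral>\<^sup>+\<omega>. G (\<omega>, h) \<partial>M) \<in> borel_measurable lborel"
    using borel_measurable_nn_integral_fst[OF measurable_pair_swap[OF G]] by simp
  ultimately have "AE h in lborel. (\<integral>\<^sup>+\<omega>. G (\<omega>, h) \<partial>M) = 0"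
    by (subst (asm) nn_integral_0_iff_AE) auto
  moreover have "ae_filter lborel \<noteq> (bot :: real filter)"
    by (simp add: ae_filter_eq_bot_iff)
  ultimately obtain h where h: "(\<integral>\<^sup>+\<omega>. G (\<omega>, h) \<partial>M) = 0"
    using eventually_happens'[of "ae_filter lborel"] by blast
  have "(\<lambda>\<omega>. G (\<omega>, h)) \<in> borel_measurable M"
    using measurable_compose[OF measurable_Pair2'[of h lborel M] G] by simp
  with h have "AE \<omega> in M. G (\<omega>, h) = 0"
    by (subst (asm) nn_integral_0_iff_AE) auto
  with shift have "AE \<omega> in M. \<Phi> (increments_path S h \<omega>) = 0"
    by eventually_elim simp
  then have at_h: "AE \<omega> in M. \<Phi> (increments_path S h \<omega>) = 0" .
  have Z: "{x \<in> space path_space. \<Phi> x = 0} \<in> sets path_space"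
    using \<Phi> by (intro borel_measurable_eq) simp_all
  note dist = AE_distr_iff[OF measurable_increments_path Z]
  have "AE x in distr M path_space (increments_path S h). \<Phi> x = 0"
    using at_h by (simp only: dist)
  then have "AE \<omega> in M. \<Phi> (increments_path S 0 \<omega>) = 0"
    by (simp only: increments_path_law[of h] dist)
  then show ?thesis using AE_regular
  proof eventually_elim
    case (elim \<omega>)
    then have r: "mono (\<lambda>t. S t \<omega>)" "\<And>t. continuous (at_right t) (\<lambda>t. S t \<omega>)" by auto
    have "N \<in> sets (path_measure S \<omega>)" using r(1) Nb by (simp add: path_measure_def)
    moreover have "(\<integral>\<^sup>+u. indicator N u \<partial>path_measure S \<omega>) = 0"
      using elim(1) nn_integral_path_stieltjes_increments_path[of S \<omega> "indicator N" 0, OF r] unfolding \<Phi>_def by simp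
    ultimately show ?case by simp
  qed
qed

lemma AE_path_measure_eq_path_stieltjes:
  "AE \<omega> in M. path_measure S \<omega> = path_stieltjes (increments_path S 0 \<omega>)"
  using AE_regular
proof eventually_elim
  case (elim \<omega>)
  then have r: "mono (\<lambda>t. S t \<omega>)" "\<And>t. continuous (at_right t) (\<lambda>t. S t \<omega>)" by auto
  have s: "sets (path_measure S \<omega>) = sets borel" using r by (simp add: path_measure_def)
  show ?case
    unfolding path_stieltjes_increments_path[of S \<omega> 0, OF r] by (rule sym) (simp add: distr_id2[OF s[symmetric]])
qed

end

section \<open>The stochastic integral is the pathwise integral\<close>

text \<open>A translation invariant metric for convergence in probability is \<open>prob_norm M (X - Y)\<close>.\<close>

definition prob_norm :: "'a measure \<Rightarrow> ('a \<Rightarrow> real) \<Rightarrow> real" where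
  "prob_norm M Z = (\<integral>\<omega>. min 1 \<bar>Z \<omega>\<bar> \<partial>M)"

context prob_space
begin

lemma integrable_min1:
  fixes Z :: "'a \<Rightarrow> real"
  shows "Z \<in> borel_measurable M \<Longrightarrow> integrable M (\<lambda>\<omega>. min 1 \<bar>Z \<omega>\<bar>)"
  by (rule integrable_const_bound[where B = 1]) auto

lemma prob_norm_mono:
  assumes [measurable]: "X \<in> borel_measurable M" "Y \<in> borel_measurable M"
    and le: "AE \<omega> in M. \<bar>X \<omega>\<bar> \<le> \<bar>Y \<omega>\<bar>"
  shows "prob_norm M X \<le> prob_norm M Y"
  unfolding prob_norm_def
  by (rule integral_mono_AE) (use le in \<open>auto intro!: integrable_min1 elim: eventually_mono\<close>)

lemma prob_norm_triangle:
  assumes [measurable]: "X \<in> borel_measurable M" "Y \<in> borel_measurable M" "Z \<in> borel_measurable M"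
    and le: "AE \<omega> in M. \<bar>Z \<omega>\<bar> \<le> \<bar>X \<omega>\<bar> + \<bar>Y \<omega>\<bar>"
  shows "prob_norm M Z \<le> prob_norm M X + prob_norm M Y"
proof -
  have "prob_norm M Z \<le> (\<integral>\<omega>. min 1 \<bar>X \<omega>\<bar> + min 1 \<bar>Y \<omega>\<bar> \<partial>M)"
    unfolding prob_norm_def
  proof (rule integral_mono_AE)
    show "AE \<omega> in M. min 1 \<bar>Z \<omega>\<bar> \<le> min 1 \<bar>X \<omega>\<bar> + min 1 \<bar>Y \<omega>\<bar>"
      using le by eventually_elim (simp add: min_def, linarith)
  qed (auto intro!: integrable_min1 Bochner_Integration.integrable_add)
  also have "\<dots> = prob_norm M X + prob_norm M Y"
    unfolding prob_norm_def by (intro Bochner_Integration.integral_add integrable_min1) auto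
  finally show ?thesis .
qed

lemma prob_norm_tendsto_AE:
  assumes [measurable]: "\<And>n. X n \<in> borel_measurable M" "Y \<in> borel_measurable M"
    and lim: "AE \<omega> in M. (\<lambda>n. X n \<omega>) \<longlonglongrightarrow> Y \<omega>"
  shows "(\<lambda>n. prob_norm M (\<lambda>\<omega>. X n \<omega> - Y \<omega>)) \<longlonglongrightarrow> 0"
proof -
  have "(\<lambda>n. \<integral>\<omega>. min 1 \<bar>X n \<omega> - Y \<omega>\<bar> \<partial>M) \<longlonglongrightarrow> (\<integral>\<omega>. 0 \<partial>M)"
  proof (rule integral_dominated_convergence[where w = "\<lambda>_. 1"])
    show "AE \<omega> in M. (\<lambda>n. min 1 \<bar>X n \<omega> - Y \<omega>\<bar>) \<longlonglongrightarrow> 0"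
      using lim
    proof eventually_elim
      case (elim \<omega>)
      have "(\<lambda>n. min 1 \<bar>X n \<omega> - Y \<omega>\<bar>) \<longlonglongrightarrow> min 1 \<bar>Y \<omega> - Y \<omega>\<bar>"
        by (intro tendsto_intros elim)
      then show ?case by simp
    qed
  qed auto
  then show ?thesis by (simp add: prob_norm_def)
qed

lemma prob_norm_tendsto_in_probability:
  assumes "converges_in_probability M X Z"
  shows "(\<lambda>n. prob_norm M (\<lambda>\<omega>. X n \<omega> - Z \<omega>)) \<longlonglongrightarrow> 0"
proof (rule LIMSEQ_I)
  have [measurable]: "X n \<in> borel_measurable M" "Z \<in> borel_measurable M" for n
    using assms by (auto simp: converges_in_probability_def)
  fix r :: real assume r: "0 < r"
  define e where "e = r / 3"
  have e: "0 < e" using r by (simp add: e_def)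
  let ?B = "\<lambda>n. {\<omega> \<in> space M. \<bar>X n \<omega> - Z \<omega>\<bar> > e}"
  have "(\<lambda>n. prob (?B n)) \<longlonglongrightarrow> 0"
    using assms e by (simp add: converges_in_probability_def)
  then have "\<forall>\<^sub>F n in sequentially. prob (?B n) < e"
    by (rule order_tendstoD(2)) (rule e)
  then obtain k where k: "\<And>n. n \<ge> k \<Longrightarrow> prob (?B n) < e"
    unfolding eventually_sequentially by blast
  have "norm (prob_norm M (\<lambda>\<omega>. X n \<omega> - Z \<omega>) - 0) < r" if n: "n \<ge> k" for n
  proof -
    have "prob_norm M (\<lambda>\<omega>. X n \<omega> - Z \<omega>) \<le> (\<integral>\<omega>. e + indicator (?B n) \<omega> \<partial>M)"
      unfolding prob_norm_def
    proof (rule integral_mono_AE)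
      show "integrable M (\<lambda>\<omega>. e + indicator (?B n) \<omega>)"
        by (intro Bochner_Integration.integrable_add) (auto simp: emeasure_eq_measure)
      show "AE \<omega> in M. min 1 \<bar>X n \<omega> - Z \<omega>\<bar> \<le> e + indicator (?B n) \<omega>"
        by (rule AE_I2) (use e in \<open>auto simp: indicator_def\<close>)
    qed (auto intro!: integrable_min1)
    also have "\<dots> = e + prob (?B n)"
      by (subst Bochner_Integration.integral_add) (auto simp: emeasure_eq_measure prob_space)
    finally have "prob_norm M (\<lambda>\<omega>. X n \<omega> - Z \<omega>) \<le> 2 * e" using k[OF n] by simp
    moreover have "0 \<le> prob_norm M (\<lambda>\<omega>. X n \<omega> - Z \<omega>)"
      unfolding prob_norm_def by (intro integral_nonneg_AE AE_I2) simp
    ultimately show ?thesis using r by (simp add: e_def)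
  qed
  then show "\<exists>no. \<forall>n\<ge>no. norm (prob_norm M (\<lambda>\<omega>. X n \<omega> - Z \<omega>) - 0) < r" by blast
qed

text \<open>The Vitali-Hahn-Saks phenomenon for measures on the natural numbers with values in the random variables:
if the sequence \<open>x n J\<close> converges in probability for every set \<open>J\<close> then its tails are uniformly small.

If the oscillation of the sequence did not settle uniformly on any cylinder of sets, then sets could be
chosen successively, each agreeing with the previous ones on a longer initial segment and each forcing an
oscillation at a later index; the limit of these sets would violate convergence. On a cylinder where it does
settle, a tail set is the difference of two members of the cylinder.\<close>

theorem gliding_hump:
  fixes x :: "nat \<Rightarrow> nat set \<Rightarrow> 'a \<Rightarrow> real"
  assumes meas[measurable]: "\<And>n J. x n J \<in> borel_measurable M"
    and add: "\<And>n J K. J \<inter> K = {} \<Longrightarrow> AE \<omega> in M. x n (J \<union> K) \<omega> = x n J \<omega> + x n K \<omega>"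
    and tails: "\<And>n e. 0 < e \<Longrightarrow> \<exists>N. \<forall>B\<subseteq>{N..}. prob_norm M (x n B) \<le> e"
    and cauchy: "\<And>J e. 0 < e \<Longrightarrow> \<exists>k. \<forall>n\<ge>k. \<forall>m\<ge>k. prob_norm M (\<lambda>\<omega>. x n J \<omega> - x m J \<omega>) \<le> e"
    and e: "0 < e"
  shows "\<exists>N k. \<forall>n\<ge>k. \<forall>B\<subseteq>{N..}. prob_norm M (x n B) \<le> e"
proof -
  define \<epsilon> where "\<epsilon> = e / 3"
  have \<epsilon>: "0 < \<epsilon>" using e by (simp add: \<epsilon>_def)
  define osc where "osc n m J = prob_norm M (\<lambda>\<omega>. x n J \<omega> - x m J \<omega>)" for n m J
  define agree where "agree N J K \<longleftrightarrow> J \<inter> {..<N} = K \<inter> {..<N}" for N :: nat and J K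
  have stage: "\<exists>N'>N. \<forall>K. agree N' K J \<longrightarrow> osc n m K > \<epsilon>" if v: "osc n m J > \<epsilon>" for n m J N
  proof -
    \<comment> \<open>Four tails change when \<open>J\<close> is altered beyond a late index; together they use up half of the excess over \<open>\<epsilon>\<close>.\<close>
    define \<delta> where "\<delta> = (osc n m J - \<epsilon>) / 8"
    have \<delta>: "0 < \<delta>" using v by (simp add: \<delta>_def)
    obtain N1 N2 where N1: "\<And>B. B \<subseteq> {N1..} \<Longrightarrow> prob_norm M (x n B) \<le> \<delta>"
      and N2: "\<And>B. B \<subseteq> {N2..} \<Longrightarrow> prob_norm M (x m B) \<le> \<delta>"
      using tails[OF \<delta>, of n] tails[OF \<delta>, of m] by auto
    define N' where "N' = Suc (max N (max N1 N2))"
    have "osc n m K > \<epsilon>" if ag: "agree N' K J" for K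
    proof -
      define C where "C = J \<inter> {..<N'}"
      define J2 where "J2 = J \<inter> {N'..}"
      define K2 where "K2 = K \<inter> {N'..}"
      have J: "J = C \<union> J2" "C \<inter> J2 = {}" by (auto simp: C_def J2_def)
      have K: "K = C \<union> K2" "C \<inter> K2 = {}" 
      proof -
        have "C = K \<inter> {..<N'}" using ag unfolding agree_def C_def by (rule sym)
        moreover have "K = (K \<inter> {..<N'}) \<union> (K \<inter> {N'..})" by auto
        ultimately show "K = C \<union> K2" unfolding K2_def by simp
      qed (auto simp: C_def K2_def)
      have small: "prob_norm M (x n J2) \<le> \<delta>" "prob_norm M (x n K2) \<le> \<delta>"
        "prob_norm M (x m J2) \<le> \<delta>" "prob_norm M (x m K2) \<le> \<delta>"
        by (rule N1 N2; auto simp: J2_def K2_def N'_def)+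
      have dec: "AE \<omega> in M. x i J \<omega> = x i C \<omega> + x i J2 \<omega>" "AE \<omega> in M. x i K \<omega> = x i C \<omega> + x i K2 \<omega>" for i
        using add[OF J(2), of i, folded J(1)] add[OF K(2), of i, folded K(1)] .
      have "osc n m J \<le> prob_norm M (\<lambda>\<omega>. x n K \<omega> - x m K \<omega>)
          + prob_norm M (\<lambda>\<omega>. (x n J2 \<omega> - x n K2 \<omega>) - (x m J2 \<omega> - x m K2 \<omega>))"
        unfolding osc_def
      proof (rule prob_norm_triangle)
        show "AE \<omega> in M. \<bar>x n J \<omega> - x m J \<omega>\<bar> \<le> \<bar>x n K \<omega> - x m K \<omega>\<bar>
            + \<bar>(x n J2 \<omega> - x n K2 \<omega>) - (x m J2 \<omega> - x m K2 \<omega>)\<bar>"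
          using dec(1)[of n] dec(1)[of m] dec(2)[of n] dec(2)[of m] by eventually_elim linarith
      qed auto
      also have "prob_norm M (\<lambda>\<omega>. (x n J2 \<omega> - x n K2 \<omega>) - (x m J2 \<omega> - x m K2 \<omega>))
          \<le> prob_norm M (\<lambda>\<omega>. x n J2 \<omega> - x n K2 \<omega>) + prob_norm M (\<lambda>\<omega>. x m J2 \<omega> - x m K2 \<omega>)"
        by (rule prob_norm_triangle) auto
      also have "prob_norm M (\<lambda>\<omega>. x n J2 \<omega> - x n K2 \<omega>) \<le> prob_norm M (x n J2) + prob_norm M (x n K2)"
        by (rule prob_norm_triangle) auto
      also have "prob_norm M (\<lambda>\<omega>. x m J2 \<omega> - x m K2 \<omega>) \<le> prob_norm M (x m J2) + prob_norm M (x m K2)"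
        by (rule prob_norm_triangle) auto
      finally have "osc n m J \<le> osc n m K + 4 * \<delta>" using small unfolding osc_def by simp
      moreover have "8 * \<delta> = osc n m J - \<epsilon>" by (simp add: \<delta>_def)
      ultimately show ?thesis using \<delta> by simp
    qed
    then show ?thesis by (intro exI[of _ N']) (simp add: N'_def)
  qed
  have "\<exists>J0 N k. \<forall>J. agree N J J0 \<longrightarrow> (\<forall>n\<ge>k. \<forall>m\<ge>k. osc n m J \<le> \<epsilon>)"
  proof (rule ccontr)
    assume "\<not> ?thesis"
    then have bad: "\<exists>J n m. agree N J J0 \<and> n \<ge> k \<and> m \<ge> k \<and> osc n m J > \<epsilon>" for J0 N k
      by (meson not_le)
    define Q where "Q k = (\<lambda>(J, N) (J', N'). N < N' \<and> agree N J' J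
        \<and> (\<forall>K. agree N' K J' \<longrightarrow> (\<exists>n m. n \<ge> k \<and> m \<ge> k \<and> osc n m K > \<epsilon>)))" for k :: nat
    have "\<exists>f. \<forall>k. True \<and> Q k (f k) (f (Suc k))"
    proof (rule dependent_nat_choice[where P = "\<lambda>_ _. True" and Q = Q])
      fix p :: "nat set \<times> nat" and k :: nat
      obtain J N where p: "p = (J, N)" by fastforce
      obtain J' n m where J': "agree N J' J" "n \<ge> k" "m \<ge> k" "osc n m J' > \<epsilon>" using bad by blast
      obtain N' where "N' > N" "\<And>K. agree N' K J' \<Longrightarrow> osc n m K > \<epsilon>" using stage[OF J'(4)] by blast
      then have "Q k p (J', N')" using J' unfolding Q_def p by auto
      then show "\<exists>p'. True \<and> Q k p p'" by blast
    qed auto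
    then obtain f where f: "\<And>k. Q k (f k) (f (Suc k))" by auto
    define J where "J k = fst (f k)" for k
    define N where "N k = snd (f k)" for k
    have step: "N k < N (Suc k)" "agree (N k) (J (Suc k)) (J k)"
      "agree (N (Suc k)) K (J (Suc k)) \<Longrightarrow> \<exists>n m. n \<ge> k \<and> m \<ge> k \<and> osc n m K > \<epsilon>" for k K
      using f[of k] unfolding Q_def J_def N_def by (auto simp: case_prod_unfold)
    have chain: "agree (N i) (J j) (J i) \<and> N i \<le> N j" if "i \<le> j" for i j
      using that
    proof (induction j rule: dec_induct)
      case (step j)
      then show ?case using \<open>\<And>k. agree (N k) (J (Suc k)) (J k)\<close>[of j] \<open>\<And>k. N k < N (Suc k)\<close>[of j]
        by (fastforce simp: agree_def set_eq_iff)
    qed (simp add: agree_def)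
    define L where "L = {i. \<exists>k. i < N k \<and> i \<in> J k}"
    have L: "agree (N k) L (J k)" for k
      unfolding agree_def
    proof (intro set_eqI iffI)
      fix i assume "i \<in> L \<inter> {..<N k}"
      then obtain j where j: "i < N j" "i \<in> J j" "i < N k" by (auto simp: L_def)
      then show "i \<in> J k \<inter> {..<N k}"
        using chain[of j k] chain[of k j] by (cases "j \<le> k") (auto simp: agree_def set_eq_iff)
    qed (auto simp: L_def)
    obtain k where k: "\<And>n m. n \<ge> k \<Longrightarrow> m \<ge> k \<Longrightarrow> osc n m L \<le> \<epsilon>"
      using cauchy[OF \<epsilon>, of L] unfolding osc_def by blast
    show False using step(3)[OF L[of "Suc k"]] k by (meson not_le)
  qed
  then obtain J0 N k where settled: "\<And>J n m. agree N J J0 \<Longrightarrow> n \<ge> k \<Longrightarrow> m \<ge> k \<Longrightarrow> osc n m J \<le> \<epsilon>"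
    by blast
  obtain N1 where N1: "\<And>B. B \<subseteq> {N1..} \<Longrightarrow> prob_norm M (x k B) \<le> \<epsilon>"
    using tails[OF \<epsilon>, of k] by blast
  have "prob_norm M (x n B) \<le> e" if n: "n \<ge> k" and B: "B \<subseteq> {max N N1..}" for n B
  proof -
    define C where "C = J0 \<inter> {..<N}"
    have dis: "C \<inter> B = {}" using B by (fastforce simp: C_def)
    have "agree N C J0" "agree N (C \<union> B) J0" using B by (auto simp: agree_def C_def)
    then have o: "osc n k C \<le> \<epsilon>" "osc n k (C \<union> B) \<le> \<epsilon>" using settled n by auto
    have "prob_norm M (x n B) \<le> prob_norm M (x k B) + prob_norm M (\<lambda>\<omega>. x n B \<omega> - x k B \<omega>)"
      by (rule prob_norm_triangle) auto
    also have "prob_norm M (\<lambda>\<omega>. x n B \<omega> - x k B \<omega>) \<le> osc n k (C \<union> B) + osc n k C"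
      unfolding osc_def
    proof (rule prob_norm_triangle)
      show "AE \<omega> in M. \<bar>x n B \<omega> - x k B \<omega>\<bar> \<le> \<bar>x n (C \<union> B) \<omega> - x k (C \<union> B) \<omega>\<bar> + \<bar>x n C \<omega> - x k C \<omega>\<bar>"
        using add[OF dis, of n] add[OF dis, of k] by eventually_elim linarith
    qed auto
    finally show ?thesis using o N1[of B] B unfolding \<epsilon>_def by fastforce
  qed
  then show ?thesis by blast
qed

end

lemma regular_path_measure:
  assumes "mono (\<lambda>t. S t \<omega>)"
  shows "sets (path_measure S \<omega>) = sets borel" "space (path_measure S \<omega>) = UNIV"
  using assms by (simp_all add: path_measure_def)

lemma emeasure_path_measure_bounded:
  assumes mono: "mono (\<lambda>t. S t \<omega>)" and rc: "\<And>t. continuous (at_right t) (\<lambda>t. S t \<omega>)"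
    and B: "bounded B"
  shows "emeasure (path_measure S \<omega>) B < \<infinity>"
proof -
  obtain b where b: "\<And>u. u \<in> B \<Longrightarrow> \<bar>u\<bar> < b" "0 < b"
    using B by (auto simp: bounded_pos_less)
  have "emeasure (path_measure S \<omega>) B \<le> emeasure (path_measure S \<omega>) {- b<..b}"
    by (rule emeasure_mono) (use b in \<open>auto simp: regular_path_measure[of S \<omega>, OF mono] abs_less_iff less_imp_le minus_less_iff\<close>)
  also have "\<dots> = ennreal (S b \<omega> - S (- b) \<omega>)"
    using mono rc b emeasure_interval_measure_Ioc[of "- b" b "\<lambda>t. S t \<omega>"]
    by (simp add: path_measure_def mono_def)
  finally show ?thesis by (rule order_le_less_trans) simp
qed

text \<open>Bounded support makes all level sets of the step function, except that at zero, finite for the path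
measure, so the defining sum is a genuine integral.\<close>

lemma step_integral_eq_integral:
  assumes mono: "mono (\<lambda>t. S t \<omega>)" and rc: "\<And>t. continuous (at_right t) (\<lambda>t. S t \<omega>)"
    and g: "step_function g" and A: "A \<in> sets borel"
  shows "integrable (path_measure S \<omega>) (\<lambda>u. indicator A u * g u)"
    and "step_integral S g A \<omega> = (\<integral>u. indicator A u * g u \<partial>path_measure S \<omega>)"
proof -
  let ?\<mu> = "path_measure S \<omega>"
  have fin: "finite (range g)" and bdd: "bounded {u. g u \<noteq> 0}" and "g \<in> borel_measurable borel"
    using g by (auto simp: step_function_def simple_function_def intro: borel_measurable_simple_function)
  then have meas: "g -` {y} \<in> sets borel" for y
    using measurable_sets[of g borel borel "{y}"] by simp
  have eq: "indicator A u * g u = (\<Sum>y\<in>range g. y * indicator (A \<inter> g -` {y}) u)" for u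
  proof -
    have "(\<Sum>y\<in>range g. y * indicator (A \<inter> g -` {y}) u) = (\<Sum>y\<in>range g. if y = g u then y * indicator A u else 0)"
      by (intro sum.cong) (auto simp: indicator_def)
    also have "\<dots> = g u * indicator A u" using fin by (simp add: sum.delta)
    finally show ?thesis by (simp add: ac_simps)
  qed
  have summand: "integrable ?\<mu> (\<lambda>u. y * indicator (A \<inter> g -` {y}) u)
      \<and> (\<integral>u. y * indicator (A \<inter> g -` {y}) u \<partial>?\<mu>) = y * measure ?\<mu> (A \<inter> g -` {y})" for y
  proof (cases "y = 0")
    case False
    have s: "A \<inter> g -` {y} \<in> sets ?\<mu>" using A meas by (simp add: regular_path_measure[of S \<omega>, OF mono])
    have "bounded (A \<inter> g -` {y})" by (rule bounded_subset[OF bdd]) (use False in auto)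
    then have "emeasure ?\<mu> (A \<inter> g -` {y}) < \<infinity>"
      by (rule emeasure_path_measure_bounded[of S \<omega>, OF mono rc])
    then show ?thesis using s by (auto simp: regular_path_measure[of S \<omega>, OF mono])
  qed simp
  show "integrable ?\<mu> (\<lambda>u. indicator A u * g u)"
    unfolding eq using summand by (intro Bochner_Integration.integrable_sum) blast
  show "step_integral S g A \<omega> = (\<integral>u. indicator A u * g u \<partial>?\<mu>)"
  proof -
    have "(\<integral>u. indicator A u * g u \<partial>?\<mu>) = (\<Sum>y\<in>range g. \<integral>u. y * indicator (A \<inter> g -` {y}) u \<partial>?\<mu>)"
      unfolding eq by (rule Bochner_Integration.integral_sum) (use summand in blast)
    also have "\<dots> = step_integral S g A \<omega>"
      unfolding step_integral_def by (intro sum.cong refl) (use summand in blast)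
    finally show ?thesis by simp
  qed
qed

context two_sided_process
begin

text \<open>The line is partitioned according to the first index \<open>j\<close> at which \<open>\<bar>u\<bar>\<close> and all values \<open>\<bar>g n u\<bar>\<close> are at
most \<open>j\<close>. On finitely many cells the approximating step functions are dominated by an integrable function, so
their integrals converge path by path. The remaining cells are negligible uniformly in \<open>n\<close> by the
gliding hump theorem, and constancy of sign, recorded by the factor \<open>c\<close>, permits monotone convergence
over the cells.\<close>

theorem subordinator_integral_eq_path_integral:
  fixes f :: "real \<Rightarrow> real"
  assumes I: "has_subordinator_integral M S f I"
    and f[measurable]: "f \<in> borel_measurable borel"
    and c: "c = 1 \<or> c = - 1" and sign: "\<And>u. 0 \<le> c * f u"
  shows "AE \<omega> in M. integrable (path_measure S \<omega>) f \<and> I \<omega> = (\<integral>u. f u \<partial>path_measure S \<omega>)"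
proof -
  obtain g where step: "\<And>n. step_function (g n)"
    and conv: "AE u in lborel. (\<lambda>n. g n u) \<longlonglongrightarrow> f u"
    and lim: "\<And>A. A \<in> sets borel \<Longrightarrow> \<exists>Z. converges_in_probability M (\<lambda>n. step_integral S (g n) A) Z"
    and limI: "converges_in_probability M (\<lambda>n. step_integral S (g n) UNIV) I"
    using I unfolding has_subordinator_integral_def by blast
  have g[measurable]: "g n \<in> borel_measurable borel" for n
    using step by (auto simp: step_function_def intro: borel_measurable_simple_function)
  have [measurable]: "I \<in> borel_measurable M" using limI by (simp add: converges_in_probability_def)
  obtain N0 where N0_props: "{u \<in> space lborel. \<not> (\<lambda>n. g n u) \<longlonglongrightarrow> f u} \<subseteq> N0" "emeasure lborel N0 = 0" "N0 \<in> sets lborel"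
    using conv by (rule AE_E)
  have N0: "N0 \<in> null_sets lborel" "{u. \<not> (\<lambda>n. g n u) \<longlonglongrightarrow> f u} \<subseteq> N0"
    using N0_props(2,3) by (rule null_setsI) (use N0_props(1) in simp)
  \<comment> \<open>A convergent sequence is bounded, so these sets exhaust the line up to a null set.\<close>
  define E where "E j = {u::real. \<bar>u\<bar> \<le> real j \<and> (\<forall>n. \<bar>g n u\<bar> \<le> real j)}" for j
  have E[measurable]: "E j \<in> sets borel" for j unfolding E_def by measurable
  define D where "D J = (\<Union>j\<in>J. disjointed E j)" for J
  have D[measurable]: "D J \<in> sets borel" for J
  proof -
    have "range (disjointed E) \<subseteq> sets borel" by (rule sets.range_disjointed_sets) (use E in auto)
    then show ?thesis unfolding D_def by (intro sets.countable_UN') auto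
  qed
  have D_Un: "D (J \<union> K) = D J \<union> D K" for J K by (auto simp: D_def)
  have D_Int: "D J \<inter> D K = {}" if "J \<inter> K = {}" for J K
  proof (rule equals0I)
    fix u assume "u \<in> D J \<inter> D K"
    then obtain j k where jk: "j \<in> J" "k \<in> K" "u \<in> disjointed E j \<inter> disjointed E k" unfolding D_def by blast
    then have "j \<noteq> k" using that by blast
    then have "disjointed E j \<inter> disjointed E k = {}"
      by (intro disjoint_family_onD[OF disjoint_family_disjointed]) auto
    then show False using jk(3) by blast
  qed
  have D_mono: "J \<subseteq> K \<Longrightarrow> D J \<subseteq> D K" for J K by (auto simp: D_def)
  have D_less: "D {..<N} = (\<Union>j<N. E j)" for N
    unfolding D_def by (simp add: finite_UN_disjointed_eq lessThan_atLeast0)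
  have D_bound: "\<bar>u\<bar> \<le> real N \<and> (\<forall>n. \<bar>g n u\<bar> \<le> real N)" if uN: "u \<in> D {..<N}" for u N
  proof -
    obtain j where "j < N" "u \<in> E j" using uN by (auto simp: D_less)
    then show ?thesis unfolding E_def by (auto intro: order_trans[OF _ of_nat_mono])
  qed
  have D_UNIV: "u \<in> D UNIV" if "u \<notin> N0" for u
  proof -
    have "(\<lambda>n. g n u) \<longlonglongrightarrow> f u" using that N0(2) by auto
    then obtain K where K: "\<And>n. \<bar>g n u\<bar> \<le> K"
      using convergent_imp_Bseq[of "\<lambda>n. g n u"] by (auto simp: convergent_def Bseq_def)
    obtain j :: nat where "max \<bar>u\<bar> K \<le> real j" using real_arch_simple by blast
    then have "u \<in> E j" using K unfolding E_def by (auto intro: order_trans)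
    then show ?thesis unfolding D_def UN_disjointed_eq by auto
  qed
  let ?\<kappa> = "\<lambda>\<omega>. path_stieltjes (increments_path S 0 \<omega>)"
  have good: "AE \<omega> in M. mono (\<lambda>t. S t \<omega>) \<and> (\<forall>t. continuous (at_right t) (\<lambda>t. S t \<omega>))
      \<and> ?\<kappa> \<omega> = path_measure S \<omega> \<and> (AE u in path_measure S \<omega>. u \<notin> N0)"
    using AE_regular AE_path_measure_null[OF N0(1)] AE_path_measure_eq_path_stieltjes
  proof eventually_elim
    case (elim \<omega>)
    have "N0 \<in> null_sets (path_measure S \<omega>)"
      using elim N0(1) by (auto simp: null_sets_def regular_path_measure[of S \<omega>])
    then have "AE u in path_measure S \<omega>. u \<notin> N0" by (rule AE_not_in)
    then show ?case using elim by simp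
  qed
  define x where "x n J = step_integral S (g n) (D J)" for n J
  have x[measurable]: "x n J \<in> borel_measurable M" for n J
  proof -
    obtain Z where "converges_in_probability M (\<lambda>n. step_integral S (g n) (D J)) Z" using lim[OF D] by blast
    then show ?thesis by (simp add: x_def converges_in_probability_def)
  qed
  have x_eq: "AE \<omega> in M. \<forall>J. integrable (path_measure S \<omega>) (\<lambda>u. indicator (D J) u * g n u)
      \<and> x n J \<omega> = (\<integral>u. indicator (D J) u * g n u \<partial>path_measure S \<omega>)" for n
    using good
  proof eventually_elim
    case (elim \<omega>)
    then show ?case
      unfolding x_def using step_integral_eq_integral[of S \<omega>, OF _ _ step[of n] D] by blast
  qed
  have tail_meas[measurable]: "(\<lambda>\<omega>. enn2real (\<integral>\<^sup>+u. ennreal (indicator (D J) u * \<bar>h u\<bar>) \<partial>?\<kappa> \<omega>)) \<in> borel_measurable M"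
    if [measurable]: "h \<in> borel_measurable borel" for h :: "real \<Rightarrow> real" and J
  proof -
    have "(\<lambda>\<omega>. \<integral>\<^sup>+u. ennreal (indicator (D J) u * \<bar>h u\<bar>) \<partial>?\<kappa> \<omega>) \<in> borel_measurable M"
      by (rule measurable_nn_integral_path_stieltjes[OF _ measurable_increments_path]) measurable
    then show ?thesis by measurable
  qed
  have small: "\<exists>N k. \<forall>n\<ge>k. \<forall>B\<subseteq>{N..}. prob_norm M (x n B) \<le> e" if "0 < e" for e
  proof (rule gliding_hump[OF x _ _ _ that])
    fix n :: nat and J K :: "nat set" assume JK: "J \<inter> K = {}"
    show "AE \<omega> in M. x n (J \<union> K) \<omega> = x n J \<omega> + x n K \<omega>"
      using x_eq[of n]
    proof eventually_elim
      case (elim \<omega>)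
      have "indicator (D (J \<union> K)) u * g n u = indicator (D J) u * g n u + indicator (D K) u * g n u" for u
        using D_Int[OF JK] by (auto simp: D_Un indicator_def)
      then show ?case using elim by simp
    qed
  next
    fix n :: nat and e :: real assume e: "0 < e"
    define T where "T N \<omega> = enn2real (\<integral>\<^sup>+u. ennreal (indicator (D {N..}) u * \<bar>g n u\<bar>) \<partial>?\<kappa> \<omega>)" for N \<omega>
    have [measurable]: "T N \<in> borel_measurable M" for N
      unfolding T_def using tail_meas[OF g] .
    have T_eq: "AE \<omega> in M. \<forall>N. T N \<omega> = (\<integral>u. indicator (D {N..}) u * \<bar>g n u\<bar> \<partial>path_measure S \<omega>)"
      using good
    proof eventually_elim
      case (elim \<omega>)
      show ?case
      proof
        fix N
        have "(\<lambda>u. indicator (D {N..}) u * \<bar>g n u\<bar>) \<in> borel_measurable (path_measure S \<omega>)"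
          using elim regular_path_measure(1)[of S \<omega>] by (subst measurable_cong_sets[OF _ refl]) auto
        then show "T N \<omega> = (\<integral>u. indicator (D {N..}) u * \<bar>g n u\<bar> \<partial>path_measure S \<omega>)"
          unfolding T_def using elim by (subst integral_eq_nn_integral) auto
      qed
    qed
    have "AE \<omega> in M. (\<lambda>N. T N \<omega>) \<longlonglongrightarrow> 0"
      using T_eq x_eq[of n] good
    proof eventually_elim
      case (elim \<omega>)
      let ?\<mu> = "path_measure S \<omega>"
      have s: "sets ?\<mu> = sets borel" using elim regular_path_measure(1)[of S \<omega>] by simp
      have m: "(\<lambda>u. indicator (D J) u * \<bar>g n u\<bar>) \<in> borel_measurable ?\<mu>" for J
        by (subst measurable_cong_sets[OF s refl]) measurable
      have int: "integrable ?\<mu> (\<lambda>u. indicator (D UNIV) u * g n u)" using elim by blast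
      have "(\<lambda>N. \<integral>u. indicator (D {N..}) u * \<bar>g n u\<bar> \<partial>?\<mu>) \<longlonglongrightarrow> (\<integral>u. 0 \<partial>?\<mu>)"
      proof (rule integral_dominated_convergence[where w = "\<lambda>u. \<bar>indicator (D UNIV) u * g n u\<bar>"])
        show "AE u in ?\<mu>. (\<lambda>N. indicator (D {N..}) u * \<bar>g n u\<bar>) \<longlonglongrightarrow> 0"
        proof (rule AE_I2)
          fix u
          have "\<exists>N. \<forall>m\<ge>N. u \<notin> D {m..}"
          proof (cases "u \<in> D UNIV")
            case True
            then obtain j where "u \<in> disjointed E j" by (auto simp: D_def)
            then have "u \<in> D {j}" by (simp add: D_def)
            then have "u \<notin> D {m..}" if "m \<ge> Suc j" for m
              using D_Int[of "{j}" "{m..}"] that by auto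
            then show ?thesis by blast
          qed (use D_mono in blast)
          then obtain N where "\<And>m. m \<ge> N \<Longrightarrow> u \<notin> D {m..}" by blast
          then show "(\<lambda>N. indicator (D {N..}) u * \<bar>g n u\<bar>) \<longlonglongrightarrow> 0"
            by (intro tendsto_eventually) (auto simp: eventually_sequentially intro!: exI[of _ N])
        qed
        show "AE u in ?\<mu>. norm (indicator (D {N..}) u * \<bar>g n u\<bar>) \<le> \<bar>indicator (D UNIV) u * g n u\<bar>" for N
          using D_mono[of "{N..}" UNIV] by (intro AE_I2) (auto simp: indicator_def)
      qed (use m int in auto)
      then show ?case using elim(1) by simp
    qed
    from prob_norm_tendsto_AE[OF _ _ this] have "(\<lambda>N. prob_norm M (T N)) \<longlonglongrightarrow> 0" by simp
    then have "\<forall>\<^sub>F N in sequentially. prob_norm M (T N) < e" by (rule order_tendstoD(2)) (rule e)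
    then obtain N where N: "prob_norm M (T N) < e" by (auto simp: eventually_sequentially)
    have "prob_norm M (x n B) \<le> prob_norm M (T N)" if B: "B \<subseteq> {N..}" for B
    proof (rule prob_norm_mono)
      show "AE \<omega> in M. \<bar>x n B \<omega>\<bar> \<le> \<bar>T N \<omega>\<bar>"
        using T_eq x_eq[of n]
      proof eventually_elim
        case (elim \<omega>)
        let ?\<mu> = "path_measure S \<omega>"
        have abs_int: "integrable ?\<mu> (\<lambda>u. indicator (D J) u * \<bar>g n u\<bar>)" for J
        proof -
          have "integrable ?\<mu> (\<lambda>u. \<bar>indicator (D J) u * g n u\<bar>)" using elim(2) by (intro integrable_abs) blast
          then show ?thesis by (simp add: abs_mult)
        qed
        have "\<bar>x n B \<omega>\<bar> \<le> (\<integral>u. \<bar>indicator (D B) u * g n u\<bar> \<partial>?\<mu>)"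
          using elim(2) integral_abs_bound[of ?\<mu> "\<lambda>u. indicator (D B) u * g n u"] by simp
        also have "\<dots> \<le> (\<integral>u. indicator (D {N..}) u * \<bar>g n u\<bar> \<partial>?\<mu>)"
          by (rule integral_mono) (use abs_int elim(2) D_mono[OF B] in \<open>auto simp: indicator_def\<close>)
        also have "\<dots> = T N \<omega>" using elim(1) by simp
        finally show ?case by simp
      qed
    qed auto
    then show "\<exists>N. \<forall>B\<subseteq>{N..}. prob_norm M (x n B) \<le> e" using N by (meson less_imp_le order_trans)
  next
    fix J :: "nat set" and e :: real assume e: "0 < e"
    obtain Z where Z: "converges_in_probability M (\<lambda>n. x n J) Z" using lim[OF D] unfolding x_def by blast
    have [measurable]: "Z \<in> borel_measurable M" using Z by (simp add: converges_in_probability_def)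
    have "\<forall>\<^sub>F n in sequentially. prob_norm M (\<lambda>\<omega>. x n J \<omega> - Z \<omega>) < e / 2"
      using prob_norm_tendsto_in_probability[OF Z] by (rule order_tendstoD(2)) (use e in simp)
    then obtain k where k: "\<And>n. n \<ge> k \<Longrightarrow> prob_norm M (\<lambda>\<omega>. x n J \<omega> - Z \<omega>) < e / 2"
      unfolding eventually_sequentially by blast
    have "prob_norm M (\<lambda>\<omega>. x n J \<omega> - x m J \<omega>) \<le> e" if "n \<ge> k" "m \<ge> k" for n m
    proof -
      have "prob_norm M (\<lambda>\<omega>. x n J \<omega> - x m J \<omega>)
          \<le> prob_norm M (\<lambda>\<omega>. x n J \<omega> - Z \<omega>) + prob_norm M (\<lambda>\<omega>. x m J \<omega> - Z \<omega>)"
        by (rule prob_norm_triangle) auto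
      then show ?thesis using k[OF that(1)] k[OF that(2)] by simp
    qed
    then show "\<exists>k. \<forall>n\<ge>k. \<forall>m\<ge>k. prob_norm M (\<lambda>\<omega>. x n J \<omega> - x m J \<omega>) \<le> e" by blast
  qed
  define q where "q N \<omega> = (\<integral>\<^sup>+u. ennreal (indicator (D {..<N}) u * \<bar>f u\<bar>) \<partial>?\<kappa> \<omega>)" for N \<omega>
  define Z where "Z N \<omega> = c * enn2real (q N \<omega>)" for N \<omega>
  have Z[measurable]: "Z N \<in> borel_measurable M" for N
    unfolding Z_def q_def using tail_meas[OF f] by measurable
  have q_fin: "AE \<omega> in M. \<forall>N. q N \<omega> < \<infinity> \<and> Z N \<omega> = (\<integral>u. indicator (D {..<N}) u * f u \<partial>path_measure S \<omega>)
      \<and> (\<lambda>n. x n {..<N} \<omega>) \<longlonglongrightarrow> Z N \<omega>"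
  proof -
    have "AE \<omega> in M. \<forall>n. \<forall>J. integrable (path_measure S \<omega>) (\<lambda>u. indicator (D J) u * g n u)
      \<and> x n J \<omega> = (\<integral>u. indicator (D J) u * g n u \<partial>path_measure S \<omega>)"
      unfolding AE_all_countable using x_eq by blast
    with good show ?thesis
    proof eventually_elim
      case (elim \<omega>)
      let ?\<mu> = "path_measure S \<omega>"
      have s: "sets ?\<mu> = sets borel" and sp: "space ?\<mu> = UNIV" using elim regular_path_measure[of S \<omega>] by simp_all
      have m: "h \<in> borel_measurable ?\<mu>" if "h \<in> borel_measurable borel" for h :: "real \<Rightarrow> real"
        using that by (subst measurable_cong_sets[OF s refl])
      show ?case
      proof
        fix N :: nat
        have b_int: "integrable ?\<mu> (\<lambda>u. real N * indicator (D {..<N}) u)"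
        proof -
          have "bounded (D {..<N})"
            using D_bound[of _ N] by (intro boundedI[of _ "real N"]) auto
          then have "emeasure ?\<mu> (D {..<N}) < \<infinity>"
            using elim by (intro emeasure_path_measure_bounded) auto
          then show ?thesis by (intro integrable_mult_right integrable_real_indicator) (auto simp: s)
        qed
        have f_le: "AE u in ?\<mu>. \<bar>indicator (D {..<N}) u * f u\<bar> \<le> real N * indicator (D {..<N}) u"
        proof -
          have "AE u in ?\<mu>. u \<notin> N0" using elim by simp
          then show ?thesis
          proof eventually_elim
            case (elim u)
            then have l: "(\<lambda>n. \<bar>g n u\<bar>) \<longlonglongrightarrow> \<bar>f u\<bar>" using N0(2) by (intro tendsto_rabs) auto
            have "\<bar>f u\<bar> \<le> real N" if "u \<in> D {..<N}"
              by (rule LIMSEQ_le_const2[OF l]) (use D_bound[OF that] in auto)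
            then show ?case by (auto simp: indicator_def)
          qed
        qed
        have f_int: "integrable ?\<mu> (\<lambda>u. indicator (D {..<N}) u * f u)"
          by (rule Bochner_Integration.integrable_bound[OF b_int]) (use f_le in \<open>auto intro!: m simp: abs_mult\<close>)
        then have abs_int: "integrable ?\<mu> (\<lambda>u. indicator (D {..<N}) u * \<bar>f u\<bar>)"
          using integrable_abs[OF f_int] by (simp add: abs_mult)
        have q: "q N \<omega> = ennreal (\<integral>u. indicator (D {..<N}) u * \<bar>f u\<bar> \<partial>?\<mu>)"
          unfolding q_def using elim abs_int by (subst nn_integral_eq_integral) auto
        have "Z N \<omega> = (\<integral>u. indicator (D {..<N}) u * f u \<partial>?\<mu>)"
        proof -
          have "f u = c * \<bar>f u\<bar>" for u using sign[of u] c by auto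
          then have "(\<integral>u. indicator (D {..<N}) u * f u \<partial>?\<mu>) = (\<integral>u. c * (indicator (D {..<N}) u * \<bar>f u\<bar>) \<partial>?\<mu>)"
            by (intro Bochner_Integration.integral_cong) (auto simp: indicator_def)
          also have "\<dots> = c * (\<integral>u. indicator (D {..<N}) u * \<bar>f u\<bar> \<partial>?\<mu>)" by simp
          finally show ?thesis
            unfolding Z_def q by (simp add: Bochner_Integration.integral_nonneg)
        qed
        moreover have "(\<lambda>n. \<integral>u. indicator (D {..<N}) u * g n u \<partial>?\<mu>) \<longlonglongrightarrow> (\<integral>u. indicator (D {..<N}) u * f u \<partial>?\<mu>)"
        proof (rule integral_dominated_convergence[where w = "\<lambda>u. real N * indicator (D {..<N}) u"])
          have "AE u in ?\<mu>. u \<notin> N0" using elim by simp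
          then show "AE u in ?\<mu>. (\<lambda>n. indicator (D {..<N}) u * g n u) \<longlonglongrightarrow> indicator (D {..<N}) u * f u"
            by eventually_elim (use N0(2) in \<open>auto intro!: tendsto_intros\<close>)
          show "AE u in ?\<mu>. norm (indicator (D {..<N}) u * g n u) \<le> real N * indicator (D {..<N}) u" for n
            using D_bound[of _ N] by (intro AE_I2) (auto simp: indicator_def)
        qed (use b_int in \<open>auto intro!: m\<close>)
        ultimately show "q N \<omega> < \<infinity> \<and> Z N \<omega> = (\<integral>u. indicator (D {..<N}) u * f u \<partial>?\<mu>) \<and> (\<lambda>n. x n {..<N} \<omega>) \<longlonglongrightarrow> Z N \<omega>"
          using elim q by simp
      qed
    qed
  qed
  have x_UNIV: "AE \<omega> in M. step_integral S (g n) UNIV \<omega> = x n UNIV \<omega>" for n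
    using good x_eq[of n]
  proof eventually_elim
    case (elim \<omega>)
    let ?\<mu> = "path_measure S \<omega>"
    have s: "sets ?\<mu> = sets borel" using elim regular_path_measure[of S \<omega>] by simp_all
    have "step_integral S (g n) UNIV \<omega> = (\<integral>u. indicator UNIV u * g n u \<partial>?\<mu>)"
      using elim by (intro step_integral_eq_integral(2)[OF _ _ step]) auto
    also have "\<dots> = (\<integral>u. indicator (D UNIV) u * g n u \<partial>?\<mu>)"
    proof (rule integral_cong_AE)
      have "AE u in ?\<mu>. u \<notin> N0" using elim by simp
      then show "AE u in ?\<mu>. indicator UNIV u * g n u = indicator (D UNIV) u * g n u"
        by eventually_elim (use D_UNIV in auto)
    qed (subst measurable_cong_sets[OF s refl], measurable)+
    finally show ?case using elim by simp
  qed
  have approx: "\<exists>N. \<forall>N'\<ge>N. prob_norm M (\<lambda>\<omega>. I \<omega> - Z N' \<omega>) \<le> e" if e: "0 < e" for e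
  proof -
    obtain N k where Nk: "\<And>n B. n \<ge> k \<Longrightarrow> B \<subseteq> {N..} \<Longrightarrow> prob_norm M (x n B) \<le> e" using small[OF e] by blast
    have "prob_norm M (\<lambda>\<omega>. I \<omega> - Z N' \<omega>) \<le> e" if N': "N' \<ge> N" for N'
    proof (rule LIMSEQ_le_const)
      have 1: "(\<lambda>n. prob_norm M (\<lambda>\<omega>. step_integral S (g n) UNIV \<omega> - I \<omega>)) \<longlonglongrightarrow> 0"
        by (rule prob_norm_tendsto_in_probability[OF limI])
      have 2: "(\<lambda>n. prob_norm M (\<lambda>\<omega>. x n {..<N'} \<omega> - Z N' \<omega>)) \<longlonglongrightarrow> 0"
        by (rule prob_norm_tendsto_AE) (use q_fin in \<open>auto elim: eventually_mono\<close>)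
      show "(\<lambda>n. prob_norm M (\<lambda>\<omega>. step_integral S (g n) UNIV \<omega> - I \<omega>) + (prob_norm M (\<lambda>\<omega>. x n {..<N'} \<omega> - Z N' \<omega>) + e)) \<longlonglongrightarrow> e"
        using tendsto_add[OF 1 tendsto_add[OF 2 tendsto_const[of e]]] by simp
      have "prob_norm M (\<lambda>\<omega>. I \<omega> - Z N' \<omega>)
          \<le> prob_norm M (\<lambda>\<omega>. step_integral S (g n) UNIV \<omega> - I \<omega>) + (prob_norm M (\<lambda>\<omega>. x n {..<N'} \<omega> - Z N' \<omega>) + e)"
        if n: "n \<ge> k" for n
      proof -
        have [measurable]: "step_integral S (g n) UNIV \<in> borel_measurable M"
          using limI by (simp add: converges_in_probability_def)
        have "x n ({..<N'} \<union> {N'..}) = x n UNIV" by (rule arg_cong[of _ _ "x n"]) auto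
        moreover have "AE \<omega> in M. x n ({..<N'} \<union> {N'..}) \<omega> = x n {..<N'} \<omega> + x n {N'..} \<omega>"
          using x_eq[of n]
        proof eventually_elim
          case (elim \<omega>)
          have "D {..<N'} \<inter> D {N'..} = {}" by (rule D_Int) auto
          then have "indicator (D ({..<N'} \<union> {N'..})) u * g n u = indicator (D {..<N'}) u * g n u + indicator (D {N'..}) u * g n u" for u
            by (auto simp: D_Un indicator_def)
          then show ?case using elim by simp
        qed
        ultimately have split: "AE \<omega> in M. step_integral S (g n) UNIV \<omega> = x n {..<N'} \<omega> + x n {N'..} \<omega>"
          using x_UNIV[of n] by auto
        have "prob_norm M (\<lambda>\<omega>. I \<omega> - Z N' \<omega>)
          \<le> prob_norm M (\<lambda>\<omega>. step_integral S (g n) UNIV \<omega> - I \<omega>)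
            + prob_norm M (\<lambda>\<omega>. x n {..<N'} \<omega> - Z N' \<omega> + x n {N'..} \<omega>)"
        proof (rule prob_norm_triangle)
          show "AE \<omega> in M. \<bar>I \<omega> - Z N' \<omega>\<bar> \<le> \<bar>step_integral S (g n) UNIV \<omega> - I \<omega>\<bar>
              + \<bar>x n {..<N'} \<omega> - Z N' \<omega> + x n {N'..} \<omega>\<bar>"
            using split by eventually_elim linarith
        qed measurable
        also have "prob_norm M (\<lambda>\<omega>. x n {..<N'} \<omega> - Z N' \<omega> + x n {N'..} \<omega>)
            \<le> prob_norm M (\<lambda>\<omega>. x n {..<N'} \<omega> - Z N' \<omega>) + prob_norm M (x n {N'..})"
          by (rule prob_norm_triangle) auto
        also have "prob_norm M (x n {N'..}) \<le> e" using Nk[OF n] N' by simp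
        finally show ?thesis by simp
      qed
      then show "\<exists>k. \<forall>n\<ge>k. prob_norm M (\<lambda>\<omega>. I \<omega> - Z N' \<omega>)
          \<le> prob_norm M (\<lambda>\<omega>. step_integral S (g n) UNIV \<omega> - I \<omega>) + (prob_norm M (\<lambda>\<omega>. x n {..<N'} \<omega> - Z N' \<omega>) + e)"
        by blast
    qed
    then show ?thesis by blast
  qed
  have pn_pos: "0 \<le> prob_norm M Y" for Y unfolding prob_norm_def by (intro integral_nonneg_AE AE_I2) simp
  have L1: "(\<lambda>N. \<integral>\<omega>. norm (min 1 \<bar>I \<omega> - Z N \<omega>\<bar>) \<partial>M) \<longlonglongrightarrow> 0"
  proof (rule LIMSEQ_I)
    fix r :: real assume "0 < r"
    then obtain N where "\<forall>N'\<ge>N. prob_norm M (\<lambda>\<omega>. I \<omega> - Z N' \<omega>) \<le> r / 2" using approx[of "r / 2"] by auto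
    then show "\<exists>no. \<forall>n\<ge>no. norm ((\<integral>\<omega>. norm (min 1 \<bar>I \<omega> - Z n \<omega>\<bar>) \<partial>M) - 0) < r"
      using \<open>0 < r\<close> pn_pos unfolding prob_norm_def by (intro exI[of _ N]) fastforce
  qed
  \<comment> \<open>A subsequence that converges almost surely suffices, because the integrals over the first cells are monotone.\<close>
  obtain r where r: "strict_mono r" "AE \<omega> in M. (\<lambda>N. min 1 \<bar>I \<omega> - Z (r N) \<omega>\<bar>) \<longlonglongrightarrow> 0"
    using tendsto_L1_AE_subseq[OF integrable_min1 L1] by auto
  show ?thesis
    using good q_fin r(2)
  proof eventually_elim
    case (elim \<omega>)
    let ?\<mu> = "path_measure S \<omega>"
    have s: "sets ?\<mu> = sets borel" using elim regular_path_measure[of S \<omega>] by simp_all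
    have m: "h \<in> borel_measurable ?\<mu>" if "h \<in> borel_measurable borel" for h :: "real \<Rightarrow> ennreal"
      using that by (subst measurable_cong_sets[OF s refl])
    have fm: "f \<in> borel_measurable ?\<mu>" using f by (subst measurable_cong_sets[OF s refl])
    have "(\<lambda>N. I \<omega> - Z (r N) \<omega>) \<longlonglongrightarrow> 0"
    proof (rule tendsto_rabs_zero_cancel, rule Lim_transform_eventually[OF elim(3)])
      have "\<forall>\<^sub>F N in sequentially. min 1 \<bar>I \<omega> - Z (r N) \<omega>\<bar> < 1"
        using elim(3) by (rule order_tendstoD(2)) simp
      then show "\<forall>\<^sub>F N in sequentially. min 1 \<bar>I \<omega> - Z (r N) \<omega>\<bar> = \<bar>I \<omega> - Z (r N) \<omega>\<bar>"
        by eventually_elim simp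
    qed
    then have "(\<lambda>N. I \<omega> - (I \<omega> - Z (r N) \<omega>)) \<longlonglongrightarrow> I \<omega> - 0" by (intro tendsto_intros)
    then have "(\<lambda>N. c * Z (r N) \<omega>) \<longlonglongrightarrow> c * I \<omega>" by (intro tendsto_intros) simp
    moreover have "c * Z N \<omega> = enn2real (q N \<omega>)" for N using c by (auto simp: Z_def)
    ultimately have "(\<lambda>N. ennreal (enn2real (q (r N) \<omega>))) \<longlonglongrightarrow> ennreal (c * I \<omega>)" by (intro tendsto_ennrealI) simp
    then have qI: "(\<lambda>N. q (r N) \<omega>) \<longlonglongrightarrow> ennreal (c * I \<omega>)" using elim(2) by simp
    have "0 \<le> c * I \<omega>"
      by (rule LIMSEQ_le_const[OF \<open>(\<lambda>N. c * Z (r N) \<omega>) \<longlonglongrightarrow> c * I \<omega>\<close>])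
        (simp add: \<open>\<And>N. c * Z N \<omega> = enn2real (q N \<omega>)\<close>)
    have inc: "incseq (\<lambda>N u. ennreal (indicator (D {..<N}) u * \<bar>f u\<bar>))"
      by (auto simp: incseq_def le_fun_def indicator_def D_less)
    have "(\<integral>\<^sup>+u. ennreal \<bar>f u\<bar> \<partial>?\<mu>) = (\<integral>\<^sup>+u. (SUP N. ennreal (indicator (D {..<N}) u * \<bar>f u\<bar>)) \<partial>?\<mu>)"
    proof (rule nn_integral_cong_AE)
      have "AE u in ?\<mu>. u \<notin> N0" using elim by simp
      then show "AE u in ?\<mu>. ennreal \<bar>f u\<bar> = (SUP N. ennreal (indicator (D {..<N}) u * \<bar>f u\<bar>))"
      proof eventually_elim
        case (elim u)
        obtain j where "u \<in> E j" using D_UNIV[OF elim] unfolding D_def UN_disjointed_eq by auto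
        then have "ennreal \<bar>f u\<bar> \<le> ennreal (indicator (D {..<Suc j}) u * \<bar>f u\<bar>)"
          by (auto simp: D_less indicator_def)
        also have "\<dots> \<le> (SUP N. ennreal (indicator (D {..<N}) u * \<bar>f u\<bar>))" by (rule SUP_upper) simp
        finally show ?case by (intro antisym SUP_least) (auto simp: indicator_def)
      qed
    qed
    also have "\<dots> = (SUP N. \<integral>\<^sup>+u. ennreal (indicator (D {..<N}) u * \<bar>f u\<bar>) \<partial>?\<mu>)"
    proof (rule nn_integral_monotone_convergence_SUP[OF inc])
      show "(\<lambda>u. ennreal (indicator (D {..<N}) u * \<bar>f u\<bar>)) \<in> borel_measurable ?\<mu>" for N
        by (rule m) measurable
    qed
    also have "\<dots> = (SUP N. q N \<omega>)"
      using elim(1) unfolding q_def by simp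
    finally have SUP: "(\<integral>\<^sup>+u. ennreal \<bar>f u\<bar> \<partial>?\<mu>) = (SUP N. q N \<omega>)" .
    have "incseq (\<lambda>N. q N \<omega>)"
      unfolding q_def using inc by (intro incseq_nn_integral)
    then have "(\<lambda>N. q N \<omega>) \<longlonglongrightarrow> (\<integral>\<^sup>+u. ennreal \<bar>f u\<bar> \<partial>?\<mu>)"
      unfolding SUP by (rule LIMSEQ_SUP)
    from LIMSEQ_subseq_LIMSEQ[OF this r(1)] qI have nn: "(\<integral>\<^sup>+u. ennreal \<bar>f u\<bar> \<partial>?\<mu>) = ennreal (c * I \<omega>)"
      unfolding comp_def by (rule LIMSEQ_unique)
    have int: "integrable ?\<mu> f"
      using fm nn by (intro integrableI_bounded) simp_all
    moreover have "I \<omega> = (\<integral>u. f u \<partial>?\<mu>)"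
    proof -
      have "(\<integral>u. \<bar>f u\<bar> \<partial>?\<mu>) = c * I \<omega>"
        using nn \<open>0 \<le> c * I \<omega>\<close> fm by (subst integral_eq_nn_integral) auto
      moreover have "\<bar>f u\<bar> = c * f u" for u using sign[of u] c by auto
      ultimately have "c * (\<integral>u. f u \<partial>?\<mu>) = c * I \<omega>" by simp
      then show ?thesis using c by auto
    qed
    ultimately show ?case by simp
  qed
qed

end

section \<open>The kernel\<close>

lemma shifted_powr_antimono:
  fixes a d :: real
  assumes "0 < a" "d < 0" "v \<le> w"
  shows "(a + max w 0) powr d \<le> (a + max v 0) powr d"
  using assms by (intro powr_mono2') auto

lemma mvn_kernel_nonneg: "0 < a \<Longrightarrow> d < 0 \<Longrightarrow> 0 \<le> t \<Longrightarrow> 0 \<le> mvn_kernel a d t u"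
  using shifted_powr_antimono[of a d "- u" "t - u"] by (simp add: mvn_kernel_def)

lemma mvn_kernel_nonpos: "0 < a \<Longrightarrow> d < 0 \<Longrightarrow> t \<le> 0 \<Longrightarrow> mvn_kernel a d t u \<le> 0"
  using shifted_powr_antimono[of a d "t - u" "- u"] by (simp add: mvn_kernel_def)

lemma mvn_kernel_le: "0 < a \<Longrightarrow> d < 0 \<Longrightarrow> mvn_kernel a d t u \<le> (a + max (- u) 0) powr d"
  by (simp add: mvn_kernel_def)

lemma abs_mvn_kernel_le:
  assumes "0 < a" "d < 0"
  shows "\<bar>mvn_kernel a d t u\<bar> \<le> a powr d"
proof -
  have "0 \<le> (a + max v 0) powr d" "(a + max v 0) powr d \<le> a powr d" for v
    using assms by (auto intro!: powr_mono2')
  from this[of "- u"] this[of "t - u"] show ?thesis unfolding mvn_kernel_def by linarith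
qed

text \<open>The increments of the kernel in time are translates of the kernel; this is the source of stationarity.\<close>

lemma mvn_kernel_shift: "mvn_kernel a d (t + h) u - mvn_kernel a d h u = mvn_kernel a d t (u - h)"
  by (simp add: mvn_kernel_def algebra_simps)

lemma mvn_kernel_0 [simp]: "mvn_kernel a d 0 u = 0"
  by (simp add: mvn_kernel_def)

lemma mvn_kernel_pos:
  assumes "0 < a" "d < 0" "0 < t" "u < t"
  shows "0 < mvn_kernel a d t u"
proof -
  have "(a + max (t - u) 0) powr d < (a + max (- u) 0) powr d"
    using assms by (intro powr_less_mono2_neg) auto
  then show ?thesis by (simp add: mvn_kernel_def)
qed

lemma measurable_mvn_kernel [measurable]: "mvn_kernel a d t \<in> borel_measurable borel"
  unfolding mvn_kernel_def[abs_def] by measurable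

text \<open>Up to its sign, the kernel at a negative time is a translate of that at the opposite time, so monotonicity
in the space variable has to be examined for positive times only.\<close>

lemma abs_mvn_kernel_eq:
  assumes "0 < a" "d < 0"
  shows "\<bar>mvn_kernel a d t u\<bar> = mvn_kernel a d \<bar>t\<bar> (u - min t 0)"
proof (cases "0 \<le> t")
  case True
  then show ?thesis using mvn_kernel_nonneg[OF assms True] by simp
next
  case False
  then have "\<bar>mvn_kernel a d t u\<bar> = - mvn_kernel a d t u"
    using mvn_kernel_nonpos[OF assms, of t u] by simp
  also have "\<dots> = mvn_kernel a d (- t) (u - t)"
    using mvn_kernel_shift[of a d "- t" t u] by simp
  finally show ?thesis using False by simp
qed

text \<open>To the left of the origin the kernel is a difference of two translates of a convex power function.\<close>

lemma mvn_kernel_incr: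
  assumes "0 < a" "d < 0" "0 \<le> w" "u \<le> v" "v \<le> 0"
  shows "mvn_kernel a d w u \<le> mvn_kernel a d w v"
proof -
  define h where "h = (\<lambda>x. (a + x) powr d - (a + x + w) powr d)"
  have "h (- u) \<le> h (- v)"
  proof (rule DERIV_nonpos_imp_nonincreasing[where f = h and a = "- v" and b = "- u"])
    show "- v \<le> - u" using assms by simp
    fix x assume x: "- v \<le> x" "x \<le> - u"
    then have "0 < a + x" using assms by simp
    then have D: "(h has_real_derivative d * (a + x) powr (d - 1) - d * (a + x + w) powr (d - 1)) (at x)"
      unfolding h_def using assms by (auto intro!: derivative_eq_intros)
    have "(a + x + w) powr (d - 1) \<le> (a + x) powr (d - 1)"
      using assms \<open>0 < a + x\<close> by (intro powr_mono2') auto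
    then have "d * ((a + x) powr (d - 1) - (a + x + w) powr (d - 1)) \<le> 0"
      using assms by (intro mult_nonpos_nonneg) auto
    then show "\<exists>y. (h has_real_derivative y) (at x) \<and> y \<le> 0"
      using D by (intro exI[of _ "d * (a + x) powr (d - 1) - d * (a + x + w) powr (d - 1)"]) (simp add: algebra_simps)
  qed
  then show ?thesis using assms by (simp add: h_def mvn_kernel_def algebra_simps)
qed

lemma mvn_kernel_decr:
  assumes "0 < a" "d < 0" "0 \<le> u" "u \<le> v"
  shows "mvn_kernel a d w v \<le> mvn_kernel a d w u"
  using assms shifted_powr_antimono[of a d "w - v" "w - u"] by (simp add: mvn_kernel_def)

lemma mvn_kernel_vanishes: "0 \<le> w \<Longrightarrow> w \<le> u \<Longrightarrow> mvn_kernel a d w u = 0"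
  by (simp add: mvn_kernel_def)

text \<open>The absolute value of the kernel increases up to \<open>min t 0\<close> and decreases afterwards, and it vanishes at
infinity. A nonempty level set is thus a bounded interval around that peak, up to its end points.\<close>

lemma mvn_level_set:
  assumes a: "0 < a" and d: "d < 0" and y: "0 < y" and ne: "{u. y < \<bar>mvn_kernel a d t u\<bar>} \<noteq> {}"
  obtains \<alpha> \<beta> where "\<alpha> \<le> min t 0" "min t 0 \<le> \<beta>"
    "{\<alpha><..<\<beta>} \<subseteq> {u. y < \<bar>mvn_kernel a d t u\<bar>}" "{u. y < \<bar>mvn_kernel a d t u\<bar>} \<subseteq> {\<alpha>..\<beta>}"
proof -
  let ?J = "{u. y < \<bar>mvn_kernel a d t u\<bar>}" and ?c = "min t 0"
  let ?k = "\<lambda>u. mvn_kernel a d \<bar>t\<bar> (u - ?c)"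
  have J: "?J = {u. y < ?k u}" by (simp add: abs_mvn_kernel_eq[OF a d])
  have inc: "?k u \<le> ?k v" if "u \<le> v" "v \<le> ?c" for u v
    using that by (intro mvn_kernel_incr a d) auto
  have dec: "?k v \<le> ?k u" if "u \<le> v" "?c \<le> u" for u v
    using that by (intro mvn_kernel_decr a d) auto
  have c: "?c \<in> ?J"
  proof -
    obtain u where "y < ?k u" using ne unfolding J by auto
    also have "?k u \<le> ?k ?c" using inc[of u ?c] dec[of ?c u] by (cases "u \<le> ?c") auto
    finally show ?thesis unfolding J by simp
  qed
  have above: "bdd_above ?J"
  proof (rule bdd_aboveI)
    fix u assume "u \<in> ?J"
    then show "u \<le> \<bar>t\<bar> + ?c" using mvn_kernel_vanishes[of "\<bar>t\<bar>" "u - ?c" a d] y unfolding J by force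
  qed
  have "((\<lambda>v. (a + v) powr d) \<longlongrightarrow> 0) at_top"
    by (rule tendsto_neg_powr[OF d]) (intro filterlim_tendsto_add_at_top[OF tendsto_const] filterlim_ident)
  then have "\<forall>\<^sub>F v in at_top. (a + v) powr d < y" by (rule order_tendstoD(2)) (rule y)
  then obtain V where V: "\<And>v. v \<ge> V \<Longrightarrow> (a + v) powr d < y" by (auto simp: eventually_at_top_linorder)
  have below: "bdd_below ?J"
  proof (rule bdd_belowI)
    fix u assume u: "u \<in> ?J"
    show "?c - max V 0 \<le> u"
    proof (rule ccontr)
      assume "\<not> ?thesis"
      then have "u < ?c - max V 0" by (simp only: not_le)
      then have "V \<le> - (u - ?c)" "0 < - (u - ?c)"
        using max.cobounded1[of V 0] max.cobounded2[of 0 V] by linarith+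
      then have "(a + max (- (u - ?c)) 0) powr d < y" using V[of "- (u - ?c)"] by (simp only: max.absorb1 less_imp_le)
      then show False using mvn_kernel_le[OF a d, of "\<bar>t\<bar>" "u - ?c"] u unfolding J by simp
    qed
  qed
  show thesis
  proof
    show "Inf ?J \<le> ?c" using c below by (rule cInf_lower)
    show "?c \<le> Sup ?J" using c above by (rule cSup_upper)
    show "?J \<subseteq> {Inf ?J..Sup ?J}" using above below by (auto intro: cInf_lower cSup_upper)
    show "{Inf ?J<..<Sup ?J} \<subseteq> ?J"
    proof
      fix u assume u: "u \<in> {Inf ?J<..<Sup ?J}"
      show "u \<in> ?J"
      proof (cases "u \<le> ?c")
        case True
        obtain v where "v \<in> ?J" "v < u" using u cInf_lessD[OF ne, of u] by auto
        then show ?thesis using inc[of v u] True unfolding J by simp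
      next
        case False
        obtain v where "v \<in> ?J" "u < v" using u less_cSupD[OF ne, of u] by auto
        then show ?thesis using dec[of u v] False unfolding J by simp
      qed
    qed
  qed
qed

lemma powr_increment_le:
  fixes x w d :: real
  assumes "0 < x" "0 \<le> w" "- 1 < d" "d < 0"
  shows "(x + w) powr (d + 1) - x powr (d + 1) \<le> (d + 1) * w * x powr d"
proof (cases "w = 0")
  case False
  then have "x < x + w" using assms by simp
  then have "\<exists>z. x < z \<and> z < x + w \<and> (x + w) powr (d + 1) - x powr (d + 1) = (x + w - x) * ((d + 1) * z powr d)"
  proof (rule MVT2)
    fix z assume "x \<le> z" "z \<le> x + w"
    then show "((\<lambda>z. z powr (d + 1)) has_real_derivative (d + 1) * z powr d) (at z)"
      using assms by (auto intro!: derivative_eq_intros)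
  qed
  then obtain z where z: "x < z" "(x + w) powr (d + 1) - x powr (d + 1) = (x + w - x) * ((d + 1) * z powr d)" by blast
  have "z powr d \<le> x powr d" using z assms by (intro powr_mono2') auto
  then have "(w * (d + 1)) * z powr d \<le> (w * (d + 1)) * x powr d" using assms by (intro mult_left_mono) auto
  then show ?thesis using z(2) by (simp add: algebra_simps)
qed simp

text \<open>The kernel is at most \<open>a powr d\<close> on the interval from the origin to \<open>w\<close>, and its integral over the
negative half-line is the increment of a power function with exponent \<open>d + 1\<close>. Both parts are at most
\<open>w * a powr d\<close>; only linear growth in \<open>w\<close> matters later on.\<close>

lemma nn_integral_mvn_kernel_le:
  assumes a: "0 < a" and d: "- 1 < d" "d < 0" and w: "0 \<le> w"
  shows "(\<integral>\<^sup>+u. ennreal (mvn_kernel a d w u) \<partial>lborel) \<le> ennreal (2 * w * a powr d)"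
proof -
  let ?h = "\<lambda>v. (a + v) powr d - (a + w + v) powr d"
  define F where "F v = ((a + v) powr (d + 1) - (a + w + v) powr (d + 1)) / (d + 1)" for v
  have tail: "(\<integral>\<^sup>+v. ennreal (?h v) * indicator {0..} v \<partial>lborel) = ennreal (0 - F 0)"
  proof (rule nn_integral_FTC_atLeast)
    show "(F has_real_derivative ?h v) (at v)" if "0 \<le> v" for v
    proof -
      have "((\<lambda>v. (a + v) powr (d + 1) - (a + w + v) powr (d + 1)) has_real_derivative (d + 1) * ?h v) (at v)"
        using that a w by (auto intro!: derivative_eq_intros simp: algebra_simps)
      from DERIV_cdivide[OF this, of "d + 1"] show ?thesis using d by (simp add: F_def[abs_def])
    qed
    show "0 \<le> ?h v" if "0 \<le> v" for v
      using powr_mono2'[of d "a + v" "a + w + v"] that a d w by simp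
    show "(F \<longlongrightarrow> 0) at_top"
    proof (rule tendsto_0_le[where K = 1 and f = "\<lambda>v. w * (a + v) powr d"])
      have "((\<lambda>v. (a + v) powr d) \<longlongrightarrow> 0) at_top"
        by (rule tendsto_neg_powr[OF d(2)]) (intro filterlim_tendsto_add_at_top[OF tendsto_const] filterlim_ident)
      then show "((\<lambda>v. w * (a + v) powr d) \<longlongrightarrow> 0) at_top" by (rule tendsto_mult_right_zero)
      show "\<forall>\<^sub>F v in at_top. norm (F v) \<le> norm (w * (a + v) powr d) * 1"
        using eventually_ge_at_top[of 0]
      proof eventually_elim
        case (elim v)
        have le: "(a + v + w) powr (d + 1) - (a + v) powr (d + 1) \<le> (d + 1) * w * (a + v) powr d"
          using elim a d w by (intro powr_increment_le) auto
        have ge: "(a + v) powr (d + 1) \<le> (a + v + w) powr (d + 1)"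
          using elim a d w by (intro powr_mono2) auto
        have "norm (F v) = ((a + v + w) powr (d + 1) - (a + v) powr (d + 1)) / (d + 1)"
        proof -
          have "F v = - (((a + v + w) powr (d + 1) - (a + v) powr (d + 1)) / (d + 1))"
            by (simp add: F_def algebra_simps diff_divide_distrib)
          moreover have "0 \<le> ((a + v + w) powr (d + 1) - (a + v) powr (d + 1)) / (d + 1)"
            using ge d by simp
          ultimately show ?thesis by (simp only: real_norm_def abs_minus_cancel abs_of_nonneg)
        qed
        also have "\<dots> \<le> w * (a + v) powr d" using le d by (simp add: field_simps)
        finally show ?case using w by simp
      qed
    qed
  qed measurable
  have F0: "0 - F 0 \<le> w * a powr d"
  proof -
    have "- F 0 = ((a + w) powr (d + 1) - a powr (d + 1)) / (d + 1)"
      unfolding F_def by (simp add: minus_divide_left)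
    also have "\<dots> \<le> w * a powr d"
      using powr_increment_le[OF a w d] d by (subst pos_divide_le_eq) (simp_all add: algebra_simps)
    finally show ?thesis by simp
  qed
  have "(\<integral>\<^sup>+u. ennreal (mvn_kernel a d w u) \<partial>lborel)
      \<le> (\<integral>\<^sup>+u. ennreal (?h (- u)) * indicator {0..} (- u) + ennreal (a powr d) * indicator {0..w} u \<partial>lborel)"
  proof (rule nn_integral_mono)
    fix u :: real
    consider "u \<le> 0" | "0 < u" "u \<le> w" | "w < u" "0 < u" by linarith
    then show "ennreal (mvn_kernel a d w u) \<le> ennreal (?h (- u)) * indicator {0..} (- u) + ennreal (a powr d) * indicator {0..w} u"
    proof cases
      case 1
      then have "mvn_kernel a d w u = ?h (- u)" using w by (simp add: mvn_kernel_def algebra_simps)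
      then show ?thesis using 1 by simp
    next
      case 2
      then show ?thesis using abs_mvn_kernel_le[OF a d(2), of w u] by (simp add: ennreal_leI)
    next
      case 3
      then show ?thesis using mvn_kernel_vanishes[of w u a d] w by simp
    qed
  qed
  also have "\<dots> = (\<integral>\<^sup>+u. ennreal (?h (- u)) * indicator {0..} (- u) \<partial>lborel) + ennreal (a powr d) * emeasure lborel {0..w}"
    by (subst nn_integral_add) (auto simp: nn_integral_cmult_indicator)
  also have "(\<integral>\<^sup>+u. ennreal (?h (- u)) * indicator {0..} (- u) \<partial>lborel) = ennreal (0 - F 0)"
    using nn_integral_real_affine[of "\<lambda>v. ennreal (?h v) * indicator {0..} v" "-1" 0] tail by simp
  also have "ennreal (0 - F 0) + ennreal (a powr d) * emeasure lborel {0..w} \<le> ennreal (w * a powr d) + ennreal (w * a powr d)"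
    using F0 w by (intro add_mono ennreal_leI) (simp_all add: ennreal_mult''[symmetric] mult.commute)
  also have "\<dots> = ennreal (2 * w * a powr d)"
    using w by (subst ennreal_plus[symmetric]) auto
  finally show ?thesis .
qed

lemma
  assumes a: "0 < a" and d: "- 1 < d" "d < 0"
  shows integrable_mvn_kernel: "integrable lborel (mvn_kernel a d t)"
    and integral_abs_mvn_kernel_le: "(\<integral>u. \<bar>mvn_kernel a d t u\<bar> \<partial>lborel) \<le> 2 * \<bar>t\<bar> * a powr d"
proof -
  have "(\<integral>\<^sup>+u. ennreal \<bar>mvn_kernel a d t u\<bar> \<partial>lborel) = (\<integral>\<^sup>+u. ennreal (mvn_kernel a d \<bar>t\<bar> u) \<partial>lborel)"
    unfolding abs_mvn_kernel_eq[OF a d(2)]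
    using nn_integral_real_affine[of "\<lambda>u. ennreal (mvn_kernel a d \<bar>t\<bar> u)" 1 "- min t 0"] by (simp add: add.commute)
  also have "\<dots> \<le> ennreal (2 * \<bar>t\<bar> * a powr d)"
    by (rule nn_integral_mvn_kernel_le[OF a d]) simp
  finally have le: "(\<integral>\<^sup>+u. ennreal \<bar>mvn_kernel a d t u\<bar> \<partial>lborel) \<le> ennreal (2 * \<bar>t\<bar> * a powr d)" .
  show "integrable lborel (mvn_kernel a d t)"
    by (rule integrableI_bounded) (use le in \<open>auto simp: less_top[symmetric] top_unique\<close>)
  show "(\<integral>u. \<bar>mvn_kernel a d t u\<bar> \<partial>lborel) \<le> 2 * \<bar>t\<bar> * a powr d"
    by (subst integral_eq_nn_integral) (use le in \<open>auto intro!: enn2real_leI\<close>)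
qed

lemma integral_mvn_kernel_lipschitz:
  assumes a: "0 < a" and d: "- 1 < d" "d < 0"
  shows "\<bar>(\<integral>u. mvn_kernel a d t u \<partial>lborel) - (\<integral>u. mvn_kernel a d s u \<partial>lborel)\<bar> \<le> 2 * \<bar>t - s\<bar> * a powr d"
proof -
  note int = integrable_mvn_kernel[OF a d]
  have "(\<integral>u. mvn_kernel a d t u \<partial>lborel) - (\<integral>u. mvn_kernel a d s u \<partial>lborel)
      = (\<integral>u. mvn_kernel a d (t - s) (u - s) \<partial>lborel)"
    using mvn_kernel_shift[of a d "t - s" s] int
    by (subst Bochner_Integration.integral_diff[symmetric]) simp_all
  also have "\<dots> = (\<integral>u. mvn_kernel a d (t - s) u \<partial>lborel)"
    using lborel_integral_real_affine[of 1 "mvn_kernel a d (t - s)" "- s"] by simp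
  also have "\<bar>\<dots>\<bar> \<le> (\<integral>u. \<bar>mvn_kernel a d (t - s) u\<bar> \<partial>lborel)"
    by (rule integral_abs_bound)
  also have "\<dots> \<le> 2 * \<bar>t - s\<bar> * a powr d" by (rule integral_abs_mvn_kernel_le[OF a d])
  finally show ?thesis .
qed

section \<open>Linear growth of a path and of its integral\<close>

text \<open>\<open>\<phi> u\<close> is the length of the set of levels in \<open>{0<..<\<phi> u}\<close>; exchanging the integrations gives the formula.\<close>

lemma layer_cake:
  fixes \<phi> :: "real \<Rightarrow> real"
  assumes N: "sigma_finite_measure N" and sets: "sets N = sets borel"
    and \<phi>[measurable]: "\<phi> \<in> borel_measurable borel" and b: "\<And>u. 0 \<le> \<phi> u" "\<And>u. \<phi> u \<le> B"
  shows "(\<integral>\<^sup>+u. ennreal (\<phi> u) \<partial>N) = (\<integral>\<^sup>+y. emeasure N {u. y < \<phi> u} * indicator {0<..<B} y \<partial>lborel)"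
    and "(\<lambda>y. emeasure N {u. y < \<phi> u}) \<in> borel_measurable borel"
proof -
  interpret N: sigma_finite_measure N by fact
  interpret P: pair_sigma_finite N lborel ..
  have space: "space N = UNIV" using sets_eq_imp_space_eq[OF sets] by simp
  note [measurable_cong] = sets
  let ?G = "\<lambda>u y. indicator {0<..<B} y * indicator {y. y < \<phi> u} y :: ennreal"
  have "(\<lambda>(u, y). indicator {(u, y). y < \<phi> u} (u, y) :: ennreal) \<in> borel_measurable (N \<Otimes>\<^sub>M lborel)"
    by measurable
  then have [measurable]: "(\<lambda>(u, y). indicator {y. y < \<phi> u} y :: ennreal) \<in> borel_measurable (N \<Otimes>\<^sub>M lborel)"
    by (rule measurable_cong[THEN iffD1, rotated]) (auto simp: indicator_def)
  have [measurable]: "(\<lambda>(u, y). ?G u y) \<in> borel_measurable (N \<Otimes>\<^sub>M lborel)"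
    by measurable
  have level: "{u. y < \<phi> u} \<in> sets N" for y
    unfolding sets by measurable
  have inner: "(\<integral>\<^sup>+u. indicator {y. y < \<phi> u} y \<partial>N) = emeasure N {u. y < \<phi> u}" for y
  proof -
    have "(\<integral>\<^sup>+u. indicator {y. y < \<phi> u} y \<partial>N) = (\<integral>\<^sup>+u. indicator {u. y < \<phi> u} u \<partial>N)"
      by (intro nn_integral_cong) (auto simp: indicator_def)
    then show ?thesis using level by simp
  qed
  have "(\<lambda>(y, u). indicator {u. y < \<phi> u} u :: ennreal) \<in> borel_measurable (lborel \<Otimes>\<^sub>M N)"
    using measurable_pair_swap[OF \<open>(\<lambda>(u, y). indicator {y. y < \<phi> u} y :: ennreal) \<in> borel_measurable (N \<Otimes>\<^sub>M lborel)\<close>]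
    by (rule measurable_cong[THEN iffD1, rotated]) (auto simp: indicator_def)
  then have "(\<lambda>y. \<integral>\<^sup>+u. indicator {y. y < \<phi> u} y \<partial>N) \<in> borel_measurable lborel"
    using N.borel_measurable_nn_integral[of "\<lambda>y u. indicator {u. y < \<phi> u} u" lborel]
    by (simp add: indicator_def)
  then show "(\<lambda>y. emeasure N {u. y < \<phi> u}) \<in> borel_measurable borel" unfolding inner by simp
  have "(\<integral>\<^sup>+u. ennreal (\<phi> u) \<partial>N) = (\<integral>\<^sup>+u. (\<integral>\<^sup>+y. ?G u y \<partial>lborel) \<partial>N)"
  proof (rule nn_integral_cong)
    fix u
    have "(\<integral>\<^sup>+y. ?G u y \<partial>lborel) = (\<integral>\<^sup>+y. indicator {0<..<\<phi> u} y \<partial>lborel)"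
      using b(2)[of u] by (intro nn_integral_cong) (auto simp: indicator_def)
    then show "ennreal (\<phi> u) = (\<integral>\<^sup>+y. ?G u y \<partial>lborel)" using b(1)[of u] by simp
  qed
  also have "\<dots> = (\<integral>\<^sup>+y. (\<integral>\<^sup>+u. ?G u y \<partial>N) \<partial>lborel)"
    by (rule P.Fubini'[symmetric]) measurable
  also have "\<dots> = (\<integral>\<^sup>+y. emeasure N {u. y < \<phi> u} * indicator {0<..<B} y \<partial>lborel)"
  proof (rule nn_integral_cong)
    fix y :: real
    have [measurable]: "(\<lambda>u. indicator {y. y < \<phi> u} y :: ennreal) \<in> borel_measurable N"
      using measurable_compose[OF measurable_Pair2'[of y lborel N]
          \<open>(\<lambda>(u, y). indicator {y. y < \<phi> u} y :: ennreal) \<in> borel_measurable (N \<Otimes>\<^sub>M lborel)\<close>] by simp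
    show "(\<integral>\<^sup>+u. ?G u y \<partial>N) = emeasure N {u. y < \<phi> u} * indicator {0<..<B} y"
      by (subst nn_integral_cmult) (auto simp: inner mult.commute)
  qed
  finally show "(\<integral>\<^sup>+u. ennreal (\<phi> u) \<partial>N) = (\<integral>\<^sup>+y. emeasure N {u. y < \<phi> u} * indicator {0<..<B} y \<partial>lborel)" .
qed

text \<open>An additive error for each level set costs that error times the range of levels. The factors \<open>p\<close> and \<open>q\<close> allow
both bounds of the deviation estimate to be instances of one comparison.\<close>

lemma nn_integral_le_by_level_sets:
  fixes \<phi> :: "real \<Rightarrow> real"
  assumes M1: "sigma_finite_measure M1" "sets M1 = sets borel" and M2: "sigma_finite_measure M2" "sets M2 = sets borel"
    and \<phi>: "\<phi> \<in> borel_measurable borel" "\<And>u. 0 \<le> \<phi> u" "\<And>u. \<phi> u \<le> B" and B: "0 \<le> B"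
    and le: "\<And>y. 0 < y \<Longrightarrow> p * emeasure M1 {u. y < \<phi> u} \<le> q * emeasure M2 {u. y < \<phi> u} + K"
  shows "p * (\<integral>\<^sup>+u. ennreal (\<phi> u) \<partial>M1) \<le> q * (\<integral>\<^sup>+u. ennreal (\<phi> u) \<partial>M2) + K * ennreal B"
proof -
  note cake1 = layer_cake[OF M1 \<phi>] and cake2 = layer_cake[OF M2 \<phi>]
  note [measurable] = cake1(2) cake2(2)
  have "p * (\<integral>\<^sup>+u. ennreal (\<phi> u) \<partial>M1) = (\<integral>\<^sup>+y. p * (emeasure M1 {u. y < \<phi> u} * indicator {0<..<B} y) \<partial>lborel)"
    unfolding cake1(1) by (rule nn_integral_cmult[symmetric]) measurable
  also have "\<dots> \<le> (\<integral>\<^sup>+y. q * (emeasure M2 {u. y < \<phi> u} * indicator {0<..<B} y) + K * indicator {0<..<B} y \<partial>lborel)"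
    using le by (intro nn_integral_mono) (auto simp: indicator_def)
  also have "\<dots> = q * (\<integral>\<^sup>+u. ennreal (\<phi> u) \<partial>M2) + K * ennreal B"
    unfolding cake2(1) using B by (simp add: nn_integral_add nn_integral_cmult nn_integral_cmult_indicator)
  finally show ?thesis .
qed

text \<open>A path that stays within \<open>\<epsilon> \<bar>u\<bar> + C\<close> of the line of slope \<open>m\<close> gives an interval \<open>m\<close> times its length, up
to an error governed by \<open>\<epsilon>\<close> and the end points. Summed over the level sets of the kernel, this error has slope
proportional to \<open>\<epsilon>\<close> in \<open>t\<close>; as \<open>\<epsilon>\<close> is arbitrary, the law of large numbers for the integral follows.\<close>

lemma mvn_integral_deviation:
  fixes F :: "real \<Rightarrow> real"
  assumes mono: "mono F" and rc: "\<And>t. continuous (at_right t) F"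
    and a: "0 < a" and d: "- 1 < d" "d < 0" and m: "0 \<le> m" and \<epsilon>: "0 \<le> \<epsilon>" and C: "0 \<le> C"
    and lin: "\<And>u. \<bar>F u - m * u\<bar> \<le> \<epsilon> * \<bar>u\<bar> + C"
  shows "\<bar>(\<integral>u. mvn_kernel a d t u \<partial>interval_measure F) - m * (\<integral>u. mvn_kernel a d t u \<partial>lborel)\<bar>
    \<le> 4 * \<epsilon> * a powr d * \<bar>t\<bar> + (m + \<epsilon> + 2 * C) * a powr d"
proof -
  let ?\<mu> = "interval_measure F" and ?A = "a powr d"
  let ?\<phi> = "\<lambda>u. \<bar>mvn_kernel a d t u\<bar>"
  define K where "K = m + \<epsilon> + 2 * \<epsilon> * \<bar>t\<bar> + 2 * C"
  have K: "0 \<le> K" "m \<le> K" using m \<epsilon> C by (auto simp: K_def)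
  have Ioc: "emeasure ?\<mu> {x<..y} = ennreal (F y - F x)" if "x \<le> y" for x y
    using emeasure_interval_measure_Ioc[OF that, of F] mono rc by (auto simp: mono_def)
  have \<mu>: "sigma_finite_measure ?\<mu>" using mono rc by (intro sigma_finite_interval_measure) (auto simp: mono_def)
  have \<phi>: "?\<phi> \<in> borel_measurable borel" "\<And>u. 0 \<le> ?\<phi> u" "\<And>u. ?\<phi> u \<le> ?A"
    using abs_mvn_kernel_le[OF a d(2)] by auto
  have "sigma_finite_measure lborel" "sets lborel = sets borel" by (auto intro: lborel.sigma_finite_measure_axioms)
  note leb = this
  \<comment> \<open>A level set fills an interval between two points whose absolute values add up to at most the length plus twice the time.\<close>
  have level: "emeasure ?\<mu> {u. y < ?\<phi> u} \<le> ennreal (m + \<epsilon>) * emeasure lborel {u. y < ?\<phi> u} + ennreal K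
      \<and> ennreal (m - \<epsilon>) * emeasure lborel {u. y < ?\<phi> u} \<le> emeasure ?\<mu> {u. y < ?\<phi> u} + ennreal K"
    if y: "0 < y" for y
  proof (cases "{u. y < ?\<phi> u} = {}")
    case True
    then show ?thesis by (simp only: emeasure_empty) simp
  next
    case False
    obtain \<alpha> \<beta> where \<alpha>\<beta>: "\<alpha> \<le> min t 0" "min t 0 \<le> \<beta>" and sub: "{\<alpha><..<\<beta>} \<subseteq> {u. y < ?\<phi> u}" "{u. y < ?\<phi> u} \<subseteq> {\<alpha>..\<beta>}"
      using mvn_level_set[OF a d(2) y False] by blast
    have Js: "{u. y < ?\<phi> u} \<in> sets borel" by measurable
    have le: "\<alpha> \<le> \<beta>" using \<alpha>\<beta> by linarith
    have len: "\<bar>\<alpha>\<bar> + \<bar>\<beta>\<bar> \<le> (\<beta> - \<alpha>) + 2 * \<bar>t\<bar>" using \<alpha>\<beta> by linarith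
    have leb_J: "emeasure lborel {u. y < ?\<phi> u} = ennreal (\<beta> - \<alpha>)"
    proof (rule antisym)
      show "emeasure lborel {u. y < ?\<phi> u} \<le> ennreal (\<beta> - \<alpha>)"
        using emeasure_mono[OF sub(2), of lborel] le by simp
      show "ennreal (\<beta> - \<alpha>) \<le> emeasure lborel {u. y < ?\<phi> u}"
        using emeasure_mono[OF sub(1), of lborel] Js le by simp
    qed
    have \<epsilon>len: "\<epsilon> * (\<bar>\<alpha>\<bar> + \<bar>\<beta>\<bar>) \<le> \<epsilon> * ((\<beta> - \<alpha>) + 2 * \<bar>t\<bar>)" using len \<epsilon> by (rule mult_left_mono)
    \<comment> \<open>The end points may or may not belong to the level set, and they may be atoms; a margin of one unit settles this, here and in the lower bound.\<close>
    have "emeasure ?\<mu> {u. y < ?\<phi> u} \<le> emeasure ?\<mu> {\<alpha> - 1<..\<beta>}"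
      by (rule emeasure_mono) (use sub(2) in auto)
    also have "\<dots> = ennreal (F \<beta> - F (\<alpha> - 1))" using le by (intro Ioc) simp
    also have "\<dots> \<le> ennreal ((m + \<epsilon>) * (\<beta> - \<alpha>) + K)"
    proof (rule ennreal_leI)
      have "\<epsilon> * \<bar>\<alpha> - 1\<bar> \<le> \<epsilon> * (\<bar>\<alpha>\<bar> + 1)" by (rule mult_left_mono[OF _ \<epsilon>]) linarith
      then show "F \<beta> - F (\<alpha> - 1) \<le> (m + \<epsilon>) * (\<beta> - \<alpha>) + K"
        using lin[of \<beta>] lin[of "\<alpha> - 1"] \<epsilon>len unfolding K_def by (simp add: algebra_simps abs_le_iff)
    qed
    also have "\<dots> = ennreal (m + \<epsilon>) * emeasure lborel {u. y < ?\<phi> u} + ennreal K"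
      unfolding leb_J using m \<epsilon> le K by (simp add: ennreal_mult)
    finally have up: "emeasure ?\<mu> {u. y < ?\<phi> u} \<le> ennreal (m + \<epsilon>) * emeasure lborel {u. y < ?\<phi> u} + ennreal K" .
    have "ennreal (m - \<epsilon>) * ennreal (\<beta> - \<alpha>) \<le> emeasure ?\<mu> {u. y < ?\<phi> u} + ennreal K"
    proof (cases "\<alpha> \<le> \<beta> - 1")
      case True
      have "ennreal (m - \<epsilon>) * ennreal (\<beta> - \<alpha>) = ennreal ((m - \<epsilon>) * (\<beta> - \<alpha>))"
        using le by (simp add: ennreal_mult'')
      also have "\<dots> \<le> ennreal ((F (\<beta> - 1) - F \<alpha>) + K)"
      proof (rule ennreal_leI)
        have "\<epsilon> * \<bar>\<beta> - 1\<bar> \<le> \<epsilon> * (\<bar>\<beta>\<bar> + 1)" by (rule mult_left_mono[OF _ \<epsilon>]) linarith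
        then show "(m - \<epsilon>) * (\<beta> - \<alpha>) \<le> (F (\<beta> - 1) - F \<alpha>) + K"
          using lin[of \<alpha>] lin[of "\<beta> - 1"] \<epsilon>len unfolding K_def by (simp add: algebra_simps abs_le_iff)
      qed
      also have "\<dots> = ennreal (F (\<beta> - 1) - F \<alpha>) + ennreal K"
        using monoD[OF mono True] K by (intro ennreal_plus) auto
      also have "ennreal (F (\<beta> - 1) - F \<alpha>) = emeasure ?\<mu> {\<alpha><..\<beta> - 1}" using Ioc[OF True] by simp
      also have "\<dots> + ennreal K \<le> emeasure ?\<mu> {u. y < ?\<phi> u} + ennreal K"
        by (intro add_right_mono emeasure_mono order_trans[OF _ sub(1)]) (use Js in auto)
      finally show ?thesis .
    next
      case False
      have "(m - \<epsilon>) * (\<beta> - \<alpha>) \<le> m * (\<beta> - \<alpha>)" using \<epsilon> le by (intro mult_right_mono) auto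
      also have "\<dots> \<le> m * 1" using False m by (intro mult_left_mono) auto
      finally have "(m - \<epsilon>) * (\<beta> - \<alpha>) \<le> K" using K by simp
      then have "ennreal (m - \<epsilon>) * ennreal (\<beta> - \<alpha>) \<le> ennreal K"
        using le by (simp add: ennreal_mult''[symmetric] ennreal_leI)
      then show ?thesis by (simp add: add_increasing)
    qed
    then show ?thesis using up unfolding leb_J by simp
  qed
  have A: "0 \<le> ?A" by simp
  let ?X = "\<integral>\<^sup>+u. ennreal (?\<phi> u) \<partial>?\<mu>"
  define l where "l = (\<integral>u. ?\<phi> u \<partial>lborel)"
  have intl: "integrable lborel (mvn_kernel a d t)" by (rule integrable_mvn_kernel[OF a d])
  have l: "0 \<le> l" "l \<le> 2 * \<bar>t\<bar> * ?A" "(\<integral>\<^sup>+u. ennreal (?\<phi> u) \<partial>lborel) = ennreal l"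
    unfolding l_def using integral_abs_mvn_kernel_le[OF a d, of t] intl
    by (auto intro!: Bochner_Integration.integral_nonneg nn_integral_eq_integral)
  have up: "?X \<le> ennreal (m + \<epsilon>) * ennreal l + ennreal K * ennreal ?A"
    using nn_integral_le_by_level_sets[OF \<mu> sets_interval_measure leb \<phi> A, of 1 "ennreal (m + \<epsilon>)" "ennreal K"] level l(3) by simp
  have low: "ennreal (m - \<epsilon>) * ennreal l \<le> ?X + ennreal K * ennreal ?A"
    using nn_integral_le_by_level_sets[OF leb \<mu> sets_interval_measure \<phi> A, of "ennreal (m - \<epsilon>)" 1 "ennreal K"] level l(3) by simp
  have "?X < \<infinity>"
    using up by (rule order_le_less_trans) (simp add: ennreal_mult_less_top)
  then have int\<mu>: "integrable ?\<mu> (mvn_kernel a d t)"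
    by (intro integrableI_bounded) auto
  define x where "x = (\<integral>u. ?\<phi> u \<partial>?\<mu>)"
  have x: "0 \<le> x" "?X = ennreal x"
    unfolding x_def using int\<mu> by (auto intro!: Bochner_Integration.integral_nonneg nn_integral_eq_integral)
  have "x \<le> (m + \<epsilon>) * l + K * ?A"
  proof -
    have "ennreal x \<le> ennreal ((m + \<epsilon>) * l + K * ?A)"
      using up m \<epsilon> l K unfolding x(2) by (simp add: ennreal_mult)
    then show ?thesis using m \<epsilon> l K by (subst (asm) ennreal_le_iff) auto
  qed
  moreover have "(m - \<epsilon>) * l \<le> x + K * ?A"
  proof -
    have "ennreal ((m - \<epsilon>) * l) \<le> ennreal (x + K * ?A)"
      using low x K l unfolding x(2) by (simp add: ennreal_mult ennreal_mult'')
    then show ?thesis using x K by (subst (asm) ennreal_le_iff) auto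
  qed
  ultimately have "\<bar>x - m * l\<bar> \<le> \<epsilon> * l + K * ?A" by (simp add: algebra_simps abs_le_iff)
  also have "\<dots> \<le> \<epsilon> * (2 * \<bar>t\<bar> * ?A) + K * ?A" using l(2) \<epsilon> by (intro add_right_mono mult_left_mono) auto
  also have "\<dots> = 4 * \<epsilon> * ?A * \<bar>t\<bar> + (m + \<epsilon> + 2 * C) * ?A" by (simp add: K_def algebra_simps)
  finally have dev: "\<bar>x - m * l\<bar> \<le> 4 * \<epsilon> * ?A * \<bar>t\<bar> + (m + \<epsilon> + 2 * C) * ?A" .
  show ?thesis
  proof (cases "0 \<le> t")
    case True
    then show ?thesis using dev mvn_kernel_nonneg[OF a d(2) True] unfolding x_def l_def by simp
  next
    case False
    then have "?\<phi> u = - mvn_kernel a d t u" for u using mvn_kernel_nonpos[OF a d(2), of t u] by simp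
    then have "x = - (\<integral>u. mvn_kernel a d t u \<partial>?\<mu>)" "l = - (\<integral>u. mvn_kernel a d t u \<partial>lborel)"
      unfolding x_def l_def by simp_all
    then have "x - m * l = - ((\<integral>u. mvn_kernel a d t u \<partial>?\<mu>) - m * (\<integral>u. mvn_kernel a d t u \<partial>lborel))" by simp
    then show ?thesis using dev by (simp only: abs_minus_cancel)
  qed
qed

lemma sublinear_bound:
  fixes x :: "nat \<Rightarrow> real"
  assumes lim: "(\<lambda>n. x n / real n) \<longlonglongrightarrow> m" and e: "0 < e"
  shows "\<exists>C\<ge>0. \<forall>n. \<bar>x n - m * real n\<bar> \<le> e * real n + C"
proof -
  obtain N where N: "\<And>n. n \<ge> N \<Longrightarrow> \<bar>x n / real n - m\<bar> < e"
    using LIMSEQ_D[OF lim e] by auto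
  define C where "C = (\<Sum>n\<le>N. \<bar>x n - m * real n\<bar>)"
  have C: "0 \<le> C" unfolding C_def by (rule sum_nonneg) simp
  have "\<bar>x n - m * real n\<bar> \<le> e * real n + C" for n
  proof (cases "n \<le> N")
    case True
    then have "\<bar>x n - m * real n\<bar> \<le> C" unfolding C_def by (intro member_le_sum) auto
    then show ?thesis using e by (simp add: add_increasing)
  next
    case False
    then have n: "0 < real n" by simp
    have "\<bar>x n - m * real n\<bar> = \<bar>x n / real n - m\<bar> * real n"
    proof -
      have "x n - m * real n = (x n / real n - m) * real n" using n by (simp add: field_simps)
      then show ?thesis using n by (simp only: abs_mult abs_of_pos)
    qed
    also have "\<dots> \<le> e * real n" using N[of n] False n by (intro mult_right_mono) auto
    finally show ?thesis using C by simp
  qed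
  then show ?thesis using C by blast
qed

text \<open>A monotone function is trapped between its values at neighbouring integers, so its growth along the integers
determines its growth along the reals.\<close>

lemma mono_sublinear_bound:
  fixes F :: "real \<Rightarrow> real"
  assumes mono: "mono F"
    and up: "(\<lambda>n. F (real n) / real n) \<longlonglongrightarrow> m" and down: "(\<lambda>n. F (- real n) / real n) \<longlonglongrightarrow> - m"
    and e: "0 < e"
  shows "\<exists>C\<ge>0. \<forall>u. \<bar>F u - m * u\<bar> \<le> e * \<bar>u\<bar> + C"
proof -
  obtain C1 where C1: "0 \<le> C1" "\<And>n. \<bar>F (real n) - m * real n\<bar> \<le> e * real n + C1"
    using sublinear_bound[OF up e] by blast
  obtain C2 where C2: "0 \<le> C2" "\<And>n. \<bar>F (- real n) - (- m) * real n\<bar> \<le> e * real n + C2"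
    using sublinear_bound[OF down e] by blast
  have int: "\<bar>F (of_int k) - m * of_int k\<bar> \<le> e * \<bar>of_int k\<bar> + (C1 + C2)" for k
  proof (cases "0 \<le> k")
    case True
    then obtain n where "k = int n" using nonneg_int_cases by blast
    then show ?thesis using C1(2)[of n] C2(1) by simp
  next
    case False
    then obtain n where "k = - int n" using nonneg_int_cases[of "- k"] by (metis minus_minus neg_0_le_iff_le linear)
    then show ?thesis using C2(2)[of n] C1(1) by simp
  qed
  define C where "C = e + \<bar>m\<bar> + (C1 + C2)"
  have "\<bar>F u - m * u\<bar> \<le> e * \<bar>u\<bar> + C" for u
  proof -
    define k where "k = \<lfloor>u\<rfloor>"
    have k: "of_int k \<le> u" "u \<le> of_int k + 1" unfolding k_def by linarith+
    have F: "F (of_int k) \<le> F u" "F u \<le> F (of_int (k + 1))"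
      using k by (auto intro!: monoD[OF mono])
    have "e * \<bar>of_int k\<bar> \<le> e * (\<bar>u\<bar> + 1)" "e * \<bar>of_int (k + 1)\<bar> \<le> e * (\<bar>u\<bar> + 1)"
      using k e by (auto intro!: mult_left_mono)
    then have b: "\<bar>F (of_int k) - m * of_int k\<bar> \<le> e * \<bar>u\<bar> + e + (C1 + C2)"
      "\<bar>F (of_int (k + 1)) - m * of_int (k + 1)\<bar> \<le> e * \<bar>u\<bar> + e + (C1 + C2)"
      using int[of k] int[of "k + 1"] by (simp_all only: distrib_left mult_1_right)
    have "\<bar>m * (u - of_int k)\<bar> \<le> \<bar>m\<bar> * 1" "\<bar>m * (of_int (k + 1) - u)\<bar> \<le> \<bar>m\<bar> * 1"
    proof -
      have "\<bar>u - of_int k\<bar> \<le> 1" "\<bar>of_int (k + 1) - u\<bar> \<le> 1" using k by auto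
      from mult_left_mono[OF this(1) abs_ge_zero[of m]] mult_left_mono[OF this(2) abs_ge_zero[of m]]
      show "\<bar>m * (u - of_int k)\<bar> \<le> \<bar>m\<bar> * 1" "\<bar>m * (of_int (k + 1) - u)\<bar> \<le> \<bar>m\<bar> * 1"
        by (simp_all only: abs_mult)
    qed
    moreover have "m * (u - of_int k) = m * u - m * of_int k" "m * (of_int (k + 1) - u) = m * of_int (k + 1) - m * u"
      by (simp_all add: right_diff_distrib)
    ultimately show ?thesis using F b unfolding C_def by linarith
  qed
  moreover have "0 \<le> C" using e C1 C2 by (simp add: C_def)
  ultimately show ?thesis by blast
qed

context two_sided_process
begin

text \<open>The two half-lines carry independent copies of one process, so the strong law holds with the same mean on
both. At negative integers the left limits are almost surely values, and the sign is that of the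
time.\<close>

lemma AE_linear_growth:
  assumes int: "integrable M (S 1)"
  shows "AE \<omega> in M. \<forall>e>0. \<exists>C\<ge>0. \<forall>u. \<bar>S u \<omega> - expectation (S 1) * u\<bar> \<le> e * \<bar>u\<bar> + C"
proof -
  have S2_1: "S 1 = S2 1" by (simp add: S_def two_sided_def[abs_def])
  have law: "distr M borel (S1 1) = distr M borel (S 1)" using distr_S1_eq_S2[of 1] by (simp add: S2_1)
  have m1: "S1 1 \<in> borel_measurable M" by (rule measurable_S1) simp
  have "integrable (distr M borel (S1 1)) (\<lambda>x. x)"
    unfolding law using int by (simp add: integrable_distr_eq)
  then have int1: "integrable M (S1 1)" using m1 by (simp add: integrable_distr_eq)
  have "expectation (S1 1) = (\<integral>x. x \<partial>distr M borel (S1 1))" using m1 by (simp add: integral_distr)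
  also have "\<dots> = expectation (S 1)" unfolding law by (simp add: integral_distr)
  finally have mean: "expectation (S1 1) = expectation (S 1)" .
  have "AE \<omega> in M. (\<lambda>n. S2 (real n) \<omega> / real n) \<longlonglongrightarrow> expectation (S 1)"
    using levy_process_strong_law[OF levy2] int by (simp add: S2_1)
  moreover have "AE \<omega> in M. (\<lambda>n. S1 (real n) \<omega> / real n) \<longlonglongrightarrow> expectation (S 1)"
    using levy_process_strong_law[OF levy1 int1] by (simp add: mean)
  moreover have "AE \<omega> in M. \<forall>n::nat. S (- real n) \<omega> = - S1 (- (- real n)) \<omega>"
    unfolding AE_all_countable by (intro allI AE_S_nonpos) simp
  ultimately show ?thesis using AE_regular
  proof eventually_elim
    case (elim \<omega>)
    have "(\<lambda>n. S (real n) \<omega> / real n) \<longlonglongrightarrow> expectation (S 1)"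
      using elim(1) by (simp add: S_def two_sided_def)
    moreover have "(\<lambda>n. S (- real n) \<omega> / real n) \<longlonglongrightarrow> - expectation (S 1)"
      using tendsto_minus[OF elim(2)] elim(3) by simp
    ultimately show ?case
      using elim(4) mono_sublinear_bound[of "\<lambda>t. S t \<omega>"] by blast
  qed
qed

lemma expectation_S_nonneg: "0 \<le> expectation (S 1)"
proof (rule integral_nonneg_AE)
  show "AE \<omega> in M. 0 \<le> S 1 \<omega>"
    using AE_regular
  proof eventually_elim
    case (elim \<omega>)
    then show ?case using monoD[of "\<lambda>t. S t \<omega>" 0 1] by simp
  qed
qed

end

section \<open>The three sample path properties\<close>

lemma open_real_abs:
  fixes U :: "real set"
  assumes "open U" "t \<in> U"
  shows "\<exists>\<delta>>0. \<forall>x. \<bar>x - t\<bar> < \<delta> \<longrightarrow> x \<in> U"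
  using bspec[OF assms(1)[unfolded open_dist] assms(2)] by (simp only: dist_real_def)

lemma continuous_le_from_rationals:
  fixes g :: "real \<Rightarrow> real"
  assumes g: "continuous_on UNIV g" and le: "\<And>q. g (of_rat q) \<le> C"
  shows "g t \<le> C"
proof (rule ccontr)
  assume "\<not> g t \<le> C"
  then have "t \<in> {x. C < g x}" by simp
  moreover have "open {x. C < g x}" using g by (intro open_Collect_less continuous_on_const)
  ultimately have "\<exists>\<delta>>0. \<forall>x. \<bar>x - t\<bar> < \<delta> \<longrightarrow> x \<in> {x. C < g x}" by (intro open_real_abs)
  then obtain \<delta> where \<delta>: "0 < \<delta>" "\<And>x. \<bar>x - t\<bar> < \<delta> \<Longrightarrow> x \<in> {x. C < g x}"
    by blast
  have "t < t + \<delta>" using \<delta>(1) by simp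
  then obtain q :: rat where "t < of_rat q" "of_rat q < t + \<delta>" using of_rat_dense by blast
  then show False using \<delta>(2)[of "of_rat q"] le[of q] by simp
qed

lemma strict_mono_on_from_rationals:
  fixes y :: "real \<Rightarrow> real"
  assumes y: "continuous_on UNIV y"
    and less: "\<And>p q. 0 \<le> p \<Longrightarrow> p < q \<Longrightarrow> y (of_rat p) < y (of_rat q)"
  shows "strict_mono_on {0..} y"
proof (rule strict_mono_onI)
  fix s t :: real assume st: "s \<in> {0..}" "t \<in> {0..}" "s < t"
  obtain p :: rat where p: "s < of_rat p" "of_rat p < t" using of_rat_dense[OF st(3)] by blast
  obtain q :: rat where q: "(of_rat p :: real) < of_rat q" "of_rat q < t" using of_rat_dense[OF p(2)] by blast
  have nonneg: "0 \<le> r" if "s < of_rat r" for r :: rat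
  proof -
    have "(of_rat 0 :: real) \<le> of_rat r" using that st(1) by (simp only: atLeast_iff of_rat_0)
    then show ?thesis by (simp only: of_rat_less_eq)
  qed
  have "y s \<le> y (of_rat p)"
  proof (rule ccontr)
    assume "\<not> ?thesis"
    then have "s \<in> {x. y (of_rat p) < y x}" by simp
    moreover have "open {x. y (of_rat p) < y x}" using y by (intro open_Collect_less continuous_on_const)
    ultimately have "\<exists>\<delta>>0. \<forall>x. \<bar>x - s\<bar> < \<delta> \<longrightarrow> x \<in> {x. y (of_rat p) < y x}" by (intro open_real_abs)
    then obtain \<delta> where \<delta>: "0 < \<delta>" "\<And>x. \<bar>x - s\<bar> < \<delta> \<Longrightarrow> x \<in> {x. y (of_rat p) < y x}"
      by blast
    have "s < min (s + \<delta>) (of_rat p)" using \<delta>(1) p(1) by simp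
    then obtain r :: rat where r: "s < of_rat r" "of_rat r < min (s + \<delta>) (of_rat p)" using of_rat_dense by blast
    have "y (of_rat r) < y (of_rat p)" using r nonneg[OF r(1)] by (intro less) (auto simp: of_rat_less)
    then show False using \<delta>(2)[of "of_rat r"] r by simp
  qed
  also have "y (of_rat p) < y (of_rat q)" using q nonneg[OF p(1)] by (intro less) (auto simp: of_rat_less)
  also have "y (of_rat q) \<le> y t"
  proof (rule ccontr)
    assume "\<not> ?thesis"
    then have "t \<in> {x. y x < y (of_rat q)}" by simp
    moreover have "open {x. y x < y (of_rat q)}" using y by (intro open_Collect_less continuous_on_const)
    ultimately have "\<exists>\<delta>>0. \<forall>x. \<bar>x - t\<bar> < \<delta> \<longrightarrow> x \<in> {x. y x < y (of_rat q)}" by (intro open_real_abs)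
    then obtain \<delta> where \<delta>: "0 < \<delta>" "\<And>x. \<bar>x - t\<bar> < \<delta> \<Longrightarrow> x \<in> {x. y x < y (of_rat q)}"
      by blast
    have "max (t - \<delta>) (of_rat q) < t" using \<delta>(1) q(2) by simp
    then obtain r :: rat where r: "max (t - \<delta>) (of_rat q) < of_rat r" "of_rat r < t" using of_rat_dense by blast
    have "s < of_rat q" using p q by simp
    then have "y (of_rat q) < y (of_rat r)" using r nonneg by (intro less) (auto simp: of_rat_less)
    then show False using \<delta>(2)[of "of_rat r"] r by simp
  qed
  finally show "y s < y t" .
qed

locale fractional_subordinator = two_sided_process M S1 S2 S for M :: "'a measure" and S1 S2 S +
  fixes X :: "real \<Rightarrow> 'a \<Rightarrow> real" and a d :: real
  assumes d: "- 1 < d" "d < 0" and a: "0 < a"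
    and X: "\<And>t. has_subordinator_integral M S (mvn_kernel a d t) (X t)"
begin

text \<open>For each time the kernel has constant sign, as the identification of the integral requires.\<close>

lemma AE_X_eq: "AE \<omega> in M. integrable (path_measure S \<omega>) (mvn_kernel a d t) \<and> X t \<omega> = (\<integral>u. mvn_kernel a d t u \<partial>path_measure S \<omega>)"
proof (rule subordinator_integral_eq_path_integral[where c = "if 0 \<le> t then 1 else - 1"])
  show "0 \<le> (if 0 \<le> t then 1 else - 1) * mvn_kernel a d t u" for u
    using mvn_kernel_nonneg[OF a d(2), of t u] mvn_kernel_nonpos[OF a d(2), of t u] by auto
qed (use X in auto)

lemma measurable_X: "X t \<in> borel_measurable M"
  using X[of t] by (auto simp: has_subordinator_integral_def converges_in_probability_def)

text \<open>The functional \<open>\<Phi> t\<close> below integrates the kernel at \<open>t\<close> against the measure of a path on the rationals; it is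
written with the absolute value of the kernel because nonnegative integrals are measurable in the path.\<close>

theorem stationary_increments_X: "stationary_increments M X"
  unfolding stationary_increments_def same_fdd_def
proof (intro conjI allI impI)
  show "X t \<in> borel_measurable M" for t by (rule measurable_X)
  fix h :: real and J :: "real set" assume "finite J \<and> J \<subseteq> UNIV"
  let ?Q = "\<Pi>\<^sub>M t\<in>J. (borel :: real measure)"
  define \<Phi> where "\<Phi> t x = (if 0 \<le> t then 1 else - 1) * enn2real (\<integral>\<^sup>+u. ennreal \<bar>mvn_kernel a d t u\<bar> \<partial>path_stieltjes x)" for t x
  have "(\<lambda>x. \<integral>\<^sup>+u. ennreal \<bar>mvn_kernel a d t u\<bar> \<partial>path_stieltjes x) \<in> borel_measurable path_space" for t
    by (rule measurable_nn_integral_path_stieltjes) measurable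
  then have [measurable]: "\<Phi> t \<in> borel_measurable path_space" for t unfolding \<Phi>_def by measurable
  have \<Psi>: "(\<lambda>x. \<lambda>t\<in>J. \<Phi> t x) \<in> path_space \<rightarrow>\<^sub>M ?Q" by (intro measurable_restrict) measurable
  have eq: "AE \<omega> in M. X (t + h) \<omega> - X h \<omega> = \<Phi> t (increments_path S h \<omega>)" for t h
    using AE_X_eq[of "t + h"] AE_X_eq[of h] AE_regular
  proof eventually_elim
    case (elim \<omega>)
    then have r: "mono (\<lambda>t. S t \<omega>)" "\<And>t. continuous (at_right t) (\<lambda>t. S t \<omega>)" by auto
    let ?\<mu> = "path_measure S \<omega>" and ?s = "if 0 \<le> t then 1 else - 1 :: real"
    have s: "sets ?\<mu> = sets borel" by (rule regular_path_measure(1)[of S \<omega>, OF r(1)])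
    have m: "(\<lambda>u. mvn_kernel a d t (u - h)) \<in> borel_measurable ?\<mu>"
      by (subst measurable_cong_sets[OF s refl]) measurable
    have "X (t + h) \<omega> - X h \<omega> = (\<integral>u. mvn_kernel a d (t + h) u - mvn_kernel a d h u \<partial>?\<mu>)"
      using elim by simp
    also have "\<dots> = (\<integral>u. ?s * \<bar>mvn_kernel a d t (u - h)\<bar> \<partial>?\<mu>)"
      unfolding mvn_kernel_shift
      using mvn_kernel_nonneg[OF a d(2), of t] mvn_kernel_nonpos[OF a d(2), of t]
      by (intro Bochner_Integration.integral_cong) auto
    also have "\<dots> = ?s * enn2real (\<integral>\<^sup>+u. ennreal \<bar>mvn_kernel a d t (u - h)\<bar> \<partial>?\<mu>)"
      using m by (subst integral_mult_right_zero, subst integral_eq_nn_integral) auto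
    also have "\<dots> = \<Phi> t (increments_path S h \<omega>)"
      using nn_integral_path_stieltjes_increments_path[of S \<omega> "\<lambda>u. ennreal \<bar>mvn_kernel a d t u\<bar>" h, OF r]
      by (simp add: \<Phi>_def)
    finally show ?case .
  qed
  have law: "distr M ?Q (\<lambda>\<omega>. \<lambda>t\<in>J. X (t + h) \<omega> - X h \<omega>)
      = distr (distr M path_space (increments_path S h)) ?Q (\<lambda>x. \<lambda>t\<in>J. \<Phi> t x)" for h
  proof -
    have "distr M ?Q (\<lambda>\<omega>. \<lambda>t\<in>J. X (t + h) \<omega> - X h \<omega>)
        = distr M ?Q (\<lambda>\<omega>. \<lambda>t\<in>J. \<Phi> t (increments_path S h \<omega>))"
    proof (rule distr_cong_AE)
      have "AE \<omega> in M. \<forall>t\<in>J. X (t + h) \<omega> - X h \<omega> = \<Phi> t (increments_path S h \<omega>)"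
        using \<open>finite J \<and> J \<subseteq> UNIV\<close> by (intro AE_finite_allI eq) simp
      then show "AE \<omega> in M. (\<lambda>t\<in>J. X (t + h) \<omega> - X h \<omega>) = (\<lambda>t\<in>J. \<Phi> t (increments_path S h \<omega>))"
        by eventually_elim (intro restrict_ext, simp)
      show "(\<lambda>\<omega>. \<lambda>t\<in>J. X (t + h) \<omega> - X h \<omega>) \<in> M \<rightarrow>\<^sub>M ?Q"
        by (intro measurable_restrict borel_measurable_diff measurable_X)
      show "(\<lambda>\<omega>. \<lambda>t\<in>J. \<Phi> t (increments_path S h \<omega>)) \<in> M \<rightarrow>\<^sub>M ?Q"
        using measurable_compose[OF measurable_increments_path \<Psi>] .
    qed simp_all
    also have "\<dots> = distr (distr M path_space (increments_path S h)) ?Q (\<lambda>x. \<lambda>t\<in>J. \<Phi> t x)"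
      by (subst distr_distr[OF \<Psi> measurable_increments_path]) (simp add: comp_def)
    finally show ?thesis .
  qed
  show "distr M ?Q (\<lambda>\<omega>. \<lambda>t\<in>J. X (t + h) \<omega> - X h \<omega>) = distr M ?Q (\<lambda>\<omega>. \<lambda>t\<in>J. X t \<omega> - X 0 \<omega>)"
    using law[of h] law[of 0] increments_path_law[of h] by simp
qed

lemma AE_modification_eq:
  assumes "continuous_modification M X Y"
  shows "AE \<omega> in M. \<forall>q::rat. integrable (path_measure S \<omega>) (mvn_kernel a d (of_rat q))
    \<and> Y (of_rat q) \<omega> = (\<integral>u. mvn_kernel a d (of_rat q) u \<partial>path_measure S \<omega>)"
  unfolding AE_all_countable
proof
  fix q :: rat
  have "AE \<omega> in M. Y (of_rat q) \<omega> = X (of_rat q) \<omega>" using assms by (simp add: continuous_modification_def)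
  then show "AE \<omega> in M. integrable (path_measure S \<omega>) (mvn_kernel a d (of_rat q))
      \<and> Y (of_rat q) \<omega> = (\<integral>u. mvn_kernel a d (of_rat q) u \<partial>path_measure S \<omega>)"
    using AE_X_eq[of "of_rat q"] by eventually_elim simp
qed

text \<open>The increment of the integral between two rational times is the integral of a translated kernel, which is
positive on an interval \<open>{0<..q / 2}\<close> that a strictly increasing path charges.\<close>

theorem strictly_increasing_paths:
  assumes strict: "AE \<omega> in M. strict_mono_on {0..} (\<lambda>t. S t \<omega>)" and Y: "continuous_modification M X Y"
  shows "AE \<omega> in M. strict_mono_on {0..} (\<lambda>t. Y t \<omega>)"
proof -
  have "AE \<omega> in M. continuous_on UNIV (\<lambda>t. Y t \<omega>)" using Y by (simp add: continuous_modification_def)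
  then show ?thesis using strict AE_regular AE_modification_eq[OF Y]
  proof eventually_elim
    case (elim \<omega>)
    then have r: "mono (\<lambda>t. S t \<omega>)" "\<And>t. continuous (at_right t) (\<lambda>t. S t \<omega>)" by auto
    let ?\<mu> = "path_measure S \<omega>"
    have s: "sets ?\<mu> = sets borel" by (rule regular_path_measure(1)[of S \<omega>, OF r(1)])
    show ?case
    proof (rule strict_mono_on_from_rationals)
      fix p q :: rat assume pq: "0 \<le> p" "p < q"
      let ?p = "of_rat p :: real" and ?q = "of_rat q :: real"
      have pq': "0 \<le> ?p" "?p < ?q" using pq by (simp_all add: of_rat_less)
      let ?k = "\<lambda>u. mvn_kernel a d (?q - ?p) (u - ?p)"
      have k: "mvn_kernel a d ?q u - mvn_kernel a d ?p u = ?k u" for u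
        using mvn_kernel_shift[of a d "?q - ?p" ?p u] by simp
      have int: "integrable ?\<mu> ?k"
        using Bochner_Integration.integrable_diff[of ?\<mu> "mvn_kernel a d ?q" "mvn_kernel a d ?p"] elim(4) by (simp add: k)
      have diff: "Y ?q \<omega> - Y ?p \<omega> = (\<integral>u. ?k u \<partial>?\<mu>)"
        using elim(4) by (simp add: k flip: Bochner_Integration.integral_diff)
      have nonneg: "0 \<le> ?k u" for u using pq' by (intro mvn_kernel_nonneg a d) simp
      have "(\<integral>u. ?k u \<partial>?\<mu>) \<noteq> 0"
      proof
        assume "(\<integral>u. ?k u \<partial>?\<mu>) = 0"
        then have "AE u in ?\<mu>. ?k u = 0"
          using integral_nonneg_eq_0_iff_AE[OF int] nonneg by simp
        then have "AE u in ?\<mu>. \<not> (0 < u \<and> u \<le> ?q / 2)"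
        proof eventually_elim
          case (elim u)
          have "0 < ?k u" if "u \<le> ?q / 2" by (intro mvn_kernel_pos a d) (use that pq' in linarith)+
          then show ?case using elim by auto
        qed
        then have "emeasure ?\<mu> {0<..?q / 2} = 0"
          by (subst (asm) AE_iff_measurable[where N = "{0<..?q / 2}"]) (auto simp: s regular_path_measure(2)[of S \<omega>, OF r(1)])
        moreover have "emeasure ?\<mu> {0<..?q / 2} = ennreal (S (?q / 2) \<omega> - S 0 \<omega>)"
        proof -
          have "0 \<le> ?q / 2" using pq' by linarith
          from emeasure_interval_measure_Ioc[OF this, of "\<lambda>t. S t \<omega>"] show ?thesis
            using r by (simp add: path_measure_def mono_def)
        qed
        moreover have "S 0 \<omega> < S (?q / 2) \<omega>"
        proof -
          have "0 < ?q" using pq' by linarith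
          then show ?thesis using strict_mono_onD[OF elim(2), of 0 "?q / 2"] by simp
        qed
        ultimately show False by simp
      qed
      moreover have "0 \<le> (\<integral>u. ?k u \<partial>?\<mu>)" using nonneg by (intro Bochner_Integration.integral_nonneg) simp
      ultimately show "Y ?p \<omega> < Y ?q \<omega>" using diff by linarith
    qed (rule elim(1))
  qed
qed

text \<open>Both \<open>Y\<close> and the centring are continuous in time, so a linear bound on their difference that holds at all
rational times holds at all times.\<close>

theorem strong_law_X:
  assumes int: "integrable M (S 1)" and Y: "continuous_modification M X Y"
  shows "AE \<omega> in M.
    ((\<lambda>t. (Y t \<omega> - expectation (S 1) * (LINT u|lborel. mvn_kernel a d t u)) / \<bar>t\<bar>) \<longlongrightarrow> 0) at_top \<and>
    ((\<lambda>t. (Y t \<omega> - expectation (S 1) * (LINT u|lborel. mvn_kernel a d t u)) / \<bar>t\<bar>) \<longlongrightarrow> 0) at_bot"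
proof -
  let ?m = "expectation (S 1)" and ?A = "a powr d" and ?I = "\<lambda>t. LINT u|lborel. mvn_kernel a d t u"
  have A: "0 < ?A" using a by simp
  have contI: "continuous_on UNIV ?I"
  proof (rule lipschitz_on_continuous_on)
    show "(2 * ?A)-lipschitz_on UNIV ?I"
      using integral_mvn_kernel_lipschitz[OF a d] by (intro lipschitz_onI) (auto simp: dist_real_def mult_ac)
  qed
  have "AE \<omega> in M. continuous_on UNIV (\<lambda>t. Y t \<omega>)" using Y by (simp add: continuous_modification_def)
  then show ?thesis using AE_linear_growth[OF int] AE_regular AE_modification_eq[OF Y]
  proof eventually_elim
    case (elim \<omega>)
    then have r: "mono (\<lambda>t. S t \<omega>)" "\<And>t. continuous (at_right t) (\<lambda>t. S t \<omega>)" by auto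
    define D where "D t = Y t \<omega> - ?m * ?I t" for t
    have contD: "continuous_on UNIV D" unfolding D_def by (intro continuous_intros elim(1) contI)
    have bound: "\<exists>C. \<forall>t. \<bar>D t\<bar> \<le> \<eta> * \<bar>t\<bar> + C" if \<eta>: "0 < \<eta>" for \<eta>
    proof -
      \<comment> \<open>The deviation estimate turns a slope \<open>\<epsilon>\<close> of the path into a slope \<open>4 * \<epsilon> * ?A\<close> of the integral.\<close>
      define \<epsilon> where "\<epsilon> = \<eta> / (4 * ?A)"
      have \<epsilon>: "0 < \<epsilon>" "4 * \<epsilon> * ?A = \<eta>" using \<eta> A by (auto simp: \<epsilon>_def)
      obtain C where C: "0 \<le> C" "\<And>u. \<bar>S u \<omega> - ?m * u\<bar> \<le> \<epsilon> * \<bar>u\<bar> + C" using elim(2) \<epsilon>(1) by blast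
      define C' where "C' = (?m + \<epsilon> + 2 * C) * ?A"
      have "\<bar>D (of_rat q)\<bar> \<le> \<eta> * \<bar>of_rat q\<bar> + C'" for q
      proof -
        have "D (of_rat q) = (\<integral>u. mvn_kernel a d (of_rat q) u \<partial>interval_measure (\<lambda>t. S t \<omega>)) - ?m * ?I (of_rat q)"
          using elim(4) r(1) by (simp add: D_def path_measure_def)
        also have "\<bar>\<dots>\<bar> \<le> 4 * \<epsilon> * ?A * \<bar>of_rat q\<bar> + C'"
          unfolding C'_def
          by (rule mvn_integral_deviation[OF r a d expectation_S_nonneg less_imp_le[OF \<epsilon>(1)] C])
        finally show ?thesis by (simp only: \<epsilon>(2))
      qed
      then have "\<bar>D (of_rat q)\<bar> - \<eta> * \<bar>of_rat q\<bar> \<le> C'" for q by (simp add: algebra_simps)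
      then have "\<bar>D t\<bar> - \<eta> * \<bar>t\<bar> \<le> C'" for t
        by (rule continuous_le_from_rationals[rotated]) (intro continuous_intros contD)
      then show ?thesis by (intro exI[of _ C']) (simp add: algebra_simps)
    qed
    have small: "\<exists>T. \<forall>t. T < \<bar>t\<bar> \<longrightarrow> \<bar>D t / \<bar>t\<bar>\<bar> < e" if e: "0 < e" for e
    proof -
      obtain C where C: "\<And>t. \<bar>D t\<bar> \<le> e / 2 * \<bar>t\<bar> + C" using bound[of "e / 2"] e by auto
      have "\<bar>D t / \<bar>t\<bar>\<bar> < e" if t: "max 0 (2 * C / e) < \<bar>t\<bar>" for t
      proof -
        have "C < e / 2 * \<bar>t\<bar>" using t e by (simp add: field_simps)
        then have "\<bar>D t\<bar> < e * \<bar>t\<bar>" using C[of t] by (simp add: field_simps)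
        then show ?thesis using t by (simp add: pos_divide_less_eq)
      qed
      then show ?thesis by blast
    qed
    have "((\<lambda>t. D t / \<bar>t\<bar>) \<longlongrightarrow> 0) at_top"
    proof (rule tendstoI)
      fix e :: real assume "0 < e"
      then obtain T where T: "\<And>t. T < \<bar>t\<bar> \<Longrightarrow> \<bar>D t / \<bar>t\<bar>\<bar> < e" using small by blast
      show "\<forall>\<^sub>F t in at_top. dist (D t / \<bar>t\<bar>) 0 < e"
        using eventually_gt_at_top[of T] eventually_gt_at_top[of 0]
      proof eventually_elim
        case (elim t)
        then have "\<bar>D t / \<bar>t\<bar>\<bar> < e" by (intro T) linarith
        then show ?case by (simp add: dist_real_def)
      qed
    qed
    moreover have "((\<lambda>t. D t / \<bar>t\<bar>) \<longlongrightarrow> 0) at_bot"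
    proof (rule tendstoI)
      fix e :: real assume "0 < e"
      then obtain T where T: "\<And>t. T < \<bar>t\<bar> \<Longrightarrow> \<bar>D t / \<bar>t\<bar>\<bar> < e" using small by blast
      show "\<forall>\<^sub>F t in at_bot. dist (D t / \<bar>t\<bar>) 0 < e"
        using eventually_gt_at_bot[of "- T"] eventually_gt_at_bot[of 0]
      proof eventually_elim
        case (elim t)
        then have "\<bar>D t / \<bar>t\<bar>\<bar> < e" by (intro T) linarith
        then show ?case by (simp add: dist_real_def)
      qed
    qed
    ultimately show ?case unfolding D_def by simp
  qed
qed

end

theorem proposition2p4:
  fixes M :: "'a measure" and S X :: "real \<Rightarrow> 'a \<Rightarrow> real" and a d :: real
  assumes "prob_space M"
    and "two_sided_subordinator M S"
    and "- (1/2) < d" and "d < 0" and "0 < a"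
    and "\<forall>t. has_subordinator_integral M S (mvn_kernel a d t) (X t)"
  shows "((AE \<omega> in M. strict_mono_on {0..} (\<lambda>t. S t \<omega>)) \<longrightarrow>
            (\<forall>Y. continuous_modification M X Y \<longrightarrow>
              (AE \<omega> in M. strict_mono_on {0..} (\<lambda>t. Y t \<omega>))))
       \<and> stationary_increments M X
       \<and> (integrable M (S 1) \<longrightarrow>
            (\<forall>Y. continuous_modification M X Y \<longrightarrow>
              (AE \<omega> in M.
                ((\<lambda>t. (Y t \<omega> - (LINT \<omega>'|M. S 1 \<omega>') * (LINT u|lborel. mvn_kernel a d t u)) / \<bar>t\<bar>)
                   \<longlongrightarrow> 0) at_top \<and>
                ((\<lambda>t. (Y t \<omega> - (LINT \<omega>'|M. S 1 \<omega>') * (LINT u|lborel. mvn_kernel a d t u)) / \<bar>t\<bar>)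
                   \<longlongrightarrow> 0) at_bot)))"
proof -
  obtain S1 S2 where S12: "subordinator M S1" "subordinator M S2" "same_fdd M {0..} S1 S2"
    "prob_space.indep_var M
       (\<Pi>\<^sub>M t\<in>{0..}. borel) (\<lambda>\<omega>. \<lambda>t\<in>{0..}. S1 t \<omega>)
       (\<Pi>\<^sub>M t\<in>{0..}. borel) (\<lambda>\<omega>. \<lambda>t\<in>{0..}. S2 t \<omega>)"
    "S = two_sided S1 S2"
    using assms(2) unfolding two_sided_subordinator_def by blast
  interpret fractional_subordinator M S1 S2 S X a d
  proof (intro fractional_subordinator.intro two_sided_process.intro two_sided_process_axioms.intro
      fractional_subordinator_axioms.intro)
    show "- 1 < d" using assms(3) by simp
    show "has_subordinator_integral M S (mvn_kernel a d t) (X t)" for t using assms(6) by blast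
  qed (rule assms(1,4,5) S12)+
  show ?thesis
  proof (rule conjI[OF impI conjI[OF stationary_increments_X impI]], goal_cases)
    case 1
    show ?case by (intro allI impI) (rule strictly_increasing_paths[OF 1])
  next
    case 2
    show ?case by (intro allI impI) (rule strong_law_X[OF 2])
  qed
qed

end
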